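(* Let $\lambda'>\lambda>0$ be real numbers. There is no equivariant thickening from intensity $\lambda$ to intensity $\lambda'$. That is, there is no measurable function $f:\mathbb{M}\to\mathbb{M}$ such that $X\cup f(X)$ is a Poisson process on $\mathbb{R}$ of intensity $\lambda'$ whenever $X$ is a Poisson process on $\mathbb{R}$ of intensity $\lambda$, and such that $\sigma\circ f=f\circ\sigma$ for every shift (translation) $\sigma:\mathbb{R}\to\mathbb{R}$.
   Context: $\mathbb{M}$ denotes the space of locally finite subsets of $\mathbb{R}$, endowed with the minimal $\sigma$-algebra under which all maps $\mu_B:S\mapsto |S\cap B|$, for $B\subset\mathbb{R}$ Borel, are measurable. Poisson processes on $\mathbb{R}$ (homogeneous, with intensity with respect to Lebesgue measure) are viewed as random elements of $\mathbb{M}$. For $\lambda'>\lambda>0$, a measurable function $f:\mathbb{M}\to\mathbb{M}$ is a thickening from intensity $\lambda$ to $\lambda'$ if $X\cup f(X)$ is a Poisson process of intensity $\lambda'$ when $X$ is a Poisson process of intensity $\lambda$. A shift $\sigma:\mathbb{R}\to\mathbb{R}$ acts on $\mathbb{M}$ by $\sigma(S)=\{\sigma(s): s\in S\}$. A thickening $f$ is equivariant if $\sigma\circ f=f\circ\sigma$ (as functions on $\mathbb{M}$) for every shift $\sigma$ of $\mathbb{R}$. *)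

theory Defs
  imports "HOL-Probability.Probability"
begin

definition locally_finite :: "real set \<Rightarrow> bool" where
  "locally_finite S \<longleftrightarrow> (\<forall>B. bounded B \<longrightarrow> finite (S \<inter> B))"

(* The counting map, with value infinity when the intersection is infinite
   (card would give 0 there). *)
definition num_points :: "real set \<Rightarrow> real set \<Rightarrow> ennreal" where
  "num_points B S = emeasure (count_space UNIV) (S \<inter> B)"

(* Only space and sets of this measure matter; compare subprob_algebra, which
   is built in the same way. *)
definition configs :: "real set measure" where
  "configs = (SUP B \<in> sets borel. vimage_algebra {S. locally_finite S} (num_points B) borel)"

(* The counts are almost surely infinite on Borel sets of infinite measure; this
   follows from the clauses below.  The explicit mass function is used instead of
   poisson_pmf because the rate may be 0 (0 ^ 0 = 1 makes the formula right then). *)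
definition poisson_process :: "real \<Rightarrow> 'w measure \<Rightarrow> ('w \<Rightarrow> real set) \<Rightarrow> bool" where
  "poisson_process l P X \<longleftrightarrow>
     prob_space P \<and>
     X \<in> P \<rightarrow>\<^sub>M configs \<and>
     (\<forall>B \<in> sets borel. emeasure lborel B < \<infinity> \<longrightarrow>
        (\<forall>k::nat. measure P {w \<in> space P. num_points B (X w) = of_nat k} =
           (l * measure lborel B) ^ k / fact k * exp (- (l * measure lborel B)))) \<and>
     (\<forall>(I :: nat set) B. finite I \<longrightarrow> (\<forall>i\<in>I. B i \<in> sets borel) \<longrightarrow> disjoint_family_on B I \<longrightarrow>
        prob_space.indep_vars P (\<lambda>_. borel) (\<lambda>i w. num_points (B i) (X w)) I)"

(* HOL cannot quantify over the type of the sample space inside a formula, so the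
   sample spaces range over the probability spaces on real set, the type that carries
   the laws of X.  Lemma thickeningD transfers the property to every sample space. *)
definition thickening :: "real \<Rightarrow> real \<Rightarrow> (real set \<Rightarrow> real set) \<Rightarrow> bool" where
  "thickening l l' f \<longleftrightarrow>
     f \<in> configs \<rightarrow>\<^sub>M configs \<and>
     (\<forall>(P :: real set measure) X.
        poisson_process l P X \<longrightarrow> poisson_process l' P (\<lambda>w. X w \<union> f (X w)))"

definition shift :: "real \<Rightarrow> real set \<Rightarrow> real set" where
  "shift t S = (\<lambda>s. s + t) ` S"

definition equivariant :: "(real set \<Rightarrow> real set) \<Rightarrow> bool" where
  "equivariant f \<longleftrightarrow> (\<forall>t. \<forall>S \<in> space configs. shift t (f S) = f (shift t S))"

lemma space_configs: "space configs = {S. locally_finite S}"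
  by (auto simp: configs_def space_Sup_eq_UN)

lemma measurable_num_points [measurable]:
  "B \<in> sets borel \<Longrightarrow> num_points B \<in> borel_measurable configs"
  by (auto intro!: measurable_Sup1 measurable_vimage_algebra1 simp: configs_def)

lemma measurable_configsI:
  assumes "\<And>w. w \<in> space P \<Longrightarrow> locally_finite (X w)"
    and "\<And>B. B \<in> sets borel \<Longrightarrow> (\<lambda>w. num_points B (X w)) \<in> borel_measurable P"
  shows "X \<in> P \<rightarrow>\<^sub>M configs"
  unfolding configs_def
  by (intro measurable_SUP2 measurable_vimage_algebra2) (use assms in auto)

lemma (in prob_space) indep_vars_iff_prod:
  "indep_vars M' Y I \<longleftrightarrow> (\<forall>i\<in>I. random_variable (M' i) (Y i)) \<and>
     (\<forall>J\<subseteq>I. J \<noteq> {} \<longrightarrow> finite J \<longrightarrow> (\<forall>A\<in>Pi J (\<lambda>i. sets (M' i)).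
        prob (\<Inter>j\<in>J. Y j -` A j \<inter> space M) = (\<Prod>j\<in>J. prob (Y j -` A j \<inter> space M))))"
  (is "_ \<longleftrightarrow> _ \<and> ?R")
proof (intro iffI conjI; (elim conjE)?)
  assume L: "indep_vars M' Y I"
  then show "\<forall>i\<in>I. random_variable (M' i) (Y i)" by (simp add: indep_vars_def2)
  show ?R
  proof (intro allI impI ballI)
    fix J A assume J: "J \<subseteq> I" "J \<noteq> {}" "finite J" and A: "A \<in> Pi J (\<lambda>i. sets (M' i))"
    have ind: "indep_sets (\<lambda>i. {Y i -` A \<inter> space M |A. A \<in> sets (M' i)}) I"
      using L by (simp add: indep_vars_def2)
    have mem: "\<forall>j\<in>J. Y j -` A j \<inter> space M \<in> {Y j -` A \<inter> space M |A. A \<in> sets (M' j)}"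
      using A by blast
    show "prob (\<Inter>j\<in>J. Y j -` A j \<inter> space M) = (\<Prod>j\<in>J. prob (Y j -` A j \<inter> space M))"
      by (rule indep_setsD[OF ind J mem])
  qed
next
  assume rv: "\<forall>i\<in>I. random_variable (M' i) (Y i)" and R: ?R
  show "indep_vars M' Y I"
    unfolding indep_vars_def2
  proof (intro conjI rv indep_setsI)
    fix i assume "i \<in> I"
    then show "{Y i -` A \<inter> space M |A. A \<in> sets (M' i)} \<subseteq> events"
      using rv by (auto intro!: measurable_sets)
  next
    fix E J assume J: "J \<noteq> {}" "J \<subseteq> I" "finite J"
      and E: "\<forall>j\<in>J. E j \<in> {Y j -` A \<inter> space M |A. A \<in> sets (M' j)}"
    have "\<forall>j\<in>J. \<exists>A. E j = Y j -` A \<inter> space M \<and> A \<in> sets (M' j)" using E by blast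
    then obtain A where A: "\<And>j. j \<in> J \<Longrightarrow> E j = Y j -` A j \<inter> space M \<and> A j \<in> sets (M' j)"
      by metis
    then have "A \<in> Pi J (\<lambda>i. sets (M' i))" by auto
    with R J have eq: "prob (\<Inter>j\<in>J. Y j -` A j \<inter> space M) = (\<Prod>j\<in>J. prob (Y j -` A j \<inter> space M))"
      by blast
    have "\<Inter> (E ` J) = (\<Inter>j\<in>J. Y j -` A j \<inter> space M)"
      using A by (intro INF_cong) auto
    moreover have "(\<Prod>j\<in>J. prob (E j)) = (\<Prod>j\<in>J. prob (Y j -` A j \<inter> space M))"
      using A by (intro prod.cong) auto
    ultimately show "prob (\<Inter> (E ` J)) = (\<Prod>j\<in>J. prob (E j))" using eq by simp
  qed
qed

lemma indep_vars_distr_iff: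
  assumes "prob_space P" and X: "X \<in> P \<rightarrow>\<^sub>M N" and Y: "\<And>i. i \<in> I \<Longrightarrow> Y i \<in> N \<rightarrow>\<^sub>M M' i"
  shows "prob_space.indep_vars (distr P N X) M' Y I \<longleftrightarrow>
         prob_space.indep_vars P M' (\<lambda>i w. Y i (X w)) I"
proof -
  interpret P: prob_space P by fact
  interpret D: prob_space "distr P N X" by (rule P.prob_space_distr[OF X])
  have YX: "(\<lambda>w. Y i (X w)) \<in> P \<rightarrow>\<^sub>M M' i" if "i \<in> I" for i
    using measurable_compose[OF X Y[OF that]] .
  have m: "measure (distr P N X) (\<Inter>j\<in>J. Y j -` A j \<inter> space N) =
           measure P (\<Inter>j\<in>J. (\<lambda>w. Y j (X w)) -` A j \<inter> space P)"
    if J: "J \<subseteq> I" "J \<noteq> {}" "finite J" and A: "\<And>j. j \<in> J \<Longrightarrow> A j \<in> sets (M' j)" for J A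
  proof -
    have "(\<Inter>j\<in>J. Y j -` A j \<inter> space N) \<in> sets N"
      using J A Y by (intro sets.finite_INT) (auto intro!: measurable_sets)
    moreover have "X -` (\<Inter>j\<in>J. Y j -` A j \<inter> space N) \<inter> space P =
        (\<Inter>j\<in>J. (\<lambda>w. Y j (X w)) -` A j \<inter> space P)"
      using J measurable_space[OF X] by auto
    ultimately show ?thesis using X by (simp add: measure_distr)
  qed
  have m1: "measure (distr P N X) (Y j -` A \<inter> space N) =
           measure P ((\<lambda>w. Y j (X w)) -` A \<inter> space P)"
    if "j \<in> I" "A \<in> sets (M' j)" for j A
    using m[of "{j}" "\<lambda>_. A"] that by simp
  have eq: "measure (distr P N X) (\<Inter>j\<in>J. Y j -` A j \<inter> space N) =
        (\<Prod>j\<in>J. measure (distr P N X) (Y j -` A j \<inter> space N)) \<longleftrightarrow>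
      measure P (\<Inter>j\<in>J. (\<lambda>w. Y j (X w)) -` A j \<inter> space P) =
        (\<Prod>j\<in>J. measure P ((\<lambda>w. Y j (X w)) -` A j \<inter> space P))"
    if J: "J \<subseteq> I" "J \<noteq> {}" "finite J" and A: "A \<in> Pi J (\<lambda>i. sets (M' i))" for J A
  proof -
    have "(\<Prod>j\<in>J. measure (distr P N X) (Y j -` A j \<inter> space N)) =
          (\<Prod>j\<in>J. measure P ((\<lambda>w. Y j (X w)) -` A j \<inter> space P))"
      using J A by (intro prod.cong refl m1) auto
    moreover have "measure (distr P N X) (\<Inter>j\<in>J. Y j -` A j \<inter> space N) =
        measure P (\<Inter>j\<in>J. (\<lambda>w. Y j (X w)) -` A j \<inter> space P)"
      using A by (intro m J) auto
    ultimately show ?thesis by simp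
  qed
  have rv: "\<forall>i\<in>I. Y i \<in> distr P N X \<rightarrow>\<^sub>M M' i" "\<forall>i\<in>I. (\<lambda>w. Y i (X w)) \<in> P \<rightarrow>\<^sub>M M' i"
    using Y YX by auto
  show ?thesis
    unfolding D.indep_vars_iff_prod P.indep_vars_iff_prod space_distr
    using rv eq by meson
qed

lemma poisson_process_distr_iff:
  assumes P: "prob_space P" and X: "X \<in> P \<rightarrow>\<^sub>M configs" and Y: "Y \<in> configs \<rightarrow>\<^sub>M configs"
  shows "poisson_process l (distr P configs X) Y \<longleftrightarrow> poisson_process l P (\<lambda>w. Y (X w))"
proof -
  have N: "num_points B \<in> borel_measurable configs" if "B \<in> sets borel" for B
    using that by simp
  have NY: "(\<lambda>S. num_points B (Y S)) \<in> borel_measurable configs" if "B \<in> sets borel" for B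
    using measurable_compose[OF Y N[OF that]] .
  have m: "measure (distr P configs X) {S \<in> space configs. num_points B (Y S) = of_nat k} =
      measure P {w \<in> space P. num_points B (Y (X w)) = of_nat k}" if "B \<in> sets borel" for B k
  proof -
    have "{S \<in> space configs. num_points B (Y S) = of_nat k} \<in> sets configs"
      using NY[OF that] by measurable
    moreover have "X -` {S \<in> space configs. num_points B (Y S) = of_nat k} \<inter> space P =
        {w \<in> space P. num_points B (Y (X w)) = of_nat k}"
      using measurable_space[OF X] by auto
    ultimately show ?thesis using X by (simp add: measure_distr)
  qed
  have i: "prob_space.indep_vars (distr P configs X) (\<lambda>_. borel) (\<lambda>i S. num_points (B i) (Y S)) I \<longleftrightarrow>
      prob_space.indep_vars P (\<lambda>_. borel) (\<lambda>i w. num_points (B i) (Y (X w))) I"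
    if "\<forall>i\<in>I. B i \<in> sets borel" for B and I :: "nat set"
    by (rule indep_vars_distr_iff[OF P X]) (use that NY in auto)
  show ?thesis
    unfolding poisson_process_def
    using P prob_space.prob_space_distr[OF P X] measurable_compose[OF X Y] Y
    by (simp add: m i cong: conj_cong imp_cong ball_cong)
qed

lemma thickeningD:
  fixes P :: "'w measure"
  assumes f: "thickening l l' f" and X: "poisson_process l P X"
  shows "poisson_process l' P (\<lambda>w. X w \<union> f (X w))"
proof -
  have P: "prob_space P" and mX: "X \<in> P \<rightarrow>\<^sub>M configs"
    using X by (auto simp: poisson_process_def)
  have "poisson_process l (distr P configs X) (\<lambda>S. S)"
    using X by (simp add: poisson_process_distr_iff[OF P mX])
  then have Q: "poisson_process l' (distr P configs X) (\<lambda>S. S \<union> f S)"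
    using f by (auto simp: thickening_def)
  then have "(\<lambda>S. S \<union> f S) \<in> configs \<rightarrow>\<^sub>M configs"
    by (simp add: poisson_process_def)
  from Q show ?thesis
    by (simp add: poisson_process_distr_iff[OF P mX \<open>(\<lambda>S. S \<union> f S) \<in> configs \<rightarrow>\<^sub>M configs\<close>])
qed

end

theory Submission
  imports Defs
begin

text \<open>Suppose that \<open>f\<close> is an equivariant thickening, let \<open>X\<close> be a Poisson process of intensity \<open>l\<close>
and put \<open>Y = X \<union> f X\<close>, a Poisson process of intensity \<open>l'\<close>.  The contradiction is a count of
information.

Fix a small block length \<open>\<epsilon> = 1 / 2 ^ m\<close>.  Whether \<open>Y\<close> meets the block \<open>{0..<\<epsilon>}\<close> is a measurable
function of \<open>X\<close>, so up to an error of probability \<open>\<theta>\<close> it is a function of the numbers of points of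
\<open>X\<close> in finitely many dyadic cells (lemma \<open>approximation_by_local_event\<close>).  Since \<open>f\<close> commutes with
shifts and the law of \<open>X\<close> is invariant under them (lemma \<open>poisson_process_stationary\<close>), the same
function decides for every block of a window of length \<open>N\<close> whether \<open>Y\<close> meets it, and with high
probability it is wrong for only a small multiple of \<open>N\<close> blocks, the multiple being as small as one
likes by the choice of \<open>\<theta>\<close> after \<open>\<epsilon>\<close>.  So \<open>Y\<close> contains a set \<open>X\<close> of about \<open>l * N\<close> points which
nearly knows the blocks of all the other points of \<open>Y\<close>, of which there are about \<open>(l' - l) * N\<close>.

A Poisson process \<open>Y\<close> is unlikely to contain any such set.  The ways to choose the points of \<open>X\<close>
among those of \<open>Y\<close> cost a factor \<open>exp (O N)\<close>.  Once \<open>X\<close> and the wrongly predicted blocks are fixed,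
the remaining points, which are independent of the chosen ones, must all fall into the at most
\<open>O N\<close> occupied blocks, a set whose proportion in the window is \<open>O \<epsilon>\<close>; this has a probability of
order \<open>\<epsilon> powr ((l' - l) * N)\<close> up to factors \<open>exp (O N)\<close>.  Naming \<open>\<kappa> * N\<close> wrong blocks costs only
about \<open>\<epsilon> powr (- \<kappa> * N)\<close>.  If \<open>\<kappa>\<close> is small compared with \<open>l' - l\<close> and then \<open>\<epsilon>\<close> is small enough, the
product is exponentially small in \<open>N\<close> (lemmas \<open>weight_of_completions_le\<close> and
\<open>prob_reconstructible_window_le\<close>).  On a grid of cells all of this is a finite sum over vectors of
independent Poisson counts.

Thickenings are defined by a condition on all Poisson processes of intensity \<open>l\<close>, so this refutes
their existence only if there is at least one such process.  It is constructed from independent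
unit cells in lemma \<open>poisson_process_poisson_points\<close>; the joint law of its counts is read off from
their generating function.\<close>

section \<open>Counting the ways to complete a sparse configuration\<close>

lemma sum_power_card_Pow:
  fixes a :: real
  assumes "finite J"
  shows "(\<Sum>D\<in>Pow J. a ^ card D) = (1 + a) ^ card J"
proof -
  have "(\<Prod>j\<in>J. (\<lambda>_. a) j + (\<lambda>_. 1) j) = (\<Sum>D\<in>Pow J. (\<Prod>j\<in>D. a) * (\<Prod>j\<in>J - D. 1))"
    using assms by (rule prod_add)
  then show ?thesis by (simp add: add.commute)
qed

lemma exp_partial_sum_le:
  fixes q :: real
  assumes "0 \<le> q"
  shows "(\<Sum>k\<le>T. q ^ k / fact k) \<le> exp q"
proof -
  have s: "(\<lambda>k. q ^ k / fact k) sums exp q"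
    using exp_converges[of q] by (simp add: divide_inverse mult.commute)
  have "(\<Sum>k\<le>T. q ^ k / fact k) \<le> (\<Sum>k. q ^ k / fact k)"
    by (rule sum_le_suminf) (use s assms in \<open>auto simp: sums_iff\<close>)
  then show ?thesis using s by (simp add: sums_iff)
qed

definition occupied :: "'i set \<Rightarrow> 'j set \<Rightarrow> ('i \<Rightarrow> 'j) \<Rightarrow> ('i \<Rightarrow> nat) \<Rightarrow> 'j set" where
  "occupied I J blk v = {j \<in> J. \<exists>i\<in>I. blk i = j \<and> 0 < v i}"

text \<open>The entropy estimate.  Cells \<open>i \<in> I\<close> are grouped into blocks by \<open>blk\<close>; cells whose label is not in
\<open>J\<close> form a boundary about which nothing is assumed.  The vector \<open>x\<close> holds the counts of a known
process, \<open>R\<close> is the set of blocks that it predicts to be occupied, and \<open>z\<close> ranges over the counts of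
at least \<open>a\<close> further points for which this prediction fails in at most \<open>w\<close> blocks.

Let \<open>D\<close> be the set of blocks where the prediction fails.  Given \<open>D\<close> and \<open>R\<close>, the occupied blocks are
known, so \<open>z\<close> lives on the few cells in these blocks and on the boundary, and the sum of the weights
factorises over these cells.  The bounds on the number of points and on \<open>D\<close> enter through the factor
\<open>q powr (sum z - a) * q powr (w - card D) \<ge> 1\<close>: it replaces \<open>\<mu>\<close> by \<open>\<mu> * q\<close> in each cell, and the sum
over \<open>D\<close> of what remains is a binomial expansion.  The parameter \<open>q\<close> will be the number of blocks
per unit length, which makes \<open>(1 + 1 / q) ^ card J\<close> and, apart from the boundary term, the last factor exponential
in the length of the window at a rate that does not depend on \<open>q\<close>, while \<open>q powr (w - a)\<close> has a base that can be
made as large as desired.\<close>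

lemma weight_of_completions_le:
  fixes \<mu> q a b w :: real and I :: "'i set" and J :: "'j set" and x :: "'i \<Rightarrow> nat"
  assumes fin: "finite I" "finite J" and q: "1 \<le> q" and mu: "0 \<le> \<mu>" and s: "0 \<le> s" 
    and fib: "\<And>j. j \<in> J \<Longrightarrow> real (card {i\<in>I. blk i = j}) \<le> s"
    and bdry: "real (card {i\<in>I. blk i \<notin> J}) \<le> v"
    and R: "R \<subseteq> J"
    and Z: "Z \<subseteq> PiE I (\<lambda>_. {..T})"
    and Z1: "\<And>z. z \<in> Z \<Longrightarrow> a \<le> real (\<Sum>i\<in>I. z i)"
    and Z2: "\<And>z. z \<in> Z \<Longrightarrow> real (card (occupied I J blk (\<lambda>i. x i + z i))) \<le> b"
    and Z3: "\<And>z. z \<in> Z \<Longrightarrow> real (card (sym_diff (occupied I J blk (\<lambda>i. x i + z i)) R)) \<le> w"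
  shows "(\<Sum>z\<in>Z. \<Prod>i\<in>I. \<mu> ^ z i / fact (z i))
       \<le> q powr (w - a) * (1 + 1 / q) ^ card J * exp (\<mu> * q * (b * s + v))"
proof -
  define occ where "occ z = occupied I J blk (\<lambda>i. x i + z i)" for z
  define g where "g z = (\<Prod>i\<in>I. \<mu> ^ z i / fact (z i))" for z
  define gq where "gq z = (\<Prod>i\<in>I. (\<mu> * q) ^ z i / fact (z i))" for z :: "'i \<Rightarrow> nat"
  define E where "E = exp (\<mu> * q * (b * s + v))"
  have q0: "0 < q" using q by simp
  have finZ: "finite Z" using Z fin by (meson finite_PiE finite_atMost finite_subset)
  have gq0: "0 \<le> gq z" for z unfolding gq_def using mu q0 by (intro prod_nonneg) auto
  have occJ: "occ z \<subseteq> J" for z by (auto simp: occ_def occupied_def)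
  have gq_g: "gq z = q powr (real (\<Sum>i\<in>I. z i)) * g z" for z
  proof -
    have "gq z = (\<Prod>i\<in>I. q ^ z i * (\<mu> ^ z i / fact (z i)))"
      unfolding gq_def by (intro prod.cong) (auto simp: power_mult_distrib)
    also have "\<dots> = (\<Prod>i\<in>I. q ^ z i) * g z" unfolding g_def by (rule prod.distrib)
    also have "(\<Prod>i\<in>I. q ^ z i) = q ^ (\<Sum>i\<in>I. z i)" by (rule power_sum[symmetric])
    also have "q ^ (\<Sum>i\<in>I. z i) = q powr (real (\<Sum>i\<in>I. z i))"
      using q0 by (simp only: powr_realpow)
    finally show ?thesis .
  qed
  \<comment> \<open>the occupied blocks are the symmetric difference of \<open>D\<close> and \<open>R\<close>, hence the same for all \<open>z\<close> in the sum\<close>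
  have key: "(\<Sum>z\<in>{z\<in>Z. sym_diff (occ z) R = D}. gq z) \<le> E" if D: "D \<subseteq> J" for D
  proof (cases "{z\<in>Z. sym_diff (occ z) R = D} = {}")
    case True
    then show ?thesis unfolding True E_def by simp
  next
    case False
    then obtain z0 where z0: "z0 \<in> Z" "sym_diff (occ z0) R = D" by blast
    define J' where "J' = sym_diff D R"
    have J': "J' = occ z" if "sym_diff (occ z) R = D" for z
      using that by (auto simp: J'_def)
    have J'J: "J' \<subseteq> J" using J'[OF z0(2)] occJ by simp
    have cJ': "real (card J') \<le> b" using Z2[OF z0(1)] J'[OF z0(2)] by (simp add: occ_def)
    define B where "B = {i\<in>I. blk i \<notin> J} \<union> (\<Union>j\<in>J'. {i\<in>I. blk i = j})"
    have BI: "B \<subseteq> I" by (auto simp: B_def)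
    have "finite J'" using J'J fin(2) by (rule finite_subset)
    then have "card (\<Union>j\<in>J'. {i\<in>I. blk i = j}) \<le> (\<Sum>j\<in>J'. card {i\<in>I. blk i = j})"
      by (rule card_UN_le)
    then have "real (card (\<Union>j\<in>J'. {i\<in>I. blk i = j})) \<le> (\<Sum>j\<in>J'. real (card {i\<in>I. blk i = j}))"
      unfolding of_nat_sum[symmetric] by (rule of_nat_mono)
    also have "\<dots> \<le> (\<Sum>j\<in>J'. s)" by (intro sum_mono fib) (use J'J in auto)
    also have "\<dots> \<le> b * s" using cJ' s by (simp add: mult_right_mono)
    finally have 1: "real (card (\<Union>j\<in>J'. {i\<in>I. blk i = j})) \<le> b * s" .
    have "card B \<le> card {i\<in>I. blk i \<notin> J} + card (\<Union>j\<in>J'. {i\<in>I. blk i = j})"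
      unfolding B_def by (rule card_Un_le)
    then have cB: "real (card B) \<le> b * s + v" using 1 bdry by linarith
    have sub: "{z\<in>Z. sym_diff (occ z) R = D} \<subseteq> PiE I (\<lambda>i. if i \<in> B then {..T} else {0})"
    proof
      fix z assume "z \<in> {z\<in>Z. sym_diff (occ z) R = D}"
      then have zZ: "z \<in> Z" and zD: "sym_diff (occ z) R = D" by auto
      have zP: "z \<in> PiE I (\<lambda>_. {..T})" using Z zZ by auto
      have "z i = 0" if "i \<in> I" "i \<notin> B" for i
      proof (rule ccontr)
        assume "z i \<noteq> 0"
        moreover have "blk i \<in> J" "blk i \<notin> J'" using that by (auto simp: B_def)
        ultimately have "blk i \<in> occ z" using that by (auto simp: occ_def occupied_def)
        with J'[OF zD] \<open>blk i \<notin> J'\<close> show False by simp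
      qed
      then show "z \<in> PiE I (\<lambda>i. if i \<in> B then {..T} else {0})"
        using zP by (auto simp: PiE_iff)
    qed
    have "(\<Sum>z\<in>{z\<in>Z. sym_diff (occ z) R = D}. gq z)
        \<le> (\<Sum>z\<in>PiE I (\<lambda>i. if i \<in> B then {..T} else {0}). gq z)"
      by (rule sum_mono2) (use sub gq0 fin in \<open>auto intro!: finite_PiE\<close>)
    also have "\<dots> = (\<Prod>i\<in>I. \<Sum>k\<in>(if i \<in> B then {..T} else {0}). (\<mu> * q) ^ k / fact k)"
      unfolding gq_def using fin by (subst prod_sum_PiE) auto
    also have "\<dots> \<le> (\<Prod>i\<in>I. if i \<in> B then exp (\<mu> * q) else 1)"
    proof (rule prod_mono)
      fix i assume "i \<in> I"
      have "0 \<le> \<mu> * q" using mu q0 by simp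
      then show "0 \<le> (\<Sum>k\<in>(if i \<in> B then {..T} else {0}). (\<mu> * q) ^ k / fact k) \<and>
        (\<Sum>k\<in>(if i \<in> B then {..T} else {0}). (\<mu> * q) ^ k / fact k) \<le> (if i \<in> B then exp (\<mu> * q) else 1)"
        using exp_partial_sum_le[of "\<mu> * q" T] by (auto intro!: sum_nonneg)
    qed
    also have "\<dots> = exp (\<mu> * q) ^ card B"
    proof -
      have "(\<Prod>i\<in>I. if i \<in> B then exp (\<mu> * q) else 1) = (\<Prod>i\<in>B. exp (\<mu> * q))"
        using BI fin by (intro prod.mono_neutral_cong_right) auto
      then show ?thesis by simp
    qed
    also have "\<dots> = exp (\<mu> * q * real (card B))" by (metis exp_of_nat_mult mult.commute)
    also have "\<dots> \<le> E" unfolding E_def using cB mu q0 by (simp add: mult_left_mono)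
    finally show ?thesis .
  qed
  \<comment> \<open>the tilting factor, which is at least 1 on \<open>Z\<close>\<close>
  have pt: "g z \<le> q powr (w - a) * ((1 / q) ^ card (sym_diff (occ z) R) * gq z)" if "z \<in> Z" for z
  proof -
    let ?d = "card (sym_diff (occ z) R)"
    have "0 \<le> g z" unfolding g_def using mu by (intro prod_nonneg) auto
    moreover have "1 \<le> q powr (w - a) * ((1 / q) ^ ?d * q powr (real (\<Sum>i\<in>I. z i)))"
    proof -
      have "(1 / q) ^ ?d = q powr (- real ?d)"
        using q0 by (simp add: powr_minus powr_realpow divide_inverse power_inverse)
      then have "q powr (w - a) * ((1 / q) ^ ?d * q powr (real (\<Sum>i\<in>I. z i)))
          = q powr ((w - a) + (- real ?d + real (\<Sum>i\<in>I. z i)))"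
        by (simp only: powr_add)
      moreover have "0 \<le> (w - a) + (- real ?d + real (\<Sum>i\<in>I. z i))"
        using Z1[OF that] Z3[OF that] by (simp add: occ_def)
      ultimately show ?thesis using q by (simp only: ge_one_powr_ge_zero)
    qed
    ultimately have "1 * g z \<le> q powr (w - a) * ((1 / q) ^ ?d * q powr (real (\<Sum>i\<in>I. z i))) * g z"
      by (intro mult_right_mono)
    then show ?thesis by (simp add: gq_g mult.assoc)
  qed
  have "(\<Sum>z\<in>Z. g z) \<le> (\<Sum>z\<in>Z. q powr (w - a) * ((1 / q) ^ card (sym_diff (occ z) R) * gq z))"
    by (intro sum_mono pt)
  also have "\<dots> = q powr (w - a) * (\<Sum>z\<in>Z. (1 / q) ^ card (sym_diff (occ z) R) * gq z)"
    by (simp add: sum_distrib_left)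
  also have "(\<Sum>z\<in>Z. (1 / q) ^ card (sym_diff (occ z) R) * gq z)
      = (\<Sum>D\<in>Pow J. \<Sum>z\<in>{z\<in>Z. sym_diff (occ z) R = D}. (1 / q) ^ card (sym_diff (occ z) R) * gq z)"
    by (rule sum.group[symmetric]) (use finZ fin occJ R in auto)
  also have "\<dots> = (\<Sum>D\<in>Pow J. (1 / q) ^ card D * (\<Sum>z\<in>{z\<in>Z. sym_diff (occ z) R = D}. gq z))"
    by (simp add: sum_distrib_left)
  also have "\<dots> \<le> (\<Sum>D\<in>Pow J. (1 / q) ^ card D * E)"
    using q0 by (intro sum_mono mult_left_mono key) auto
  also have "\<dots> = (1 + 1 / q) ^ card J * E"
    using fin by (simp add: sum_power_card_Pow flip: sum_distrib_right)
  finally show ?thesis using q0 by (simp add: g_def E_def mult.assoc mult_left_mono)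
qed

text \<open>The rate may be 0, which is the rate of the count in a null set.\<close>

definition poisson_weight :: "real \<Rightarrow> nat \<Rightarrow> real" where
  "poisson_weight \<mu> k = \<mu> ^ k / fact k * exp (- \<mu>)"

text \<open>The inequality \<open>j! * k! \<le> (j + k)!\<close> separates the points of the sparse process from the added
ones.  It amounts to summing over all ways to choose \<open>j\<close> of \<open>j + k\<close> points without dividing by their
number; the missing factor \<open>exp (- \<mu>)\<close> for the added points accounts for this loss.\<close>

lemma poisson_weight_add_le:
  assumes "0 \<le> \<mu>"
  shows "poisson_weight \<mu> (j + k) \<le> poisson_weight \<mu> j * (\<mu> ^ k / fact k)"
proof -
  have "fact j * fact k \<le> (fact (j + k) :: nat)"
    by (rule dvd_imp_le[OF fact_fact_dvd_fact]) simp
  then have "real (fact j * fact k) \<le> real (fact (j + k))"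
    by (simp only: of_nat_le_iff)
  then have "fact j * fact k \<le> (fact (j + k) :: real)"
    by simp
  then have "\<mu> ^ (j + k) / fact (j + k) \<le> \<mu> ^ (j + k) / (fact j * fact k)"
    using assms by (intro divide_left_mono) auto
  then have "\<mu> ^ (j + k) / fact (j + k) * exp (- \<mu>) \<le> \<mu> ^ (j + k) / (fact j * fact k) * exp (- \<mu>)"
    by (intro mult_right_mono) auto
  then show ?thesis by (simp add: poisson_weight_def power_add field_simps)
qed

lemma poisson_weight_nonneg: "0 \<le> \<mu> \<Longrightarrow> 0 \<le> poisson_weight \<mu> k"
  by (simp add: poisson_weight_def)

lemma sum_prod_poisson_weight_le:
  assumes "finite I" "0 \<le> \<mu>"
  shows "(\<Sum>x\<in>PiE I (\<lambda>_. {..T}). \<Prod>i\<in>I. poisson_weight \<mu> (x i)) \<le> 1"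
proof -
  have "(\<Sum>x\<in>PiE I (\<lambda>_. {..T}). \<Prod>i\<in>I. poisson_weight \<mu> (x i)) = (\<Prod>i\<in>I. \<Sum>k\<le>T. poisson_weight \<mu> k)"
    using assms by (subst prod_sum_PiE) auto
  also have "\<dots> \<le> (\<Prod>i\<in>I. 1)"
  proof (rule prod_mono)
    fix i
    have "(\<Sum>k\<le>T. poisson_weight \<mu> k) = (\<Sum>k\<le>T. \<mu> ^ k / fact k) * exp (- \<mu>)"
      by (simp add: poisson_weight_def sum_distrib_right)
    also have "\<dots> \<le> exp \<mu> * exp (- \<mu>)"
      using assms by (intro mult_right_mono exp_partial_sum_le) auto
    finally show "0 \<le> (\<Sum>k\<le>T. poisson_weight \<mu> k) \<and> (\<Sum>k\<le>T. poisson_weight \<mu> k) \<le> 1"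
      using assms by (auto intro!: sum_nonneg poisson_weight_nonneg simp flip: exp_add)
  qed
  finally show ?thesis by simp
qed

text \<open>A union bound over all splittings of a vector of Poisson counts into a sparse part \<open>x\<close> and an added
part \<open>z\<close>: if every \<open>x\<close> has few completions by weight, then it is unlikely that any admissible
splitting exists, because the weights of the \<open>x\<close> have total mass at most 1.\<close>

lemma sum_poisson_pairs_le:
  assumes fin: "finite I" and mu: "0 \<le> \<mu>"
    and E: "E \<subseteq> PiE I (\<lambda>_. {..T}) \<times> PiE I (\<lambda>_. {..T})"
    and bd: "\<And>x. x \<in> PiE I (\<lambda>_. {..T}) \<Longrightarrow> (\<Sum>z | (x, z) \<in> E. \<Prod>i\<in>I. \<mu> ^ z i / fact (z i)) \<le> b"
    and b: "0 \<le> b"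
  shows "(\<Sum>(x, z)\<in>E. \<Prod>i\<in>I. poisson_weight \<mu> (x i + z i)) \<le> b"
proof -
  let ?P = "PiE I (\<lambda>_. {..T})"
  have finP: "finite ?P" using fin by (auto intro: finite_PiE)
  have finE: "finite {z. (x, z) \<in> E}" for x
    by (rule finite_subset[of _ ?P]) (use E finP in auto)
  have Eeq: "E = Sigma ?P (\<lambda>x. {z. (x, z) \<in> E})" using E by auto
  have "(\<Sum>(x, z)\<in>E. \<Prod>i\<in>I. poisson_weight \<mu> (x i + z i))
      = (\<Sum>x\<in>?P. \<Sum>z | (x, z) \<in> E. \<Prod>i\<in>I. poisson_weight \<mu> (x i + z i))"
    by (subst Eeq, subst sum.Sigma) (use finP finE in auto)
  also have "\<dots> \<le> (\<Sum>x\<in>?P. \<Sum>z | (x, z) \<in> E. (\<Prod>i\<in>I. poisson_weight \<mu> (x i)) * (\<Prod>i\<in>I. \<mu> ^ z i / fact (z i)))"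
    unfolding prod.distrib[symmetric]
  proof (intro sum_mono prod_mono conjI)
    fix x z i
    show "0 \<le> poisson_weight \<mu> (x i + z i)" by (rule poisson_weight_nonneg[OF mu])
    show "poisson_weight \<mu> (x i + z i) \<le> poisson_weight \<mu> (x i) * (\<mu> ^ z i / fact (z i))"
      by (rule poisson_weight_add_le[OF mu])
  qed
  also have "\<dots> = (\<Sum>x\<in>?P. (\<Prod>i\<in>I. poisson_weight \<mu> (x i)) * (\<Sum>z | (x, z) \<in> E. \<Prod>i\<in>I. \<mu> ^ z i / fact (z i)))"
    by (simp add: sum_distrib_left)
  also have "\<dots> \<le> (\<Sum>x\<in>?P. (\<Prod>i\<in>I. poisson_weight \<mu> (x i)) * b)"
    using mu by (intro sum_mono mult_left_mono bd prod_nonneg) (auto intro: poisson_weight_nonneg)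
  also have "\<dots> = (\<Sum>x\<in>?P. \<Prod>i\<in>I. poisson_weight \<mu> (x i)) * b" by (simp add: sum_distrib_right)
  also have "\<dots> \<le> 1 * b"
    using b by (intro mult_right_mono sum_prod_poisson_weight_le fin mu)
  finally show ?thesis by simp
qed

section \<open>Dyadic cells and the measurable structure of configurations\<close>

lemma num_points_eq_card:
  assumes "locally_finite S" "bounded B"
  shows "num_points B S = of_nat (card (S \<inter> B))"
  using assms by (simp add: num_points_def locally_finite_def emeasure_count_space_finite)

text \<open>The cell \<open>{i / 2 ^ n ..< (i + 1) / 2 ^ n}\<close>; the form with \<open>floor\<close> turns the nesting of cells into
integer division.\<close>

definition dyadic_cell :: "nat \<Rightarrow> int \<Rightarrow> real set" where
  "dyadic_cell n i = {x. \<lfloor>x * 2 ^ n\<rfloor> = i}"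

lemma dyadic_cell_eq: "dyadic_cell n i = {real_of_int i / 2 ^ n ..< (real_of_int i + 1) / 2 ^ n}"
  by (auto simp: dyadic_cell_def floor_eq_iff field_simps)

lemma dyadic_cell_borel [measurable]: "dyadic_cell n i \<in> sets borel"
  by (simp add: dyadic_cell_eq)

lemma bounded_dyadic_cell: "bounded (dyadic_cell n i)"
  unfolding dyadic_cell_eq 
  by (rule bounded_subset[OF bounded_closed_interval[of "real_of_int i / 2 ^ n" "(real_of_int i + 1) / 2 ^ n"]]) auto

lemma measure_dyadic_cell: "measure lborel (dyadic_cell n i) = 1 / 2 ^ n"
  by (simp add: dyadic_cell_eq field_simps)

lemma le_floor_dyadic_iff: "a * 2 ^ n \<le> \<lfloor>x * 2 ^ n\<rfloor> \<longleftrightarrow> real_of_int a \<le> x"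
proof -
  have "(a * 2 ^ n \<le> \<lfloor>x * 2 ^ n\<rfloor>) = (real_of_int (a * 2 ^ n) \<le> x * 2 ^ n)" by (rule le_floor_iff)
  also have "real_of_int (a * 2 ^ n) = real_of_int a * 2 ^ n" by simp
  also have "(real_of_int a * 2 ^ n \<le> x * 2 ^ n) = (real_of_int a \<le> x)"
    by (rule mult_le_cancel_right_pos) simp
  finally show ?thesis .
qed

lemma floor_dyadic_less_iff: "\<lfloor>x * 2 ^ n\<rfloor> < b * 2 ^ n \<longleftrightarrow> x < real_of_int b"
  using le_floor_dyadic_iff[of b n x] by linarith

lemma floor_cell_preimage_eq:
  "{x. \<lfloor>x * 2 ^ n\<rfloor> \<in> {a * 2 ^ n ..< b * 2 ^ n}} = {real_of_int a ..< real_of_int b}"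
  unfolding atLeastLessThan_iff le_floor_dyadic_iff floor_dyadic_less_iff by auto

lemma floor_dyadic_coarsen:
  fixes x :: real
  assumes "n \<le> n'"
  shows "\<lfloor>x * 2 ^ n\<rfloor> = \<lfloor>x * 2 ^ n'\<rfloor> div 2 ^ (n' - n)"
proof -
  have "x * 2 ^ n = (x * 2 ^ n') / real_of_int (2 ^ (n' - n))"
  proof -
    have "(2::real) ^ n' = 2 ^ n * 2 ^ (n' - n)" using assms by (simp flip: power_add)
    then show ?thesis by simp
  qed
  then have "\<lfloor>x * 2 ^ n\<rfloor> = \<lfloor>(x * 2 ^ n') / real_of_int (2 ^ (n' - n))\<rfloor>" by (rule arg_cong)
  also have "\<dots> = \<lfloor>x * 2 ^ n'\<rfloor> div 2 ^ (n' - n)"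
    by (rule floor_divide_real_eq_div) simp
  finally show ?thesis .
qed

definition cell_count :: "nat \<Rightarrow> real set \<Rightarrow> int \<Rightarrow> nat" where
  "cell_count n S i = card (S \<inter> dyadic_cell n i)"

lemma card_Int_floor_cells:
  assumes "locally_finite S" "finite I"
  shows "card (S \<inter> {x. \<lfloor>x * 2 ^ n\<rfloor> \<in> I}) = (\<Sum>i\<in>I. cell_count n S i)"
proof -
  have "S \<inter> {x. \<lfloor>x * 2 ^ n\<rfloor> \<in> I} = (\<Union>i\<in>I. S \<inter> dyadic_cell n i)" by (auto simp: dyadic_cell_def)
  moreover have "card (\<Union>i\<in>I. S \<inter> dyadic_cell n i) = (\<Sum>i\<in>I. card (S \<inter> dyadic_cell n i))"
    by (rule card_UN_disjoint)
       (use assms bounded_dyadic_cell in \<open>auto simp: locally_finite_def dyadic_cell_def\<close>)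
  ultimately show ?thesis by (simp add: cell_count_def)
qed

lemma div_eq_iff_interval:
  fixes a i d :: int
  assumes "0 < d"
  shows "a div d = i \<longleftrightarrow> a \<in> {i * d ..< (i + 1) * d}"
proof
  assume "a div d = i"
  then have "a = i * d + a mod d" by (metis div_mult_mod_eq)
  moreover have "0 \<le> a mod d" "a mod d < d" using assms by auto
  ultimately show "a \<in> {i * d ..< (i + 1) * d}" by (simp add: algebra_simps)
next
  assume "a \<in> {i * d ..< (i + 1) * d}"
  then show "a div d = i"
    by (intro int_div_pos_eq[of a d i "a - i * d"]) (auto simp: algebra_simps)
qed

lemma cell_count_refine:
  assumes "locally_finite S" "n \<le> n'"
  shows "cell_count n S i = (\<Sum>j\<in>{i * 2 ^ (n' - n) ..< (i + 1) * 2 ^ (n' - n)}. cell_count n' S j)"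
proof -
  have "dyadic_cell n i = {x. \<lfloor>x * 2 ^ n'\<rfloor> \<in> {i * 2 ^ (n' - n) ..< (i + 1) * 2 ^ (n' - n)}}"
    unfolding dyadic_cell_def floor_dyadic_coarsen[OF assms(2)] by (subst div_eq_iff_interval) auto
  then show ?thesis
    using card_Int_floor_cells[OF assms(1), of "{i * 2 ^ (n' - n) ..< (i + 1) * 2 ^ (n' - n)}" n']
    by (simp add: cell_count_def)
qed

lemma measurable_cell_count [measurable]: "(\<lambda>S. cell_count n S i) \<in> configs \<rightarrow>\<^sub>M count_space UNIV"
proof (subst measurable_count_space_eq2_countable, safe)
  fix k
  have "(\<lambda>S. cell_count n S i) -` {k} \<inter> space configs = num_points (dyadic_cell n i) -` {of_nat k} \<inter> space configs"
    by (auto simp: space_configs num_points_eq_card bounded_dyadic_cell cell_count_def)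
  also have "\<dots> \<in> sets configs" by (rule measurable_sets[OF measurable_num_points]) auto
  finally show "(\<lambda>S. cell_count n S i) -` {k} \<inter> space configs \<in> sets configs" .
qed auto

text \<open>The indices of the cells of level \<open>n\<close> in \<open>{- n ..< n}\<close>.  Refining the cells and enlarging the
window are tied to one parameter, so that larger \<open>n\<close> always means more information.\<close>

definition window :: "nat \<Rightarrow> int set" where
  "window n = {- int n * 2 ^ n ..< int n * 2 ^ n}"

lemma finite_window [simp]: "finite (window n)" by (simp add: window_def)

definition window_counts :: "nat \<Rightarrow> real set \<Rightarrow> int \<Rightarrow> nat" where
  "window_counts n S = restrict (cell_count n S) (window n)"

lemma window_counts_PiE: "window_counts n S \<in> PiE (window n) (\<lambda>_. UNIV)"
  by (simp add: window_counts_def)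

lemma window_counts_eq_iff: "window_counts n S = window_counts n S' \<longleftrightarrow> (\<forall>i\<in>window n. cell_count n S i = cell_count n S' i)"
  by (auto simp: window_counts_def fun_eq_iff restrict_def split: if_splits)

text \<open>The counts at level \<open>n'\<close> determine those at every earlier level, since a coarse cell of the smaller
window is a disjoint union of fine cells of the larger one.\<close>

lemma window_counts_coarsen:
  assumes "locally_finite S" "locally_finite S'" "n \<le> n'" "window_counts n' S = window_counts n' S'"
  shows "window_counts n S = window_counts n S'"
  unfolding window_counts_eq_iff
proof
  fix i assume i: "i \<in> window n"
  have d: "(2::int) ^ n * 2 ^ (n' - n) = 2 ^ n'" using assms(3) by (simp flip: power_add)
  have "{i * 2 ^ (n' - n) ..< (i + 1) * 2 ^ (n' - n)} \<subseteq> window n'"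
  proof
    fix j assume j: "j \<in> {i * 2 ^ (n' - n) ..< (i + 1) * 2 ^ (n' - n)}"
    have "- int n' * 2 ^ n' \<le> - int n * 2 ^ n'" using assms(3) by simp
    also have "\<dots> = (- int n * 2 ^ n) * 2 ^ (n' - n)" by (simp add: d mult.assoc)
    also have "\<dots> \<le> i * 2 ^ (n' - n)" using i by (intro mult_right_mono) (auto simp: window_def)
    finally have 1: "- int n' * 2 ^ n' \<le> j" using j by simp
    have "j < (i + 1) * 2 ^ (n' - n)" using j by simp
    also have "\<dots> \<le> (int n * 2 ^ n) * 2 ^ (n' - n)"
      using i by (intro mult_right_mono) (auto simp: window_def)
    also have "\<dots> = int n * 2 ^ n'" by (simp add: d mult.assoc)
    also have "\<dots> \<le> int n' * 2 ^ n'" using assms(3) by simp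
    finally show "j \<in> window n'" using 1 by (simp add: window_def)
  qed
  then have "\<forall>j\<in>{i * 2 ^ (n' - n) ..< (i + 1) * 2 ^ (n' - n)}. cell_count n' S j = cell_count n' S' j"
    using assms(4) unfolding window_counts_eq_iff by blast
  then show "cell_count n S i = cell_count n S' i"
    using assms by (auto simp: cell_count_refine[of _ n n'] intro!: sum.cong)
qed

lemma measurable_window_counts: "window_counts n \<in> configs \<rightarrow>\<^sub>M count_space (PiE (window n) (\<lambda>_. UNIV))"
proof (intro measurable_count_space_eq_countable[THEN iffD2] conjI ballI)
  show "countable (PiE (window n) (\<lambda>_. UNIV :: nat set))" by (intro countable_PiE) auto
next
  fix v :: "int \<Rightarrow> nat" assume v: "v \<in> PiE (window n) (\<lambda>_. UNIV)"
  have "window_counts n -` {v} \<inter> space configs = {S \<in> space configs. \<forall>i\<in>window n. cell_count n S i = v i}"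
    using v by (auto simp: window_counts_def fun_eq_iff restrict_def PiE_def extensional_def)
  also have "\<dots> \<in> sets configs" by measurable
  finally show "window_counts n -` {v} \<inter> space configs \<in> sets configs" .
qed (auto simp: window_counts_def)

text \<open>The events that depend on finitely many counts only: they form an algebra whose
generated sigma-algebra is that of the configurations.\<close>

definition local_event :: "nat \<Rightarrow> (int \<Rightarrow> nat) set \<Rightarrow> real set set" where
  "local_event n T = {S \<in> space configs. window_counts n S \<in> T}"

lemma sets_local_event [measurable]: "local_event n T \<in> sets configs"
proof -
  have "local_event n T = window_counts n -` (T \<inter> PiE (window n) (\<lambda>_. UNIV)) \<inter> space configs"
    using window_counts_PiE by (auto simp: local_event_def)
  also have "\<dots> \<in> sets configs" by (rule measurable_sets[OF measurable_window_counts]) auto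
  finally show ?thesis .
qed

lemma local_event_refine:
  assumes "n \<le> n'"
  obtains T' where "local_event n T = local_event n' T'"
proof
  show "local_event n T = local_event n' (window_counts n' ` local_event n T)"
  proof (intro equalityI subsetI)
    fix S assume "S \<in> local_event n' (window_counts n' ` local_event n T)"
    then obtain S' where S: "locally_finite S" "locally_finite S'" "window_counts n S' \<in> T" "window_counts n' S = window_counts n' S'"
      by (auto simp: local_event_def space_configs)
    from window_counts_coarsen[OF S(1,2) assms S(4)] S show "S \<in> local_event n T"
      by (simp add: local_event_def space_configs)
  qed (auto simp: local_event_def)
qed

definition local_events :: "real set set set" where
  "local_events = (\<Union>n. range (local_event n))"

lemma Int_stable_local_events: "Int_stable local_events"
proof (rule Int_stableI)
  fix a b assume "a \<in> local_events" "b \<in> local_events"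
  then obtain n1 T1 n2 T2 where ab: "a = local_event n1 T1" "b = local_event n2 T2"
    by (auto simp: local_events_def)
  obtain T1' where 1: "a = local_event (max n1 n2) T1'"
    unfolding ab by (rule local_event_refine[of n1 "max n1 n2" T1]) auto
  obtain T2' where 2: "b = local_event (max n1 n2) T2'"
    unfolding ab by (rule local_event_refine[of n2 "max n1 n2" T2]) auto
  have "a \<inter> b = local_event (max n1 n2) (T1' \<inter> T2')"
    unfolding 1 2 by (auto simp: local_event_def)
  then show "a \<inter> b \<in> local_events" by (auto simp: local_events_def)
qed

lemma local_events_subset: "local_events \<subseteq> Pow (space configs)"
  by (auto simp: local_events_def local_event_def)

lemma num_points_Compl_Int:
  assumes "locally_finite S" "bounded W"
  shows "num_points ((UNIV - B) \<inter> W) S = num_points W S - num_points (B \<inter> W) S"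
proof -
  have fin: "finite (S \<inter> W)" using assms by (auto simp: locally_finite_def)
  have "S \<inter> ((UNIV - B) \<inter> W) = (S \<inter> W) - (S \<inter> (B \<inter> W))" by auto
  moreover have "emeasure (count_space UNIV) ((S \<inter> W) - (S \<inter> (B \<inter> W))) =
     emeasure (count_space UNIV) (S \<inter> W) - emeasure (count_space UNIV) (S \<inter> (B \<inter> W))"
  proof (rule emeasure_Diff)
    have "finite (S \<inter> (B \<inter> W))" by (rule finite_subset[OF _ fin]) auto
    then show "emeasure (count_space UNIV) (S \<inter> (B \<inter> W)) \<noteq> \<infinity>" by (simp add: emeasure_count_space_finite)
  qed auto
  ultimately show ?thesis by (simp add: num_points_def)
qed

lemma num_points_UN:
  assumes "disjoint_family (A :: nat \<Rightarrow> real set)"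
  shows "num_points (\<Union>i. A i) S = (\<Sum>i. num_points (A i) S)"
proof -
  have "(\<Sum>i. emeasure (count_space UNIV) (S \<inter> A i)) = emeasure (count_space UNIV) (\<Union>i. S \<inter> A i)"
    by (rule suminf_emeasure) (use assms in \<open>auto simp: disjoint_family_on_def\<close>)
  then show ?thesis by (simp add: num_points_def)
qed

text \<open>A locally finite set has finitely many points in \<open>{- N ..< N}\<close>, so for all fine enough levels the
points below \<open>a\<close> are exactly those in cells strictly below the cell of \<open>a\<close>.\<close>

lemma measurable_num_points_ray:
  fixes G :: "real set measure"
  assumes sG: "space G = space configs"
    and cntG: "\<And>k i. i \<in> window k \<Longrightarrow> (\<lambda>S. of_nat (cell_count k S i) :: ennreal) \<in> borel_measurable G"
  shows "(\<lambda>S. num_points ({..<a} \<inter> {- real N ..< real N}) S) \<in> borel_measurable G"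
proof -
  define I where "I k = {- int N * 2 ^ k ..< min (int N * 2 ^ k) \<lfloor>a * 2 ^ k\<rfloor>}" for k
  define F where "F k S = (\<Sum>i\<in>I k. of_nat (cell_count k S i) :: ennreal)" for k S
  have m: "F k \<in> borel_measurable G" if "N \<le> k" for k
  proof -
    have le: "int N * 2 ^ k \<le> int k * 2 ^ k" using that by simp
    have "I k \<subseteq> window k"
    proof
      fix x assume "x \<in> I k"
      then have "- (int N * 2 ^ k) \<le> x" "x < int N * 2 ^ k" by (simp_all add: I_def)
      with le have "- (int k * 2 ^ k) \<le> x" "x < int k * 2 ^ k" by linarith+
      then show "x \<in> window k" by (simp add: window_def)
    qed
    then show ?thesis unfolding F_def[abs_def] by (intro borel_measurable_sum cntG) (rule subsetD)
  qed
  have Nfl: "- int N * 2 ^ k \<le> \<lfloor>x * 2 ^ k\<rfloor> \<longleftrightarrow> - real N \<le> x"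
    "\<lfloor>x * 2 ^ k\<rfloor> < int N * 2 ^ k \<longleftrightarrow> x < real N" for x k
    unfolding le_floor_dyadic_iff floor_dyadic_less_iff by simp_all
  \<comment> \<open>levels below \<open>N\<close> are skipped because their windows need not contain \<open>{- N ..< N}\<close>\<close>
  have lim: "(\<lambda>k. F (k + N) S) \<longlonglongrightarrow> num_points ({..<a} \<inter> {- real N ..< real N}) S"
    if S: "S \<in> space G" for S
  proof (rule tendsto_eventually)
    have lf: "locally_finite S" using S by (simp add: sG space_configs)
    have bW: "bounded {- real N ..< real N}"
      by (rule bounded_subset[OF bounded_closed_interval[of "- real N" "real N"]]) auto
    then have fin: "finite (S \<inter> {- real N ..< real N})" using lf by (auto simp: locally_finite_def)
    have ev: "\<forall>\<^sub>F k in sequentially. x < a \<longrightarrow> \<lfloor>x * 2 ^ (k + N)\<rfloor> < \<lfloor>a * 2 ^ (k + N)\<rfloor>" for x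
    proof (cases "x < a")
      case True
      obtain k0 where k0: "1 / (a - x) < 2 ^ k0"
        using real_arch_pow[of 2 "1 / (a - x)"] by auto
      show ?thesis
      proof (rule eventually_sequentiallyI[of k0], rule impI)
        fix k assume "k0 \<le> k"
        then have "(2::real) ^ k0 \<le> 2 ^ (k + N)" by (intro power_increasing) auto
        with k0 have "1 / (a - x) < 2 ^ (k + N)" by linarith
        then have "1 < (a - x) * 2 ^ (k + N)" using True by (simp add: field_simps)
        then have "x * 2 ^ (k + N) + 1 < a * 2 ^ (k + N)" by (simp add: algebra_simps)
        then show "\<lfloor>x * 2 ^ (k + N)\<rfloor> < \<lfloor>a * 2 ^ (k + N)\<rfloor>" by linarith
      qed
    qed simp
    have "\<forall>\<^sub>F k in sequentially. \<forall>x\<in>S \<inter> {- real N ..< real N}. 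
        x < a \<longrightarrow> \<lfloor>x * 2 ^ (k + N)\<rfloor> < \<lfloor>a * 2 ^ (k + N)\<rfloor>"
      by (rule eventually_ball_finite) (use fin ev in auto)
    then show "\<forall>\<^sub>F k in sequentially. F (k + N) S = num_points ({..<a} \<inter> {- real N ..< real N}) S"
    proof eventually_elim
      case (elim k)
      have fl: "\<lfloor>x * 2 ^ (k + N)\<rfloor> \<in> I (k + N) \<longleftrightarrow> x < a \<and> x \<in> {- real N ..< real N}" if x: "x \<in> S" for x
      proof -
        have a: "x < a" if "\<lfloor>x * 2 ^ (k + N)\<rfloor> < \<lfloor>a * 2 ^ (k + N)\<rfloor>"
        proof (rule ccontr)
          assume "\<not> x < a"
          then have "a * 2 ^ (k + N) \<le> x * 2 ^ (k + N)" by (intro mult_right_mono) auto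
          then have "\<lfloor>a * 2 ^ (k + N)\<rfloor> \<le> \<lfloor>x * 2 ^ (k + N)\<rfloor>" by (rule floor_mono)
          with that show False by simp
        qed
        have b: "\<lfloor>x * 2 ^ (k + N)\<rfloor> < \<lfloor>a * 2 ^ (k + N)\<rfloor>" if "x < a" "x \<in> {- real N ..< real N}"
          using elim x that by blast
        have "\<lfloor>x * 2 ^ (k + N)\<rfloor> \<in> I (k + N) \<longleftrightarrow>
            - real N \<le> x \<and> x < real N \<and> \<lfloor>x * 2 ^ (k + N)\<rfloor> < \<lfloor>a * 2 ^ (k + N)\<rfloor>"
          by (simp only: I_def atLeastLessThan_iff min_less_iff_conj Nfl)
        with a b show ?thesis by (metis atLeastLessThan_iff)
      qed
      have "S \<inter> ({..<a} \<inter> {- real N ..< real N}) = S \<inter> {x. \<lfloor>x * 2 ^ (k + N)\<rfloor> \<in> I (k + N)}"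
      proof (rule set_eqI)
        fix x show "x \<in> S \<inter> ({..<a} \<inter> {- real N ..< real N}) \<longleftrightarrow> x \<in> S \<inter> {x. \<lfloor>x * 2 ^ (k + N)\<rfloor> \<in> I (k + N)}"
          using fl[of x] by (simp only: Int_iff lessThan_iff mem_Collect_eq cong: conj_cong)
      qed
      moreover have "bounded ({..<a} \<inter> {- real N ..< real N})" using bW by (rule bounded_subset) auto
      moreover have "card (S \<inter> {x. \<lfloor>x * 2 ^ (k + N)\<rfloor> \<in> I (k + N)}) = (\<Sum>i\<in>I (k + N). cell_count (k + N) S i)"
        by (rule card_Int_floor_cells[OF lf]) (simp add: I_def)
      ultimately show ?case
        unfolding F_def by (simp only: num_points_eq_card[OF lf] of_nat_sum)
    qed
  qed
  show ?thesis
    by (rule borel_measurable_LIMSEQ_order[OF lim]) (auto intro: m)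
qed

text \<open>Rays are closed under intersection and generate the Borel sets, so Dynkin's theorem extends the
previous lemma from rays to Borel sets.  The restriction to a bounded window keeps the counts finite,
which the step to complements needs for its subtraction.\<close>

lemma measurable_num_points_window:
  fixes G :: "real set measure"
  assumes sG: "space G = space configs"
    and cntG: "\<And>k i. i \<in> window k \<Longrightarrow> (\<lambda>S. of_nat (cell_count k S i) :: ennreal) \<in> borel_measurable G"
    and B: "B \<in> sets borel"
  shows "(\<lambda>S. num_points (B \<inter> {- real N ..< real N}) S) \<in> borel_measurable G"
proof -
  note ray = measurable_num_points_ray[OF sG cntG]
  let ?W = "{- real N ..< real N}"
  have bW: "bounded ?W"
    by (rule bounded_subset[OF bounded_closed_interval[of "- real N" "real N"]]) auto
  have stab: "Int_stable (range (lessThan :: real \<Rightarrow> real set))"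
  proof (rule Int_stableI_image)
    fix a b :: real
    have "{..<a} \<inter> {..<b} = {..<min a b}" by auto
    then show "\<exists>c\<in>UNIV. {..<a} \<inter> {..<b} = {..<c}" by blast
  qed
  have "sets borel = sigma_sets UNIV (range (lessThan :: real \<Rightarrow> real set))"
    by (subst borel_Iio) (rule sets_measure_of, simp)
  from B this have "B \<in> sigma_sets UNIV (range (lessThan :: real \<Rightarrow> real set))" by (simp only:)
  with stab subset_UNIV[of "range lessThan", folded Pow_UNIV] show ?thesis
  proof (induction rule: sigma_sets_induct_disjoint[where \<Omega> = "UNIV :: real set"])
    case (basic A)
    then show ?case using ray by blast
  next
    case empty
    then show ?case by (simp add: num_points_def)
  next
    case (compl A)
    have W: "{..<real N} \<inter> ?W = ?W" by auto
    have m1: "(\<lambda>S. num_points ?W S - num_points (A \<inter> ?W) S) \<in> borel_measurable G"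
      by (rule borel_measurable_minus_ennreal[OF _ compl(2)]) (use ray[of "real N" N] W in simp)
    have m2: "num_points ((UNIV - A) \<inter> ?W) S = num_points ?W S - num_points (A \<inter> ?W) S"
      if "S \<in> space G" for S
      by (rule num_points_Compl_Int[OF _ bW]) (use that in \<open>simp add: sG space_configs\<close>)
    show ?case by (subst measurable_cong[OF m2]) (auto intro: m1)
  next
    case (union A)
    have "(\<lambda>S. \<Sum>i. num_points (A i \<inter> ?W) S) \<in> borel_measurable G"
      by (rule borel_measurable_suminf_order, rule union(3))
    moreover have "num_points (\<Union> (range A) \<inter> ?W) S = (\<Sum>i. num_points (A i \<inter> ?W) S)" for S
    proof -
      have "disjoint_family (\<lambda>i. A i \<inter> ?W)" using union(1) by (auto simp: disjoint_family_on_def)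
      from num_points_UN[OF this] show ?thesis by simp
    qed
    ultimately show ?case by simp
  qed
qed

text \<open>Measurability of the identity says that \<open>G\<close> contains every measurable set of configurations.\<close>

lemma measurable_ident_from_cells:
  fixes G :: "real set measure"
  assumes sG: "space G = space configs"
    and cntG: "\<And>k i. i \<in> window k \<Longrightarrow> (\<lambda>S. of_nat (cell_count k S i) :: ennreal) \<in> borel_measurable G"
  shows "(\<lambda>S. S) \<in> G \<rightarrow>\<^sub>M configs"
proof (rule measurable_configsI)
  fix B :: "real set" assume B: "B \<in> sets borel"
  have "(\<lambda>N. num_points (B \<inter> {- real N ..< real N}) S) \<longlonglongrightarrow> num_points B S" for S
  proof -
    have "(\<lambda>N. emeasure (count_space UNIV) (S \<inter> (B \<inter> {- real N ..< real N})))
        \<longlonglongrightarrow> emeasure (count_space UNIV) (\<Union>N. S \<inter> (B \<inter> {- real N ..< real N}))"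
      by (rule Lim_emeasure_incseq) (auto simp: incseq_def)
    moreover have "(\<Union>N. S \<inter> (B \<inter> {- real N ..< real N})) = S \<inter> B"
    proof (intro equalityI subsetI)
      fix x assume x: "x \<in> S \<inter> B"
      obtain N where "\<bar>x\<bar> < real N" using reals_Archimedean2 by blast
      then have "- real N \<le> x" "x < real N" by linarith+
      with x show "x \<in> (\<Union>N. S \<inter> (B \<inter> {- real N ..< real N}))" by auto
    qed auto
    ultimately show ?thesis by (simp add: num_points_def)
  qed
  from measurable_num_points_window[OF sG cntG B] this show "(\<lambda>S. num_points B S) \<in> borel_measurable G"
    by (rule borel_measurable_LIMSEQ_order[where u = "\<lambda>N. num_points (B \<inter> {- real N ..< real N})", rotated])
qed (simp add: sG space_configs)

text \<open>The sigma-algebra of the configurations is defined by the counts in all Borel sets; counts in dyadic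
cells suffice.\<close>

lemma sets_configs_local: "sets configs = sigma_sets (space configs) local_events"
proof
  show "sigma_sets (space configs) local_events \<subseteq> sets configs"
    by (rule sets.sigma_sets_subset) (auto simp: local_events_def)
next
  define G where "G = sigma (space configs) local_events"
  have sG: "space G = space configs" unfolding G_def by (rule space_measure_of[OF local_events_subset])
  have setsG: "sets G = sigma_sets (space configs) local_events"
    unfolding G_def by (rule sets_measure_of[OF local_events_subset])
  have cntG: "(\<lambda>S. of_nat (cell_count k S i) :: ennreal) \<in> borel_measurable G" if "i \<in> window k" for k i
  proof -
    have "(\<lambda>S. cell_count k S i) \<in> G \<rightarrow>\<^sub>M count_space UNIV"
    proof (subst measurable_count_space_eq2_countable, safe)
      fix c
      have "(\<lambda>S. cell_count k S i) -` {c} \<inter> space G = local_event k {v. v i = c}"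
        using that by (auto simp: sG local_event_def window_counts_def)
      also have "\<dots> \<in> sets G" unfolding setsG by (rule sigma_sets.Basic) (auto simp: local_events_def)
      finally show "(\<lambda>S. cell_count k S i) -` {c} \<inter> space G \<in> sets G" .
    qed auto
    from measurable_compose[OF this, of "of_nat :: nat \<Rightarrow> ennreal" borel] show ?thesis by simp
  qed
  have id: "(\<lambda>S. S) \<in> G \<rightarrow>\<^sub>M configs" by (rule measurable_ident_from_cells[OF sG cntG])
  show "sets configs \<subseteq> sigma_sets (space configs) local_events"
  proof
    fix A assume A: "A \<in> sets configs"
    from measurable_sets[OF id this]
    show "A \<in> sigma_sets (space configs) local_events"
      using sets.sets_into_space[OF A] by (simp add: sG setsG Int_absorb2)
  qed
qed

section \<open>Laws of Poisson processes\<close>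

lemma poisson_weight_sums: "(\<lambda>k. poisson_weight \<mu> k) sums 1"
proof -
  have "(\<lambda>k. \<mu> ^ k / fact k * exp (- \<mu>)) sums (exp \<mu> * exp (- \<mu>))"
    using exp_converges[of \<mu>] by (intro sums_mult2) (simp add: divide_inverse mult.commute)
  then show ?thesis by (simp add: poisson_weight_def exp_minus)
qed

lemma poisson_weight_Suc: "real (Suc k) * poisson_weight \<mu> (Suc k) = \<mu> * poisson_weight \<mu> k"
proof -
  have "c * (\<mu> * p / (c * f) * e) = \<mu> * (p / f * e)" if "c \<noteq> 0" for c p f e :: real
    using that by simp
  from this[of "real (Suc k)"] show ?thesis
    unfolding poisson_weight_def fact_Suc power_Suc of_nat_mult by (simp del: of_nat_Suc)
qed

text \<open>The variance of the Poisson law, from \<open>(k - \<mu>)\<^sup>2 = k * (k - 1) + (1 - 2 * \<mu>) * k + \<mu>\<^sup>2\<close> and the recursion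
\<open>k * p k = \<mu> * p (k - 1)\<close>.\<close>

lemma poisson_weight_variance_sums: "(\<lambda>k. poisson_weight \<mu> k * (real k - \<mu>)\<^sup>2) sums \<mu>"
proof -
  have 1: "(\<lambda>k. real k * poisson_weight \<mu> k) sums \<mu>"
    by (rule sums_Suc_imp) (use sums_mult[OF poisson_weight_sums[of \<mu>], of \<mu>] in \<open>simp_all only: poisson_weight_Suc, simp_all\<close>)
  have "(\<lambda>k. real k * (real (Suc k) * poisson_weight \<mu> (Suc k))) sums (\<mu> * \<mu>)"
    using sums_mult[OF 1, of \<mu>] unfolding poisson_weight_Suc by (simp add: mult_ac)
  then have "(\<lambda>k. real (Suc k) * (real (Suc k) - 1) * poisson_weight \<mu> (Suc k)) sums (\<mu> * \<mu>)"
    by (simp add: mult_ac)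
  then have 2: "(\<lambda>k. real k * (real k - 1) * poisson_weight \<mu> k) sums (\<mu> * \<mu>)"
    by (rule sums_Suc_imp[rotated]) simp
  have "(\<lambda>k. real k * (real k - 1) * poisson_weight \<mu> k + (1 - 2 * \<mu>) * (real k * poisson_weight \<mu> k)
      + \<mu>\<^sup>2 * poisson_weight \<mu> k) sums (\<mu> * \<mu> + (1 - 2 * \<mu>) * \<mu> + \<mu>\<^sup>2 * 1)"
    by (intro sums_add sums_mult 1 2 poisson_weight_sums)
  then show ?thesis by (simp add: algebra_simps power2_eq_square)
qed

lemma measurable_card_Int:
  assumes "B \<in> sets borel" "bounded B"
  shows "(\<lambda>S. card (S \<inter> B)) \<in> configs \<rightarrow>\<^sub>M count_space UNIV"
proof (subst measurable_count_space_eq2_countable, safe)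
  fix k
  have "(\<lambda>S. card (S \<inter> B)) -` {k} \<inter> space configs = num_points B -` {of_nat k} \<inter> space configs"
    using assms by (auto simp: space_configs num_points_eq_card)
  also have "\<dots> \<in> sets configs" by (rule measurable_sets[OF measurable_num_points]) (use assms in auto)
  finally show "(\<lambda>S. card (S \<inter> B)) -` {k} \<inter> space configs \<in> sets configs" .
qed auto

lemma poisson_process_prob_card:
  assumes X: "poisson_process l P X" and B: "B \<in> sets borel" "bounded B"
  shows "measure P {w \<in> space P. card (X w \<inter> B) = k} = poisson_weight (l * measure lborel B) k"
proof -
  have mX: "X \<in> P \<rightarrow>\<^sub>M configs" using X by (simp add: poisson_process_def)
  have "emeasure lborel B < \<infinity>" using B(2) by (rule emeasure_bounded_finite)
  then have "measure P {w \<in> space P. num_points B (X w) = of_nat k} = poisson_weight (l * measure lborel B) k"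
    using X B(1) unfolding poisson_process_def poisson_weight_def by blast
  moreover have "{w \<in> space P. num_points B (X w) = of_nat k} = {w \<in> space P. card (X w \<inter> B) = k}"
    using measurable_space[OF mX] B(2) by (auto simp: space_configs num_points_eq_card)
  ultimately show ?thesis by simp
qed

text \<open>Chebyshev's inequality for the number of points in a bounded set.\<close>

lemma poisson_process_deviation:
  assumes X: "poisson_process l P X" and B: "B \<in> sets borel" "bounded B" and a: "0 < a" and l: "0 \<le> l"
  shows "measure P {w \<in> space P. a \<le> \<bar>real (card (X w \<inter> B)) - l * measure lborel B\<bar>}
    \<le> l * measure lborel B / a\<^sup>2"
proof -
  define \<mu> where "\<mu> = l * measure lborel B"
  have mu: "0 \<le> \<mu>" using l by (simp add: \<mu>_def)
  have mX: "X \<in> P \<rightarrow>\<^sub>M configs" and P: "prob_space P" using X by (simp_all add: poisson_process_def)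
  interpret P: prob_space P by fact
  define A where "A k = (if a \<le> \<bar>real k - \<mu>\<bar> then {w \<in> space P. card (X w \<inter> B) = k} else {})" for k
  have mc: "(\<lambda>w. card (X w \<inter> B)) \<in> P \<rightarrow>\<^sub>M count_space UNIV"
    using measurable_compose[OF mX measurable_card_Int[OF B]] .
  have "{w \<in> space P. card (X w \<inter> B) = k} \<in> sets P" for k
    using mc by measurable
  then have "range A \<subseteq> sets P" by (auto simp: A_def)
  moreover have "disjoint_family A" by (auto simp: A_def disjoint_family_on_def)
  ultimately have "(\<lambda>k. measure P (A k)) sums measure P (\<Union>k. A k)"
    by (rule P.finite_measure_UNION)
  moreover have "(\<Union>k. A k) = {w \<in> space P. a \<le> \<bar>real (card (X w \<inter> B)) - \<mu>\<bar>}"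
    by (auto simp: A_def)
  ultimately have s: "(\<lambda>k. measure P (A k)) sums measure P {w \<in> space P. a \<le> \<bar>real (card (X w \<inter> B)) - \<mu>\<bar>}"
    by simp
  have t: "(\<lambda>k. poisson_weight \<mu> k * (real k - \<mu>)\<^sup>2 / a\<^sup>2) sums (\<mu> / a\<^sup>2)"
    by (rule sums_divide[OF poisson_weight_variance_sums])
  have "measure P (A k) \<le> poisson_weight \<mu> k * (real k - \<mu>)\<^sup>2 / a\<^sup>2" for k
  proof (cases "a \<le> \<bar>real k - \<mu>\<bar>")
    case True
    then have "a\<^sup>2 \<le> \<bar>real k - \<mu>\<bar>\<^sup>2" using a by (intro power_mono) auto
    then have "1 \<le> (real k - \<mu>)\<^sup>2 / a\<^sup>2" using a by (simp add: le_divide_eq)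
    then have "poisson_weight \<mu> k * 1 \<le> poisson_weight \<mu> k * ((real k - \<mu>)\<^sup>2 / a\<^sup>2)"
      using mu by (intro mult_left_mono poisson_weight_nonneg) auto
    then show ?thesis
      using True poisson_process_prob_card[OF X B, of k] by (simp add: A_def \<mu>_def)
  next
    case False
    then show ?thesis using mu by (simp add: A_def poisson_weight_nonneg)
  qed
  from sums_le[OF this s t] show ?thesis by (simp add: \<mu>_def)
qed

lemma poisson_process_prob_cell_count:
  assumes X: "poisson_process l P X" and I: "finite I"
  shows "measure P {w \<in> space P. \<forall>i\<in>I. cell_count n (X w) i = v i} = (\<Prod>i\<in>I. poisson_weight (l / 2 ^ n) (v i))"
proof (cases "I = {}")
  case True
  have "prob_space P" using X by (simp add: poisson_process_def)
  then show ?thesis using True by (simp add: prob_space.prob_space)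
next
  case False
  define J where "J = int_encode ` I"
  define B where "B k = dyadic_cell n (int_decode k)" for k
  have J: "finite J" "J \<noteq> {}" using I False by (auto simp: J_def)
  have mX: "X \<in> P \<rightarrow>\<^sub>M configs" and P: "prob_space P" using X by (simp_all add: poisson_process_def)
  interpret P: prob_space P by fact
  have "disjoint_family_on B J"
    by (auto simp: disjoint_family_on_def B_def J_def dyadic_cell_def)
  moreover have "\<forall>k\<in>J. B k \<in> sets borel" by (simp add: B_def)
  ultimately have "P.indep_vars (\<lambda>_. borel) (\<lambda>k w. num_points (B k) (X w)) J"
    using X J(1) unfolding poisson_process_def by blast
  then have "P.prob (\<Inter>k\<in>J. (\<lambda>w. num_points (B k) (X w)) -` {of_nat (v (int_decode k))} \<inter> space P)
      = (\<Prod>k\<in>J. P.prob ((\<lambda>w. num_points (B k) (X w)) -` {of_nat (v (int_decode k))} \<inter> space P))"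
    using J by (intro P.indep_varsD_finite) auto
  moreover have eq: "(\<lambda>w. num_points (B k) (X w)) -` {of_nat (v (int_decode k))} \<inter> space P
      = {w \<in> space P. cell_count n (X w) (int_decode k) = v (int_decode k)}" for k
    using measurable_space[OF mX] by (auto simp: space_configs num_points_eq_card bounded_dyadic_cell B_def cell_count_def)
  moreover have "(\<Inter>k\<in>J. {w \<in> space P. cell_count n (X w) (int_decode k) = v (int_decode k)})
      = {w \<in> space P. \<forall>i\<in>I. cell_count n (X w) i = v i}"
    using False by (auto simp: J_def)
  moreover have "P.prob {w \<in> space P. cell_count n (X w) i = v i} = poisson_weight (l / 2 ^ n) (v i)" for i
    using poisson_process_prob_card[OF X dyadic_cell_borel bounded_dyadic_cell, of n i "v i"]
    by (simp add: cell_count_def measure_dyadic_cell)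
  moreover have "(\<Prod>k\<in>J. poisson_weight (l / 2 ^ n) (v (int_decode k))) = (\<Prod>i\<in>I. poisson_weight (l / 2 ^ n) (v i))"
    unfolding J_def by (subst prod.reindex) (auto simp: inj_int_encode)
  ultimately show ?thesis by simp
qed

text \<open>Local events are closed under intersection and generate, and each of them is a countable union of
events that fix the counts in one window.\<close>

lemma configs_measure_eqI:
  assumes M: "prob_space M" "sets M = sets configs" and N: "prob_space N" "sets N = sets configs"
    and eq: "\<And>n v. v \<in> PiE (window n) (\<lambda>_. UNIV) \<Longrightarrow> emeasure M (local_event n {v}) = emeasure N (local_event n {v})"
  shows "M = N"
proof (rule measure_eqI_generator_eq[OF Int_stable_local_events local_events_subset])
  have sp: "space M = space configs" "space N = space configs" 
    using M(2) N(2) by (auto dest: sets_eq_imp_space_eq)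
  fix D assume "D \<in> local_events"
  then obtain n T where D: "D = local_event n T" by (auto simp: local_events_def)
  let ?C = "count_space (PiE (window n) (\<lambda>_. UNIV :: nat set))"
  have mM: "window_counts n \<in> M \<rightarrow>\<^sub>M ?C" and mN: "window_counts n \<in> N \<rightarrow>\<^sub>M ?C"
    using measurable_window_counts[of n] measurable_cong_sets[OF M(2) refl] measurable_cong_sets[OF N(2) refl] by auto
  have pre: "window_counts n -` A \<inter> space configs = local_event n A" for A
    by (auto simp: local_event_def)
  have "distr M ?C (window_counts n) = distr N ?C (window_counts n)"
  proof (rule measure_eqI_countable)
    show "countable (PiE (window n) (\<lambda>_. UNIV :: nat set))" by (intro countable_PiE) auto
    fix v :: "int \<Rightarrow> nat" assume v: "v \<in> PiE (window n) (\<lambda>_. UNIV)"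
    then show "emeasure (distr M ?C (window_counts n)) {v} = emeasure (distr N ?C (window_counts n)) {v}"
      using eq[OF v] by (simp add: emeasure_distr[OF mM] emeasure_distr[OF mN] sp pre)
  qed auto
  then have "emeasure (distr M ?C (window_counts n)) (T \<inter> PiE (window n) (\<lambda>_. UNIV))
      = emeasure (distr N ?C (window_counts n)) (T \<inter> PiE (window n) (\<lambda>_. UNIV))" by simp
  moreover have "local_event n (T \<inter> PiE (window n) (\<lambda>_. UNIV)) = local_event n T"
    using window_counts_PiE by (auto simp: local_event_def)
  ultimately show "emeasure M D = emeasure N D"
    by (simp add: emeasure_distr[OF mM] emeasure_distr[OF mN] sp pre D del: vimage_Int)
next
  show "sets M = sigma_sets (space configs) local_events" "sets N = sigma_sets (space configs) local_events"
    using M N sets_configs_local by auto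
  show "range (\<lambda>_::nat. local_event 0 UNIV) \<subseteq> local_events" by (auto simp: local_events_def)
  show "(\<Union>i::nat. local_event 0 UNIV) = space configs" by (auto simp: local_event_def)
  interpret M: prob_space M by fact
  show "\<And>i::nat. emeasure M (local_event 0 UNIV) \<noteq> \<infinity>" by simp
qed

lemma poisson_process_law_unique:
  assumes X: "poisson_process l P X" and Y: "poisson_process l Q Y"
  shows "distr P configs X = distr Q configs Y"
proof -
  have *: "prob_space P" "X \<in> P \<rightarrow>\<^sub>M configs" "prob_space Q" "Y \<in> Q \<rightarrow>\<^sub>M configs"
    using X Y by (simp_all add: poisson_process_def)
  have emb: "emeasure (distr R configs Z) (local_event n {v}) = ennreal (\<Prod>i\<in>window n. poisson_weight (l / 2 ^ n) (v i))"
    if Z: "poisson_process l R Z" and v: "v \<in> PiE (window n) (\<lambda>_. UNIV)" for R Z n v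
  proof -
    have R: "prob_space R" "Z \<in> R \<rightarrow>\<^sub>M configs" using Z by (simp_all add: poisson_process_def)
    interpret R: prob_space R by fact
    have "Z -` local_event n {v} \<inter> space R = {w \<in> space R. \<forall>i\<in>window n. cell_count n (Z w) i = v i}"
      using measurable_space[OF R(2)] v
      by (auto simp: local_event_def window_counts_def fun_eq_iff restrict_def PiE_def extensional_def)
    then show ?thesis
      using R(2) by (simp add: emeasure_distr R.emeasure_eq_measure poisson_process_prob_cell_count[OF Z])
  qed
  show ?thesis
    by (rule configs_measure_eqI) (use * emb[OF X] emb[OF Y] in \<open>auto intro: prob_space.prob_space_distr\<close>)
qed

lemma locally_finite_shift:
  assumes "locally_finite S"
  shows "locally_finite (shift t S)"
  unfolding locally_finite_def
proof (intro allI impI)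
  fix B :: "real set" assume "bounded B"
  then have "bounded ((\<lambda>s. s - t) ` B)" by (simp add: bounded_translation_minus)
  then have "finite (S \<inter> (\<lambda>s. s - t) ` B)" using assms by (simp add: locally_finite_def)
  then have "finite ((\<lambda>s. s + t) ` (S \<inter> (\<lambda>s. s - t) ` B))" by simp
  moreover have "shift t S \<inter> B \<subseteq> (\<lambda>s. s + t) ` (S \<inter> (\<lambda>s. s - t) ` B)"
    by (force simp: shift_def)
  ultimately show "finite (shift t S \<inter> B)" by (rule finite_subset[rotated])
qed

lemma shift_Int: "shift t S \<inter> B = (\<lambda>s. s + t) ` (S \<inter> ((\<lambda>s. s + t) -` B))"
  by (auto simp: shift_def)

lemma num_points_shift: "num_points B (shift t S) = num_points ((\<lambda>s. s + t) -` B) S"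
proof -
  have inj: "inj_on (\<lambda>s. s + t) A" for A :: "real set" by (simp add: inj_on_def)
  show ?thesis
    unfolding num_points_def shift_Int
    by (simp add: emeasure_count_space finite_image_iff[OF inj] card_image[OF inj])
qed

lemma measurable_shift: "shift t \<in> configs \<rightarrow>\<^sub>M configs"
proof (rule measurable_configsI)
  fix B :: "real set" assume B: "B \<in> sets borel"
  have "(\<lambda>s. s + t) -` B \<in> sets borel"
    using measurable_sets_borel[of "\<lambda>s. s + t" borel B] B by simp
  then show "(\<lambda>w. num_points B (shift t w)) \<in> borel_measurable configs"
    unfolding num_points_shift by (rule measurable_num_points)
qed (simp add: space_configs locally_finite_shift)

lemma poisson_process_shift:
  assumes X: "poisson_process l P X"
  shows "poisson_process l P (\<lambda>w. shift t (X w))"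
proof -
  have vb: "(\<lambda>s. s + t) -` B \<in> sets borel" if "B \<in> sets borel" for B :: "real set"
    using measurable_sets_borel[of "\<lambda>s. s + t" borel B] that by simp
  have em: "emeasure lborel ((\<lambda>s. s + t) -` B) = emeasure lborel B" if B: "B \<in> sets borel" for B :: "real set"
  proof -
    have "emeasure lborel B = emeasure (distr lborel borel ((+) t)) B" by (simp add: lborel_distr_plus)
    also have "\<dots> = emeasure lborel ((+) t -` B \<inter> space lborel)"
      by (rule emeasure_distr) (use B in auto)
    also have "(+) t -` B \<inter> space lborel = (\<lambda>s. s + t) -` B" by (auto simp: add.commute)
    finally show ?thesis by simp
  qed
  have ms: "measure lborel ((\<lambda>s. s + t) -` B) = measure lborel B" if "B \<in> sets borel" for B :: "real set"
    using em[OF that] by (simp add: measure_def)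
  show ?thesis
    unfolding poisson_process_def num_points_shift
  proof (intro conjI ballI allI impI)
    show "prob_space P" using X by (simp add: poisson_process_def)
    have "X \<in> P \<rightarrow>\<^sub>M configs" using X by (simp add: poisson_process_def)
    from measurable_compose[OF this measurable_shift] show "(\<lambda>w. shift t (X w)) \<in> P \<rightarrow>\<^sub>M configs" .
  next
    fix B :: "real set" and k :: nat assume B: "B \<in> sets borel" "emeasure lborel B < \<infinity>"
    have "measure P {w \<in> space P. num_points ((\<lambda>s. s + t) -` B) (X w) = of_nat k} =
       (l * measure lborel ((\<lambda>s. s + t) -` B)) ^ k / fact k * exp (- (l * measure lborel ((\<lambda>s. s + t) -` B)))"
      using X vb[OF B(1)] B(2) unfolding poisson_process_def em[OF B(1), symmetric] by blast
    then show "measure P {w \<in> space P. num_points ((\<lambda>s. s + t) -` B) (X w) = of_nat k} =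
       (l * measure lborel B) ^ k / fact k * exp (- (l * measure lborel B))"
      by (simp only: ms[OF B(1)])
  next
    fix I :: "nat set" and B :: "nat \<Rightarrow> real set" assume "finite I" "\<forall>i\<in>I. B i \<in> sets borel" "disjoint_family_on B I"
    then have "finite I" "\<forall>i\<in>I. (\<lambda>s. s + t) -` B i \<in> sets borel" "disjoint_family_on (\<lambda>i. (\<lambda>s. s + t) -` B i) I"
      using vb by (auto simp: disjoint_family_on_def)
    moreover have "prob_space.indep_vars P (\<lambda>_. borel) (\<lambda>i w. num_points (C i) (X w)) I"
      if "finite I" "\<forall>i\<in>I. C i \<in> sets borel" "disjoint_family_on C I" for C
      using X that unfolding poisson_process_def by blast
    ultimately show "prob_space.indep_vars P (\<lambda>_. borel) (\<lambda>i w. num_points ((\<lambda>s. s + t) -` B i) (X w)) I"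
      by simp
  qed
qed

text \<open>Lebesgue measure is invariant under translations, so a shifted Poisson process is again a Poisson
process of the same intensity, and the intensity determines the law.\<close>

lemma poisson_process_stationary:
  assumes X: "poisson_process l P X" and A: "A \<in> sets configs"
  shows "measure P {w \<in> space P. shift t (X w) \<in> A} = measure P {w \<in> space P. X w \<in> A}"
proof -
  have m: "X \<in> P \<rightarrow>\<^sub>M configs" "(\<lambda>w. shift t (X w)) \<in> P \<rightarrow>\<^sub>M configs"
    using X poisson_process_shift[OF X, of t] by (simp_all add: poisson_process_def)
  have "measure (distr P configs (\<lambda>w. shift t (X w))) A = measure (distr P configs X) A"
    using poisson_process_law_unique[OF X poisson_process_shift[OF X, of t]] by simp
  then show ?thesis
    using A by (simp add: measure_distr[OF m(1)] measure_distr[OF m(2)] vimage_def Int_def conj_commute)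
qed

text \<open>The events that can be approximated in probability by local events form a sigma-algebra: for a
countable union, finitely many members carry almost all of the mass, and their approximations can be
brought to one common level.\<close>

lemma approximation_by_local_event:
  assumes M: "prob_space M" "sets M = sets configs" and A: "A \<in> sets configs" and e: "0 < (e::real)"
  shows "\<exists>n\<ge>m. \<exists>T. measure M (sym_diff A (local_event n T)) < e"
proof -
  interpret M: prob_space M by fact
  have sp: "space M = space configs" using M(2) by (rule sets_eq_imp_space_eq)
  have le[measurable]: "local_event n T \<in> sets M" for n T by (simp add: M(2))
  have subM: "B \<in> sets M" if "B \<in> sigma_sets (space configs) local_events" for B
    using that M(2) sets_configs_local by simp
  have "A \<in> sigma_sets (space configs) local_events" using A sets_configs_local by simp
  then show ?thesis using e
  proof (induction arbitrary: e m)
    case (Basic a)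
    then obtain n T where a: "a = local_event n T" by (auto simp: local_events_def)
    obtain T' where "a = local_event (max n m) T'"
      unfolding a by (rule local_event_refine[of n "max n m" T]) auto
    with Basic show ?case by (intro exI[of _ "max n m"] conjI exI[of _ T']) auto
  next
    case Empty
    then show ?case by (intro exI[of _ m] conjI exI[of _ "{}"]) (auto simp: local_event_def)
  next
    case (Compl a)
    then obtain n T where n: "n \<ge> m" "measure M (sym_diff a (local_event n T)) < e" by blast
    have "a \<subseteq> space configs" using Compl(1) sets.sets_into_space[OF subM] sp by auto
    then have "sym_diff (space configs - a) (local_event n (- T)) = sym_diff a (local_event n T)"
      by (auto simp: local_event_def)
    with n show ?case by (intro exI[of _ n] conjI exI[of _ "- T"]) auto
  next
    case (Union a)
    have aM[measurable]: "a i \<in> sets M" for i using subM Union(1) by simp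
    have "(\<lambda>k. measure M (\<Union>i. a i) - measure M (\<Union>i<k. a i)) \<longlonglongrightarrow> measure M (\<Union>i. a i) - measure M (\<Union>i. a i)"
    proof (intro tendsto_diff tendsto_const)
      have "(\<lambda>k. measure M (\<Union>i<k. a i)) \<longlonglongrightarrow> measure M (\<Union>k. \<Union>i<k. a i)"
      proof (rule M.finite_Lim_measure_incseq)
        show "incseq (\<lambda>k. \<Union>i<k. a i)" by (intro incseq_SucI UN_mono) auto
      qed auto
      moreover have "(\<Union>k. \<Union>i<k. a i) = (\<Union>i. a i)" by auto
      ultimately show "(\<lambda>k. measure M (\<Union>i<k. a i)) \<longlonglongrightarrow> measure M (\<Union>i. a i)" by simp
    qed
    then have "(\<lambda>k. measure M (\<Union>i. a i) - measure M (\<Union>i<k. a i)) \<longlonglongrightarrow> 0" by simp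
    from order_tendstoD(2)[OF this, of "e / 2"] Union(3)
    obtain K where K: "measure M (\<Union>i. a i) - measure M (\<Union>i<K. a i) < e / 2"
      by (auto simp: eventually_sequentially)
    define d where "d = e / (2 * real (Suc K))"
    have d: "0 < d" using Union(3) by (simp add: d_def)
    have "\<forall>i. \<exists>n T. n \<ge> m \<and> measure M (sym_diff (a i) (local_event n T)) < d"
      using Union(2)[OF d] by blast
    then obtain nn TT where nT: "\<And>i. nn i \<ge> m" "\<And>i. measure M (sym_diff (a i) (local_event (nn i) (TT i))) < d"
      by metis
    define n where "n = Max (insert m (nn ` {..<K}))"
    have nn: "nn i \<le> n" if "i < K" for i unfolding n_def using that by (intro Max_ge) auto
    have mn: "m \<le> n" unfolding n_def by (intro Max_ge) auto
    have "\<exists>T'. local_event (nn i) (TT i) = local_event n T'" if "i < K" for i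
      by (rule local_event_refine[OF nn[OF that], of "TT i"]) blast
    then obtain T' where T': "\<And>i. i < K \<Longrightarrow> local_event (nn i) (TT i) = local_event n (T' i)" by metis
    define T where "T = (\<Union>i<K. T' i)"
    have "local_event n T = (\<Union>i<K. local_event n (T' i))" by (auto simp: T_def local_event_def)
    then have T: "local_event n T = (\<Union>i<K. local_event (nn i) (TT i))" using T' by auto
    let ?S = "\<lambda>i. sym_diff (a i) (local_event (nn i) (TT i))"
    have "measure M (sym_diff (\<Union>i. a i) (local_event n T))
        \<le> measure M (((\<Union>i. a i) - (\<Union>i<K. a i)) \<union> (\<Union>i<K. ?S i))"
      unfolding T by (rule M.finite_measure_mono) auto
    also have "\<dots> \<le> measure M ((\<Union>i. a i) - (\<Union>i<K. a i)) + measure M (\<Union>i<K. ?S i)"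
      by (rule measure_Un_le) auto
    also have "measure M ((\<Union>i. a i) - (\<Union>i<K. a i)) = measure M (\<Union>i. a i) - measure M (\<Union>i<K. a i)"
      by (rule M.finite_measure_Diff) auto
    also have "measure M (\<Union>i<K. ?S i) \<le> (\<Sum>i<K. measure M (?S i))"
      by (rule measure_UNION_le) auto
    also have "\<dots> \<le> (\<Sum>i<K. d)" by (intro sum_mono less_imp_le nT)
    also have "\<dots> \<le> e / 2" using Union(3) by (simp add: d_def field_simps)
    finally have "measure M (sym_diff (\<Union>i. a i) (local_event n T)) < e" using K by linarith
    with mn show ?case by blast
  qed
qed

section \<open>Recovering a dense process from a sparse one\<close>

text \<open>Shifts by multiples of \<open>1 / 2 ^ m\<close> permute the cells of every finer level \<open>n\<close>, so they carry local
events to functions of the counts in other cells of the same level.\<close>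

lemma cell_count_shift:
  assumes "m \<le> n"
  shows "cell_count n (shift (- (real_of_int j / 2 ^ m)) S) i = cell_count n S (i + j * 2 ^ (n - m))"
proof -
  have p: "(2::real) ^ n = 2 ^ m * 2 ^ (n - m)" using assms by (simp flip: power_add)
  have "\<lfloor>(s + - (real_of_int j / 2 ^ m)) * 2 ^ n\<rfloor> = \<lfloor>s * 2 ^ n\<rfloor> - j * 2 ^ (n - m)" for s
  proof -
    have "(s + - (real_of_int j / 2 ^ m)) * 2 ^ n = s * 2 ^ n - real_of_int (j * 2 ^ (n - m))"
      by (simp add: p field_simps)
    then show ?thesis by (simp only: floor_diff_of_int)
  qed
  then have "(\<lambda>s. s + - (real_of_int j / 2 ^ m)) -` dyadic_cell n i = dyadic_cell n (i + j * 2 ^ (n - m))"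
    by (auto simp: dyadic_cell_def)
  then have "shift (- (real_of_int j / 2 ^ m)) S \<inter> dyadic_cell n i
      = (\<lambda>s. s + - (real_of_int j / 2 ^ m)) ` (S \<inter> dyadic_cell n (i + j * 2 ^ (n - m)))"
    by (simp add: shift_Int)
  moreover have "inj_on (\<lambda>s. s + - (real_of_int j / 2 ^ m)) A" for A by (simp add: inj_on_def)
  ultimately show ?thesis unfolding cell_count_def by (simp only: card_image)
qed

lemma card_occupied_le:
  assumes "finite I"
  shows "card (occupied I J blk v) \<le> (\<Sum>i\<in>I. v i)"
proof -
  have "occupied I J blk v \<subseteq> blk ` {i\<in>I. 0 < v i}" by (auto simp: occupied_def)
  then have "card (occupied I J blk v) \<le> card {i\<in>I. 0 < v i}"
    using assms by (intro surj_card_le) auto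
  also have "\<dots> = (\<Sum>i\<in>{i\<in>I. 0 < v i}. 1)" by simp
  also have "\<dots> \<le> (\<Sum>i\<in>{i\<in>I. 0 < v i}. v i)" by (intro sum_mono) auto
  also have "\<dots> \<le> (\<Sum>i\<in>I. v i)" using assms by (intro sum_mono2) auto
  finally show ?thesis .
qed

text \<open>Markov's inequality for the number of events that occur.\<close>

lemma (in prob_space) prob_card_gt_le:
  assumes J: "finite J" and E: "\<And>j. j \<in> J \<Longrightarrow> E j \<in> events" and a: "0 < (a::real)"
  shows "prob {w \<in> space M. a < real (card {j\<in>J. w \<in> E j})} \<le> (\<Sum>j\<in>J. prob (E j)) / a"
proof -
  have eq: "real (card {j\<in>J. w \<in> E j}) = (\<Sum>j\<in>J. indicator (E j) w)" for w
    using J by (simp add: indicator_def sum.If_cases Int_def)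
  have m: "(\<lambda>w. \<Sum>j\<in>J. indicator (E j) w :: real) \<in> borel_measurable M"
    using E by (intro borel_measurable_sum borel_measurable_indicator)
  have int: "integrable M (\<lambda>w. indicator (E j) w :: real)" if "j \<in> J" for j
    using E[OF that] by (simp add: integrable_indicator_iff emeasure_eq_measure)
  have "prob {w \<in> space M. a < (\<Sum>j\<in>J. indicator (E j) w)}
      \<le> prob {w \<in> space M. a \<le> (\<Sum>j\<in>J. indicator (E j) w)}"
    using m by (intro finite_measure_mono) auto
  also have "\<dots> \<le> (\<integral>w. (\<Sum>j\<in>J. indicator (E j) w) \<partial>M) / a"
  proof (rule integral_Markov_inequality_measure[where A = "{}"])
    show "integrable M (\<lambda>w. \<Sum>j\<in>J. indicator (E j) w :: real)"
      using int by (rule Bochner_Integration.integrable_sum)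
  qed (use a in \<open>auto intro!: sum_nonneg\<close>)
  also have "(\<integral>w. (\<Sum>j\<in>J. indicator (E j) w :: real) \<partial>M) = (\<Sum>j\<in>J. \<integral>w. indicator (E j) w \<partial>M)"
    using int by (rule Bochner_Integration.integral_sum)
  also have "\<dots> = (\<Sum>j\<in>J. prob (E j))"
    using E sets.sets_into_space by (intro sum.cong) (auto simp: Int_absorb2)
  finally show ?thesis unfolding eq .
qed

text \<open>The cells of level \<open>n\<close> in \<open>{- n ..< N + n}\<close>.  The margin of length \<open>n\<close> on both sides contains the
information that a local event of level \<open>n\<close> reads after a shift into \<open>{0 ..< N}\<close>.\<close>

definition long_window :: "nat \<Rightarrow> nat \<Rightarrow> int set" where
  "long_window n N = {- int n * 2 ^ n ..< int (N + n) * 2 ^ n}"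

text \<open>The indices of the blocks of length \<open>1 / 2 ^ m\<close> in \<open>{0 ..< N}\<close>.\<close>

definition blocks :: "nat \<Rightarrow> nat \<Rightarrow> int set" where
  "blocks m N = {0 ..< int N * 2 ^ m}"

lemma finite_long_window [simp]: "finite (long_window n N)" and finite_blocks [simp]: "finite (blocks m N)"
  by (simp_all add: long_window_def blocks_def)

lemma card_blocks: "card (blocks m N) = N * 2 ^ m"
  by (simp add: blocks_def nat_mult_distrib nat_power_eq)

lemma block_cells:
  assumes "m \<le> n" "j \<in> blocks m N"
  shows "{j * 2 ^ (n - m) ..< (j + 1) * 2 ^ (n - m)} \<subseteq> long_window n N"
    and "{i \<in> long_window n N. i div 2 ^ (n - m) = j} = {j * 2 ^ (n - m) ..< (j + 1) * 2 ^ (n - m)}"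
proof -
  have d: "(2::int) ^ m * 2 ^ (n - m) = 2 ^ n" using assms(1) by (simp flip: power_add)
  show sub: "{j * 2 ^ (n - m) ..< (j + 1) * 2 ^ (n - m)} \<subseteq> long_window n N"
  proof
    fix i assume i: "i \<in> {j * 2 ^ (n - m) ..< (j + 1) * 2 ^ (n - m)}"
    have "0 \<le> j * 2 ^ (n - m)" using assms(2) by (simp add: blocks_def)
    then have "0 \<le> i" using i by simp
    moreover have "- int n * 2 ^ n \<le> 0" by simp
    ultimately have 1: "- int n * 2 ^ n \<le> i" by linarith
    have "i < (j + 1) * 2 ^ (n - m)" using i by simp
    also have "\<dots> \<le> (int N * 2 ^ m) * 2 ^ (n - m)"
      using assms(2) by (intro mult_right_mono) (auto simp: blocks_def)
    also have "\<dots> = int N * 2 ^ n" by (simp add: d mult.assoc)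
    also have "\<dots> \<le> int (N + n) * 2 ^ n" by (intro mult_right_mono) auto
    finally show "i \<in> long_window n N" using 1 by (simp add: long_window_def)
  qed
  have "i div 2 ^ (n - m) = j \<longleftrightarrow> i \<in> {j * 2 ^ (n - m) ..< (j + 1) * 2 ^ (n - m)}" for i
    by (rule div_eq_iff_interval) simp
  then show "{i \<in> long_window n N. i div 2 ^ (n - m) = j} = {j * 2 ^ (n - m) ..< (j + 1) * 2 ^ (n - m)}"
    using sub by blast
qed

lemma window_shift_subset_long_window:
  assumes "m \<le> n" "j \<in> blocks m N" "i \<in> window n"
  shows "i + j * 2 ^ (n - m) \<in> long_window n N"
proof -
  have d: "(2::int) ^ m * 2 ^ (n - m) = 2 ^ n" using assms(1) by (simp flip: power_add)
  have "0 \<le> j * 2 ^ (n - m)" using assms(2) by (simp add: blocks_def)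
  moreover have "j * 2 ^ (n - m) \<le> (int N * 2 ^ m) * 2 ^ (n - m)"
    using assms(2) by (intro mult_right_mono) (auto simp: blocks_def)
  moreover have "(int N * 2 ^ m) * 2 ^ (n - m) = int N * 2 ^ n" unfolding mult.assoc d ..
  moreover have "- int n * 2 ^ n \<le> i" "i < int n * 2 ^ n" using assms(3) by (simp_all add: window_def)
  moreover have "int (N + n) * 2 ^ n = int N * 2 ^ n + int n * 2 ^ n" by (simp add: distrib_right)
  ultimately show ?thesis unfolding long_window_def atLeastLessThan_iff by linarith
qed

lemma card_boundary_cells:
  assumes "m \<le> n"
  shows "real (card {i \<in> long_window n N. i div 2 ^ (n - m) \<notin> blocks m N}) \<le> 2 * real n * 2 ^ n"
proof -
  have d: "(2::int) ^ m * 2 ^ (n - m) = 2 ^ n" using assms(1) by (simp flip: power_add)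
  have "{i \<in> long_window n N. i div 2 ^ (n - m) \<notin> blocks m N}
      \<subseteq> {- int n * 2 ^ n ..< 0} \<union> {int N * 2 ^ n ..< int (N + n) * 2 ^ n}"
  proof
    fix i assume i: "i \<in> {i \<in> long_window n N. i div 2 ^ (n - m) \<notin> blocks m N}"
    have h: "i div 2 ^ (n - m) \<in> blocks m N" if "0 \<le> i" "i < int N * 2 ^ n"
    proof -
      have "i div 2 ^ (n - m) < int N * 2 ^ m"
      proof (rule ccontr)
        assume "\<not> ?thesis"
        then have "(int N * 2 ^ m) * 2 ^ (n - m) \<le> (i div 2 ^ (n - m)) * 2 ^ (n - m)"
          by (intro mult_right_mono) auto
        also have "\<dots> \<le> (i div 2 ^ (n - m)) * 2 ^ (n - m) + i mod 2 ^ (n - m)" by simp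
        also have "\<dots> = i" by (rule div_mult_mod_eq)
        finally show False using that unfolding mult.assoc d by simp
      qed
      moreover have "0 \<le> i div 2 ^ (n - m)" using that by (simp add: pos_imp_zdiv_nonneg_iff)
      ultimately show ?thesis by (simp add: blocks_def)
    qed
    have "i < 0 \<or> int N * 2 ^ n \<le> i" using h i by fastforce
    with i show "i \<in> {- int n * 2 ^ n ..< 0} \<union> {int N * 2 ^ n ..< int (N + n) * 2 ^ n}"
      unfolding long_window_def by auto
  qed
  then have "card {i \<in> long_window n N. i div 2 ^ (n - m) \<notin> blocks m N}
      \<le> card ({- int n * 2 ^ n ..< 0} \<union> {int N * 2 ^ n ..< int (N + n) * 2 ^ n})"
    by (intro card_mono) auto
  also have "\<dots> \<le> card {- int n * 2 ^ n ..< 0} + card {int N * 2 ^ n ..< int (N + n) * 2 ^ n}"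
    by (rule card_Un_le)
  also have "\<dots> = n * 2 ^ n + n * 2 ^ n"
    by (simp add: nat_mult_distrib nat_power_eq left_diff_distrib[symmetric])
  finally have "real (card {i \<in> long_window n N. i div 2 ^ (n - m) \<notin> blocks m N}) \<le> real (n * 2 ^ n + n * 2 ^ n)"
    by (rule of_nat_mono)
  then show ?thesis by simp
qed

lemma sum_long_window_cell_count:
  assumes "locally_finite S"
  shows "(\<Sum>i\<in>long_window n N. cell_count n S i) = card (S \<inter> {- real n ..< real (N + n)})"
  using card_Int_floor_cells[OF assms finite_long_window[of n N], of n]
  unfolding long_window_def floor_cell_preimage_eq by simp

text \<open>The function \<open>R\<close> guesses from the counts of the subprocess \<open>X\<close> which blocks the process \<open>Y\<close> occupies.
The bound is a union bound over all subsets of \<open>Y\<close>, so it holds whichever of them \<open>X\<close> is and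
however it depends on \<open>Y\<close>.  The exponent \<open>\<kappa> - a\<close> is negative
when the number \<open>a\<close> of added points exceeds the number \<open>\<kappa>\<close> of tolerated errors, and then the bound
decays as the block length \<open>1 / 2 ^ m\<close> decreases.\<close>

lemma prob_reconstructible_window_le:
  fixes a b \<kappa> :: real
  assumes Y: "poisson_process l' P Y" and l': "0 \<le> l'" and mn: "m \<le> n"
    and XY: "\<And>w. w \<in> space P \<Longrightarrow> X w \<subseteq> Y w"
    and R: "\<And>x. R x \<subseteq> blocks m N"
  defines "I \<equiv> long_window n N" and "J \<equiv> blocks m N" and "W \<equiv> {- real n ..< real (N + n)}"
  shows "measure P {w \<in> space P.
      a \<le> real (card (Y w \<inter> W)) - real (card (X w \<inter> W)) \<and> real (card (Y w \<inter> W)) \<le> b \<and>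
      real (card (sym_diff (occupied I J (\<lambda>i. i div 2 ^ (n - m)) (cell_count n (Y w))) (R (restrict (cell_count n (X w)) I)))) \<le> \<kappa>}
    \<le> (2 ^ m) powr (\<kappa> - a) * exp (real N + l' * b + 2 * real n * l' * 2 ^ m)"
    (is "measure P ?Ev \<le> ?bound")
proof -
  define blk where "blk = (\<lambda>i::int. i div 2 ^ (n - m))"
  \<comment> \<open>on the event in question no count exceeds \<open>b\<close>, so finitely many vectors are involved\<close>
  define T where "T = nat \<lfloor>b\<rfloor>"
  define \<mu> where "\<mu> = l' / 2 ^ n"
  let ?P = "PiE I (\<lambda>_. {..T})"
  define E where "E = {(x, z). x \<in> ?P \<and> z \<in> ?P \<and> a \<le> real (\<Sum>i\<in>I. z i) \<and>
     real (card (occupied I J blk (\<lambda>i. x i + z i))) \<le> b \<and>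
     real (card (sym_diff (occupied I J blk (\<lambda>i. x i + z i)) (R x))) \<le> \<kappa>}"
  have fin: "finite I" "finite J" by (simp_all add: I_def J_def)
  have mY: "Y \<in> P \<rightarrow>\<^sub>M configs" and P: "prob_space P" using Y by (simp_all add: poisson_process_def)
  interpret P: prob_space P by fact
  have lfY: "locally_finite (Y w)" if "w \<in> space P" for w
    using measurable_space[OF mY that] by (simp add: space_configs)
  have lfX: "locally_finite (X w)" if "w \<in> space P" for w
    using lfY[OF that] XY[OF that] unfolding locally_finite_def by (meson Int_mono finite_subset order_refl)
  have Esub: "E \<subseteq> ?P \<times> ?P" by (auto simp: E_def)
  have finE: "finite E" by (rule finite_subset[OF Esub]) (use fin in \<open>auto intro!: finite_PiE\<close>)
  define F where "F = (\<lambda>(x, z). {w \<in> space P. \<forall>i\<in>I. cell_count n (Y w) i = x i + z i})"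
  have Fm: "F p \<in> sets P" for p
  proof -
    have m1: "(\<lambda>w. cell_count n (Y w) i) \<in> P \<rightarrow>\<^sub>M count_space UNIV" for i
      by (rule measurable_compose[OF mY measurable_cell_count])
    have "{w \<in> space P. cell_count n (Y w) i = k} \<in> sets P" for i k using m1 by measurable
    then show ?thesis unfolding F_def using fin by (auto simp: split_beta intro!: sets.sets_Collect_finite_All')
  qed
  have sub: "?Ev \<subseteq> (\<Union>p\<in>E. F p)"
  proof
    fix w assume "w \<in> ?Ev"
    then have w: "w \<in> space P" and w1: "a \<le> real (card (Y w \<inter> W)) - real (card (X w \<inter> W))"
      and w2: "real (card (Y w \<inter> W)) \<le> b"
      and w3: "real (card (sym_diff (occupied I J blk (cell_count n (Y w))) (R (restrict (cell_count n (X w)) I)))) \<le> \<kappa>"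
      by (auto simp: blk_def)
    define x where "x = restrict (cell_count n (X w)) I"
    define z where "z = restrict (\<lambda>i. cell_count n (Y w) i - cell_count n (X w) i) I"
    have le: "cell_count n (X w) i \<le> cell_count n (Y w) i" for i
      unfolding cell_count_def using lfY[OF w] XY[OF w] bounded_dyadic_cell
      by (intro card_mono) (auto simp: locally_finite_def)
    have xz: "x i + z i = cell_count n (Y w) i" if "i \<in> I" for i
      using le[of i] that by (simp add: x_def z_def)
    have sY: "(\<Sum>i\<in>I. cell_count n (Y w) i) = card (Y w \<inter> W)"
      and sX: "(\<Sum>i\<in>I. cell_count n (X w) i) = card (X w \<inter> W)"
      unfolding I_def W_def using sum_long_window_cell_count lfY[OF w] lfX[OF w] by blast+
    have cT: "cell_count n (Y w) i \<le> T" if "i \<in> I" for i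
    proof -
      have "cell_count n (Y w) i \<le> (\<Sum>i\<in>I. cell_count n (Y w) i)" using that fin by (intro member_le_sum) auto
      then have "real (cell_count n (Y w) i) \<le> b" using w2 sY by linarith
      then show ?thesis unfolding T_def by linarith
    qed
    have "x \<in> ?P" "z \<in> ?P"
      using cT le by (auto simp: x_def z_def intro: order_trans diff_le_self)
    moreover have "a \<le> real (\<Sum>i\<in>I. z i)"
    proof -
      have "(\<Sum>i\<in>I. x i) + (\<Sum>i\<in>I. z i) = (\<Sum>i\<in>I. cell_count n (Y w) i)"
        by (simp add: xz flip: sum.distrib)
      moreover have "(\<Sum>i\<in>I. x i) = (\<Sum>i\<in>I. cell_count n (X w) i)" by (simp add: x_def)
      ultimately have "card (X w \<inter> W) + (\<Sum>i\<in>I. z i) = card (Y w \<inter> W)" using sX sY by simp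
      then show ?thesis using w1 by linarith
    qed
    moreover have occ: "occupied I J blk (\<lambda>i. x i + z i) = occupied I J blk (cell_count n (Y w))"
      by (auto simp: occupied_def xz)
    moreover have "real (card (occupied I J blk (cell_count n (Y w)))) \<le> b"
    proof -
      have "card (occupied I J blk (cell_count n (Y w))) \<le> card (Y w \<inter> W)"
        using card_occupied_le[OF fin(1), of J blk "cell_count n (Y w)"] sY by simp
      then show ?thesis using w2 by linarith
    qed
    ultimately have "(x, z) \<in> E" using w3 by (simp add: E_def occ flip: x_def)
    moreover have "w \<in> F (x, z)" using w xz by (simp add: F_def)
    ultimately show "w \<in> (\<Union>p\<in>E. F p)" by blast
  qed
  have mu: "0 \<le> \<mu>" using l' by (simp add: \<mu>_def)
  define bd where "bd = (2 ^ m) powr (\<kappa> - a) * (1 + 1 / 2 ^ m) ^ card J * exp (\<mu> * 2 ^ m * (b * 2 ^ (n - m) + 2 * real n * 2 ^ n))"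
  have "measure P ?Ev \<le> measure P (\<Union>p\<in>E. F p)"
    using sub Fm finE by (intro P.finite_measure_mono) auto
  also have "\<dots> \<le> (\<Sum>p\<in>E. measure P (F p))" by (rule measure_UNION_le[OF finE Fm])
  also have "\<dots> = (\<Sum>(x, z)\<in>E. \<Prod>i\<in>I. poisson_weight \<mu> (x i + z i))"
  proof (rule sum.cong[OF refl])
    fix p assume "p \<in> E"
    show "measure P (F p) = (case p of (x, z) \<Rightarrow> \<Prod>i\<in>I. poisson_weight \<mu> (x i + z i))"
      using poisson_process_prob_cell_count[OF Y fin(1), of n "\<lambda>i. fst p i + snd p i"]
      by (simp add: F_def \<mu>_def split_beta)
  qed
  also have "\<dots> \<le> bd"
  proof (rule sum_poisson_pairs_le[OF fin(1) mu Esub])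
    show "0 \<le> bd" unfolding bd_def by (intro mult_nonneg_nonneg zero_le_power) auto
    fix x assume "x \<in> ?P"
    show "(\<Sum>z | (x, z) \<in> E. \<Prod>i\<in>I. \<mu> ^ z i / fact (z i)) \<le> bd"
      unfolding bd_def
    proof (rule weight_of_completions_le[where blk = blk and J = J and R = "R x" and T = T and x = x, OF fin _ mu])
      fix j assume j: "j \<in> J"
      have "card {i \<in> I. blk i = j} = 2 ^ (n - m)"
        using block_cells(2)[OF mn, of j N] j
        by (simp add: I_def J_def blk_def nat_power_eq algebra_simps)
      then show "real (card {i \<in> I. blk i = j}) \<le> 2 ^ (n - m)" by simp
    next
      show "real (card {i \<in> I. blk i \<notin> J}) \<le> 2 * real n * 2 ^ n"
        unfolding I_def J_def blk_def by (rule card_boundary_cells[OF mn])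
      show "R x \<subseteq> J" unfolding J_def by (rule R)
    qed (auto simp: E_def)
  qed
  also have "bd \<le> ?bound"
  proof -
    have p: "(2::real) ^ n = 2 ^ m * 2 ^ (n - m)" using mn by (simp flip: power_add)
    have "(1 + 1 / 2 ^ m :: real) ^ card J \<le> exp (1 / 2 ^ m) ^ card J"
      by (intro power_mono exp_ge_add_one_self) auto
    also have "\<dots> = exp (real (card J) * (1 / 2 ^ m))" by (simp only: exp_of_nat_mult)
    also have "real (card J) * (1 / 2 ^ m) = real N" by (simp add: J_def card_blocks)
    finally have 1: "(1 + 1 / 2 ^ m :: real) ^ card J \<le> exp (real N)" .
    have "\<mu> * 2 ^ m * (b * 2 ^ (n - m) + 2 * real n * 2 ^ n) = l' * b + 2 * real n * l' * 2 ^ m"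
      by (simp add: \<mu>_def p field_simps)
    then have "bd = (2 ^ m) powr (\<kappa> - a) * ((1 + 1 / 2 ^ m) ^ card J * exp (l' * b + 2 * real n * l' * 2 ^ m))"
      by (simp add: bd_def)
    also have "\<dots> \<le> (2 ^ m) powr (\<kappa> - a) * (exp (real N) * exp (l' * b + 2 * real n * l' * 2 ^ m))"
      by (intro mult_left_mono mult_right_mono 1) auto
    finally show ?thesis by (simp add: exp_add mult.assoc)
  qed
  finally show ?thesis .
qed

section \<open>Generating functions, independence and product measures\<close>

text \<open>The first coefficient in which two power series differ would be the limit at 0 of their difference,
divided by the matching power of \<open>t\<close>; a limit from the right is enough to see that it vanishes.
Generating functions are only considered at arguments in the unit interval.\<close>

lemma powser_right_unique:
  fixes a b :: "nat \<Rightarrow> real"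
  assumes a: "\<And>t. 0 < t \<Longrightarrow> t < 1 \<Longrightarrow> (\<lambda>k. a k * t ^ k) sums h t"
    and b: "\<And>t. 0 < t \<Longrightarrow> t < 1 \<Longrightarrow> (\<lambda>k. b k * t ^ k) sums h t"
  shows "a = b"
proof (rule ccontr)
  assume "a \<noteq> b"
  define c where "c k = a k - b k" for k
  have "\<exists>k. c k \<noteq> 0" using \<open>a \<noteq> b\<close> by (auto simp: c_def fun_eq_iff)
  define m where "m = (LEAST k. c k \<noteq> 0)"
  have cm: "c m \<noteq> 0" unfolding m_def using \<open>\<exists>k. c k \<noteq> 0\<close> by (rule LeastI_ex)
  have cl: "c k = 0" if "k < m" for k using not_less_Least that unfolding m_def by blast
  have s: "(\<lambda>k. c (k + m) * t ^ k) sums 0" if t: "0 < t" "t < 1" for t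
  proof -
    have "(\<lambda>k. c k * t ^ k) sums 0"
      using sums_diff[OF a[OF t] b[OF t]] by (simp add: c_def left_diff_distrib)
    then have "(\<lambda>k. c (k + m) * t ^ (k + m)) sums 0"
      using sums_iff_shift[of "\<lambda>k. c k * t ^ k" m 0] cl by simp
    then have "(\<lambda>k. c (k + m) * t ^ (k + m) / t ^ m) sums (0 / t ^ m)" by (rule sums_divide)
    then show ?thesis using t by (simp add: power_add)
  qed
  define F where "F x = (\<Sum>k. c (k + m) * x ^ k)" for x
  have "(F \<longlongrightarrow> c (0 + m)) (at 0)"
  proof (rule powser_limit_0[of "1/2"])
    fix x :: real assume x: "norm x < 1/2"
    have "summable (\<lambda>k. c (k + m) * (1/2) ^ k)" using s[of "1/2"] by (simp add: sums_iff)
    then have "summable (\<lambda>k. c (k + m) * x ^ k)" by (rule powser_inside) (use x in simp)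
    then show "(\<lambda>k. c (k + m) * x ^ k) sums F x" unfolding F_def by (rule summable_sums)
  qed simp
  then have "(F \<longlongrightarrow> c m) (at_right 0)" by (auto intro: tendsto_within_subset)
  moreover have "(F \<longlongrightarrow> 0) (at_right 0)"
  proof (rule tendsto_eventually)
    have "F t = 0" if "0 < t" "t < 1" for t using s[OF that] by (simp add: F_def sums_iff)
    then show "\<forall>\<^sub>F t in at_right 0. F t = 0"
      by (auto simp: eventually_at_right_field intro!: exI[of _ 1])
  qed
  ultimately have "c m = 0" by (rule tendsto_unique[rotated]) simp
  with cm show False by simp
qed

lemma poisson_weight_gf_sums: "(\<lambda>k. poisson_weight r k * t ^ k) sums exp (r * (t - 1))"
proof -
  have "(\<lambda>k. (r * t) ^ k / fact k * exp (- r)) sums (exp (r * t) * exp (- r))"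
    using exp_converges[of "r * t"] by (intro sums_mult2) (simp add: divide_inverse mult.commute)
  moreover have "exp (r * t) * exp (- r) = exp (r * (t - 1))"
    by (simp add: exp_add[symmetric] algebra_simps)
  ultimately show ?thesis by (simp add: poisson_weight_def power_mult_distrib mult_ac)
qed

lemma (in prob_space) nn_integral_power_expand:
  fixes N :: "'a \<Rightarrow> nat" and Z :: "'a \<Rightarrow> ennreal"
  assumes N: "N \<in> M \<rightarrow>\<^sub>M count_space UNIV" and Z: "Z \<in> borel_measurable M"
  shows "(\<integral>\<^sup>+w. Z w * t ^ N w \<partial>M) = (\<Sum>k. (\<integral>\<^sup>+w. Z w * indicator {w. N w = k} w \<partial>M) * t ^ k)"
proof -
  have [measurable]: "{w \<in> space M. N w = k} \<in> sets M" for k using N by measurable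
  have m: "(\<lambda>w. Z w * indicator {w. N w = k} w) \<in> borel_measurable M" for k
  proof -
    have "(\<lambda>w. Z w * indicator {w \<in> space M. N w = k} w) \<in> borel_measurable M"
      using Z by measurable
    then show ?thesis by (rule measurable_cong[THEN iffD1, rotated]) (simp add: indicator_def)
  qed
  have "(\<integral>\<^sup>+w. Z w * t ^ N w \<partial>M) = (\<integral>\<^sup>+w. (\<Sum>k. Z w * indicator {w. N w = k} w * t ^ k) \<partial>M)"
  proof (rule nn_integral_cong)
    fix w
    have "(\<Sum>k. Z w * indicator {w. N w = k} w * t ^ k) = (\<Sum>k\<in>{N w}. Z w * indicator {w. N w = k} w * t ^ k)"
      by (rule suminf_finite) auto
    then show "Z w * t ^ N w = (\<Sum>k. Z w * indicator {w. N w = k} w * t ^ k)" by simp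
  qed
  also have "\<dots> = (\<Sum>k. \<integral>\<^sup>+w. Z w * indicator {w. N w = k} w * t ^ k \<partial>M)"
    by (rule nn_integral_suminf) (use m in measurable)
  also have "\<dots> = (\<Sum>k. (\<integral>\<^sup>+w. Z w * indicator {w. N w = k} w \<partial>M) * t ^ k)"
    by (intro suminf_cong nn_integral_multc m)
  finally show ?thesis .
qed

text \<open>If \<open>t \<mapsto> E (Z * t ^ N)\<close> is the generating function of a Poisson law up to the factor \<open>c\<close>, then its
coefficients \<open>E (Z; N = k)\<close> are \<open>c\<close> times those of that law.  The weight \<open>Z\<close> will hold the other counts of a
vector.\<close>

lemma (in prob_space) poisson_gf_step:
  fixes N :: "'a \<Rightarrow> nat" and Z :: "'a \<Rightarrow> ennreal"
  assumes N: "N \<in> M \<rightarrow>\<^sub>M count_space UNIV" and Z: "Z \<in> borel_measurable M" and c: "0 \<le> c" and r: "0 \<le> r"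
    and gf: "\<And>t. 0 \<le> t \<Longrightarrow> t \<le> 1 \<Longrightarrow> (\<integral>\<^sup>+w. Z w * ennreal t ^ N w \<partial>M) = ennreal (c * exp (r * (t - 1)))"
  shows "(\<integral>\<^sup>+w. Z w * indicator {w. N w = k} w \<partial>M) = ennreal (c * poisson_weight r k)"
proof -
  define e where "e k = (\<integral>\<^sup>+w. Z w * indicator {w. N w = k} w \<partial>M)" for k
  have "(\<integral>\<^sup>+w. Z w \<partial>M) = ennreal c" using gf[of 1] by simp
  moreover have "e k \<le> (\<integral>\<^sup>+w. Z w \<partial>M)" for k
    unfolding e_def by (intro nn_integral_mono) (auto simp: indicator_def)
  ultimately have "e k < \<top>" for k by (metis ennreal_less_top le_less_trans)
  then have e: "e k = ennreal (enn2real (e k))" for k by simp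
  have "(\<lambda>k. enn2real (e k)) = (\<lambda>k. c * poisson_weight r k)"
  proof (rule powser_right_unique)
    fix t :: real assume t: "0 < t" "t < 1"
    have "ennreal (c * exp (r * (t - 1))) = (\<Sum>k. e k * ennreal t ^ k)"
      using gf[of t] t nn_integral_power_expand[OF N Z, of "ennreal t"] by (simp add: e_def)
    also have "(\<lambda>k. e k * ennreal t ^ k) = (\<lambda>k. ennreal (enn2real (e k) * t ^ k))"
      by (subst e) (use t in \<open>simp add: ennreal_mult ennreal_power\<close>)
    finally have s: "(\<Sum>k. ennreal (enn2real (e k) * t ^ k)) = ennreal (c * exp (r * (t - 1)))" by simp
    have sm: "summable (\<lambda>k. enn2real (e k) * t ^ k)"
      by (rule summable_suminf_not_top) (use s t in auto)
    then have "ennreal (\<Sum>k. enn2real (e k) * t ^ k) = ennreal (c * exp (r * (t - 1)))"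
      using s t by (subst (asm) suminf_ennreal2) auto
    then have "(\<Sum>k. enn2real (e k) * t ^ k) = c * exp (r * (t - 1))"
      by (subst (asm) ennreal_inj) (use c t sm in \<open>auto intro!: suminf_nonneg\<close>)
    then show "(\<lambda>k. enn2real (e k) * t ^ k) sums (c * exp (r * (t - 1)))"
      using sm by (simp add: sums_iff)
  next
    fix t :: real
    show "(\<lambda>k. c * poisson_weight r k * t ^ k) sums (c * exp (r * (t - 1)))"
      using sums_mult[OF poisson_weight_gf_sums[of r t], of c] by (simp add: mult.assoc)
  qed
  then have "enn2real (e k) = c * poisson_weight r k" by (rule fun_cong)
  then show ?thesis using e[of k] by (simp add: e_def)
qed

text \<open>A vector of counts whose joint generating function is that of independent Poisson variables has
their joint law.  The coefficients are extracted one variable at a time: after the variables in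
\<open>A\<close> have been treated, their generating factors are replaced by indicators, the others are still
present.\<close>

lemma (in prob_space) independent_poisson_from_gf:
  fixes N :: "'i \<Rightarrow> 'a \<Rightarrow> nat" and r :: "'i \<Rightarrow> real"
  assumes J: "finite J" and N: "\<And>j. j \<in> J \<Longrightarrow> N j \<in> M \<rightarrow>\<^sub>M count_space UNIV" and r: "\<And>j. j \<in> J \<Longrightarrow> 0 \<le> r j"
    and gf: "\<And>s. (\<And>j. j \<in> J \<Longrightarrow> 0 \<le> s j \<and> s j \<le> 1) \<Longrightarrow>
       (\<integral>\<^sup>+w. (\<Prod>j\<in>J. ennreal (s j) ^ N j w) \<partial>M) = ennreal (\<Prod>j\<in>J. exp (r j * (s j - 1)))"
  shows "prob {w \<in> space M. \<forall>j\<in>J. N j w = k j} = (\<Prod>j\<in>J. poisson_weight (r j) (k j))"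
proof -
  define I where "I A w = (\<Prod>j\<in>A. indicator {w. N j w = k j} w :: ennreal)" for A w
  have Im: "I A \<in> borel_measurable M" if "A \<subseteq> J" for A
  proof -
    have "(\<lambda>w. indicator {w. N j w = k j} w :: ennreal) \<in> borel_measurable M" if "j \<in> J" for j
    proof -
      have "(\<lambda>w. indicator {k j} (N j w) :: ennreal) \<in> borel_measurable M"
        by (rule measurable_compose[OF N[OF that]]) simp
      then show ?thesis by (simp add: indicator_def)
    qed
    then show ?thesis unfolding I_def[abs_def] using that by (intro borel_measurable_prod_ennreal) auto
  qed
  have main: "(\<integral>\<^sup>+w. I A w * (\<Prod>j\<in>J - A. ennreal (s j) ^ N j w) \<partial>M)
      = ennreal ((\<Prod>j\<in>A. poisson_weight (r j) (k j)) * (\<Prod>j\<in>J - A. exp (r j * (s j - 1))))"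
    if "A \<subseteq> J" "\<And>j. j \<in> J \<Longrightarrow> 0 \<le> s j \<and> s j \<le> 1" for A s
    using finite_subset[OF that(1) J] that
  proof (induction A arbitrary: s rule: finite_induct)
    case empty
    then show ?case using gf[of s] by (simp add: I_def)
  next
    case (insert a A)
    define Z where "Z w = I A w * (\<Prod>j\<in>J - insert a A. ennreal (s j) ^ N j w)" for w
    define c where "c = (\<Prod>j\<in>A. poisson_weight (r j) (k j)) * (\<Prod>j\<in>J - insert a A. exp (r j * (s j - 1)))"
    have aJ: "a \<in> J" and AJ: "A \<subseteq> J" using insert by auto
    have split: "J - A = insert a (J - insert a A)" using insert by auto
    have fin: "finite (J - insert a A)" using J by simp
    have Zm: "Z \<in> borel_measurable M"
    proof -
      have "(\<lambda>w. ennreal (s j) ^ N j w) \<in> borel_measurable M" if "j \<in> J" for j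
        by (rule measurable_compose[OF N[OF that]]) simp
      then show ?thesis unfolding Z_def[abs_def]
        using Im[OF AJ] by (intro borel_measurable_times_ennreal borel_measurable_prod_ennreal) auto
    qed
    have c0: "0 \<le> c"
      unfolding c_def using r AJ by (intro mult_nonneg_nonneg prod_nonneg ballI poisson_weight_nonneg) auto
    have "(\<integral>\<^sup>+w. Z w * indicator {w. N a w = k a} w \<partial>M) = ennreal (c * poisson_weight (r a) (k a))"
    proof (rule poisson_gf_step[OF N[OF aJ] Zm c0 r[OF aJ]])
      fix t :: real assume t: "0 \<le> t" "t \<le> 1"
      have eq: "(\<Prod>j\<in>J - insert a A. f j ((s(a := t)) j)) = (\<Prod>j\<in>J - insert a A. f j (s j))" for f :: "'i \<Rightarrow> real \<Rightarrow> 'z::comm_monoid_mult"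
        by (rule prod.cong) auto
      have "Z w * ennreal t ^ N a w = I A w * (\<Prod>j\<in>J - A. ennreal ((s(a := t)) j) ^ N j w)" for w
        unfolding split using fin eq[of "\<lambda>j x. ennreal x ^ N j w"] by (simp add: Z_def mult_ac)
      then have "(\<integral>\<^sup>+w. Z w * ennreal t ^ N a w \<partial>M)
          = ennreal ((\<Prod>j\<in>A. poisson_weight (r j) (k j)) * (\<Prod>j\<in>J - A. exp (r j * ((s(a := t)) j - 1))))"
        using insert.IH[OF AJ, of "s(a := t)"] insert.prems t by simp
      also have "(\<Prod>j\<in>J - A. exp (r j * ((s(a := t)) j - 1)))
          = exp (r a * (t - 1)) * (\<Prod>j\<in>J - insert a A. exp (r j * (s j - 1)))"
        unfolding split using fin eq[of "\<lambda>j x. exp (r j * (x - 1))"] by simp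
      finally show "(\<integral>\<^sup>+w. Z w * ennreal t ^ N a w \<partial>M) = ennreal (c * exp (r a * (t - 1)))"
        by (simp add: c_def mult_ac)
    qed
    moreover have "I (insert a A) w * (\<Prod>j\<in>J - insert a A. ennreal (s j) ^ N j w) = Z w * indicator {w. N a w = k a} w" for w
      using insert.hyps by (simp add: I_def Z_def mult_ac)
    ultimately show ?case using insert.hyps by (simp add: c_def mult_ac)
  qed
  have "(\<integral>\<^sup>+w. I J w \<partial>M) = ennreal (\<Prod>j\<in>J. poisson_weight (r j) (k j))"
    using main[of J "\<lambda>_. 1"] by simp
  moreover have "(\<integral>\<^sup>+w. I J w \<partial>M) = emeasure M {w \<in> space M. \<forall>j\<in>J. N j w = k j}"
  proof -
    have m: "{w \<in> space M. \<forall>j\<in>J. N j w = k j} \<in> sets M"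
      using J N by (intro sets.sets_Collect_finite_All) measurable
    have "(\<integral>\<^sup>+w. I J w \<partial>M) = (\<integral>\<^sup>+w. indicator {w \<in> space M. \<forall>j\<in>J. N j w = k j} w \<partial>M)"
      by (rule nn_integral_cong) (use J in \<open>auto simp: I_def indicator_def\<close>)
    then show ?thesis using m by simp
  qed
  ultimately have "ennreal (prob {w \<in> space M. \<forall>j\<in>J. N j w = k j}) = ennreal (\<Prod>j\<in>J. poisson_weight (r j) (k j))"
    by (simp add: emeasure_eq_measure)
  then show ?thesis
    by (subst (asm) ennreal_inj) (use r in \<open>auto intro!: prod_nonneg poisson_weight_nonneg\<close>)
qed

text \<open>For variables with values in the natural numbers and infinity, independence can be tested on the
events \<open>N i = k\<close> with finite \<open>k\<close>: together with the empty set they are closed under intersection, and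
the event that \<open>N i\<close> is infinite is the complement of their union.\<close>

lemma (in prob_space) indep_vars_from_nat_atoms:
  fixes N :: "'i \<Rightarrow> 'a \<Rightarrow> ennreal"
  assumes N: "\<And>i. i \<in> I \<Longrightarrow> N i \<in> borel_measurable M"
    and range: "\<And>i w. i \<in> I \<Longrightarrow> w \<in> space M \<Longrightarrow> N i w = \<top> \<or> (\<exists>k::nat. N i w = of_nat k)"
    and atoms: "\<And>J k. J \<subseteq> I \<Longrightarrow> finite J \<Longrightarrow> J \<noteq> {} \<Longrightarrow>
      prob {w \<in> space M. \<forall>j\<in>J. N j w = of_nat (k j)} = (\<Prod>j\<in>J. prob {w \<in> space M. N j w = of_nat (k j)})"
  shows "indep_vars (\<lambda>_. borel) N I"
proof -
  define atom where "atom i k = {w \<in> space M. N i w = of_nat k}" for i and k :: nat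
  define G where "G i = insert {} (range (atom i))" for i
  have atomE: "atom i k \<in> events" if "i \<in> I" for i k
    unfolding atom_def using N[OF that] by measurable
  have "indep_sets G I"
  proof (rule indep_setsI)
    fix i assume "i \<in> I"
    then show "G i \<subseteq> events" using atomE by (auto simp: G_def)
  next
    fix A J assume J: "J \<noteq> {}" "J \<subseteq> I" "finite J" and A: "\<forall>j\<in>J. A j \<in> G j"
    show "prob (\<Inter>j\<in>J. A j) = (\<Prod>j\<in>J. prob (A j))"
    proof (cases "\<exists>j\<in>J. A j = {}")
      case True
      then have "(\<Inter>j\<in>J. A j) = {}" by blast
      moreover obtain j where j: "j \<in> J" "A j = {}" using True by blast
      then have "\<exists>j\<in>J. prob (A j) = 0" by (intro bexI[of _ j]) simp_all
      then have "(\<Prod>j\<in>J. prob (A j)) = 0" by (rule prod_zero[OF J(3)])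
      ultimately show ?thesis by simp
    next
      case False
      then have "\<forall>j\<in>J. \<exists>k. A j = atom j k" using A by (auto simp: G_def image_iff)
      then obtain k where k: "\<And>j. j \<in> J \<Longrightarrow> A j = atom j (k j)" by metis
      have "(\<Inter>j\<in>J. A j) = {w \<in> space M. \<forall>j\<in>J. N j w = of_nat (k j)}"
        using k J(1) by (auto simp: atom_def)
      then show ?thesis
        using atoms[OF J(2,3,1), of k] k by (simp add: atom_def)
    qed
  qed
  moreover have "Int_stable (G i)" for i
    unfolding Int_stable_def G_def by (auto simp: atom_def)
  ultimately have "indep_sets (\<lambda>i. sigma_sets (space M) (G i)) I"
    by (intro indep_sets_sigma)
  then have "indep_sets (\<lambda>i. {N i -` A \<inter> space M |A. A \<in> sets borel}) I"
  proof (rule indep_sets_mono_sets)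
    fix i assume i: "i \<in> I"
    interpret S: sigma_algebra "space M" "sigma_sets (space M) (G i)"
      by (rule sigma_algebra_sigma_sets) (auto simp: G_def atom_def)
    have fin: "N i -` A \<inter> space M \<in> sigma_sets (space M) (G i)" if "\<top> \<notin> A" for A
    proof -
      have "N i -` A \<inter> space M = (\<Union>k\<in>{k. of_nat k \<in> A}. atom i k)"
        using range[OF i] that by (fastforce simp: atom_def)
      also have "\<dots> \<in> sigma_sets (space M) (G i)"
        by (rule S.countable_UN'') (auto simp: G_def)
      finally show ?thesis .
    qed
    have "N i -` A \<inter> space M \<in> sigma_sets (space M) (G i)" for A
    proof (cases "\<top> \<in> A")
      case True
      have "N i -` A \<inter> space M = space M - (N i -` (- A) \<inter> space M)" by auto
      also have "\<dots> \<in> sigma_sets (space M) (G i)" using True by (intro S.compl_sets fin) auto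
      finally show ?thesis .
    qed (rule fin)
    then show "{N i -` A \<inter> space M |A. A \<in> sets borel} \<subseteq> sigma_sets (space M) (G i)" by blast
  qed
  then show ?thesis unfolding indep_vars_def2 using N by blast
qed

lemma nn_integral_PiM_prod_coordinates:
  assumes M: "\<And>i. prob_space (M i)" and J: "finite J" and f: "\<And>i. i \<in> J \<Longrightarrow> f i \<in> borel_measurable (M i)"
  shows "(\<integral>\<^sup>+w. (\<Prod>i\<in>J. f i (w i)) \<partial>PiM UNIV M) = (\<Prod>i\<in>J. \<integral>\<^sup>+x. f i x \<partial>M i)"
proof -
  interpret M: prob_space "M q" for q by (rule M)
  interpret P: product_prob_space M UNIV by unfold_locales
  have "(\<integral>\<^sup>+w. (\<Prod>i\<in>J. f i (w i)) \<partial>PiM UNIV M) = (\<integral>\<^sup>+w. (\<Prod>i\<in>J. f i (restrict w J i)) \<partial>PiM UNIV M)"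
    by (intro nn_integral_cong prod.cong) auto
  also have "\<dots> = (\<integral>\<^sup>+w. (\<Prod>i\<in>J. f i (w i)) \<partial>distr (PiM UNIV M) (PiM J M) (\<lambda>x. restrict x J))"
    using f by (subst nn_integral_distr) (auto intro!: borel_measurable_prod_ennreal measurable_PiM_component_rev)
  also have "\<dots> = (\<integral>\<^sup>+w. (\<Prod>i\<in>J. f i (w i)) \<partial>PiM J M)"
    by (subst P.distr_PiM_restrict_finite[OF J]) auto
  also have "\<dots> = (\<Prod>i\<in>J. \<integral>\<^sup>+x. f i x \<partial>M i)"
    by (rule P.product_nn_integral_prod[OF J f])
  finally show ?thesis .
qed

text \<open>The pair of the two coordinates has the product law, under which the diagonal is a null set by
Fubini's theorem.\<close>

lemma AE_PiM_coordinates_distinct: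
  fixes M :: "'i \<Rightarrow> real measure" and i j :: 'i
  assumes M: "\<And>i. prob_space (M i)" and s: "\<And>i. sets (M i) = sets (borel :: real measure)"
    and atomless: "\<And>i x. emeasure (M i) {x} = 0" and ij: "i \<noteq> j"
  shows "AE w in PiM UNIV M. w i \<noteq> w j"
proof -
  interpret M: prob_space "M q" for q by (rule M)
  interpret P: product_prob_space M UNIV by unfold_locales
  interpret PP: pair_sigma_finite "M i" "M j" by unfold_locales
  have mp: "(\<lambda>w. (w i, w j)) \<in> PiM UNIV M \<rightarrow>\<^sub>M M i \<Otimes>\<^sub>M M j" by measurable
  have eq: "M i \<Otimes>\<^sub>M M j = distr (PiM UNIV M) (M i \<Otimes>\<^sub>M M j) (\<lambda>w. (w i, w j))"
  proof (rule pair_measure_eqI)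
    fix A B assume AB: "A \<in> sets (M i)" "B \<in> sets (M j)"
    have "emeasure (PiM UNIV M) {w \<in> space (PiM UNIV M). \<forall>k\<in>{i, j}. w k \<in> (if k = i then A else B)}
        = (\<Prod>k\<in>{i, j}. emeasure (M k) (if k = i then A else B))"
      using AB ij by (intro P.emeasure_PiM_Collect) auto
    moreover have "(\<forall>k\<in>{i, j}. w k \<in> (if k = i then A else B)) \<longleftrightarrow> w i \<in> A \<and> w j \<in> B" for w
      using ij by (auto split: if_splits)
    then have "{w \<in> space (PiM UNIV M). \<forall>k\<in>{i, j}. w k \<in> (if k = i then A else B)}
        = (\<lambda>w. (w i, w j)) -` (A \<times> B) \<inter> space (PiM UNIV M)" by auto
    ultimately show "emeasure (M i) A * emeasure (M j) B
        = emeasure (distr (PiM UNIV M) (M i \<Otimes>\<^sub>M M j) (\<lambda>w. (w i, w j))) (A \<times> B)"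
      using AB ij mp by (simp add: emeasure_distr)
  qed (auto intro: M.sigma_finite_measure_axioms)
  define D where "D = {p \<in> space (M i \<Otimes>\<^sub>M M j). fst p = snd p}"
  have sp: "space (M k) = UNIV" for k using sets_eq_imp_space_eq[OF s[of k]] by simp
  have D: "D \<in> sets (M i \<Otimes>\<^sub>M M j)"
  proof -
    have "fst \<in> M i \<Otimes>\<^sub>M M j \<rightarrow>\<^sub>M (borel :: real measure)" "snd \<in> M i \<Otimes>\<^sub>M M j \<rightarrow>\<^sub>M (borel :: real measure)"
      using measurable_fst[of "M i" "M j"] measurable_snd[of "M i" "M j"] measurable_cong_sets[OF refl s] by auto
    then show ?thesis unfolding D_def by (rule borel_measurable_eq)
  qed
  have "emeasure (M i \<Otimes>\<^sub>M M j) D = (\<integral>\<^sup>+x. emeasure (M j) (Pair x -` D) \<partial>M i)"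
    by (rule M.emeasure_pair_measure_alt[OF D])
  also have "\<dots> = (\<integral>\<^sup>+x. 0 \<partial>M i)"
  proof (rule nn_integral_cong)
    fix x
    have "Pair x -` D = {x}" by (auto simp: D_def space_pair_measure sp)
    then show "emeasure (M j) (Pair x -` D) = 0" by (simp add: atomless)
  qed
  finally have "emeasure (distr (PiM UNIV M) (M i \<Otimes>\<^sub>M M j) (\<lambda>w. (w i, w j))) D = 0" using eq by simp
  then have "emeasure (PiM UNIV M) ((\<lambda>w. (w i, w j)) -` D \<inter> space (PiM UNIV M)) = 0"
    by (simp add: emeasure_distr[OF mp D])
  moreover have "(\<lambda>w. (w i, w j)) -` D \<inter> space (PiM UNIV M) \<in> sets (PiM UNIV M)"
    by (rule measurable_sets[OF mp D])
  ultimately show ?thesis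
    by (intro AE_I'[of "(\<lambda>w. (w i, w j)) -` D \<inter> space (PiM UNIV M)"])
       (auto simp: D_def space_pair_measure sp)
qed

section \<open>Construction of a Poisson process\<close>

text \<open>On each \<open>B j\<close> the product has the value \<open>s j\<close>, and it is 1 elsewhere.  For \<open>M\<close> the law of a uniform
point, this is the mean of the factor that one point contributes to the generating function.\<close>

lemma (in prob_space) nn_integral_step_function:
  assumes J: "finite J" and B: "\<And>j. j \<in> J \<Longrightarrow> B j \<in> events" and disj: "disjoint_family_on B J"
    and s: "\<And>j. j \<in> J \<Longrightarrow> 0 \<le> s j"
  shows "(\<integral>\<^sup>+x. (\<Prod>j\<in>J. if x \<in> B j then ennreal (s j) else 1) \<partial>M)
       = ennreal (1 + (\<Sum>j\<in>J. prob (B j) * (s j - 1)))"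
proof -
  let ?U = "\<Union>j\<in>J. B j"
  have U: "?U \<in> events" using J B by auto
  have eq: "(\<Prod>j\<in>J. if x \<in> B j then ennreal (s j) else 1)
      = (\<Sum>j\<in>J. ennreal (s j) * indicator (B j) x) + indicator (space M - ?U) x" if x: "x \<in> space M" for x
  proof (cases "\<exists>i\<in>J. x \<in> B i")
    case True
    then obtain i where i: "i \<in> J" "x \<in> B i" by blast
    have only: "x \<in> B j \<longleftrightarrow> j = i" if "j \<in> J" for j
      using disj i that unfolding disjoint_family_on_def by blast
    have "(\<Prod>j\<in>J. if x \<in> B j then ennreal (s j) else 1) = (\<Prod>j\<in>J. if j = i then ennreal (s j) else 1)"
      by (intro prod.cong) (auto simp: only)
    moreover have "(\<Sum>j\<in>J. ennreal (s j) * indicator (B j) x) = (\<Sum>j\<in>J. if j = i then ennreal (s j) else 0)"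
      by (intro sum.cong) (auto simp: only indicator_def)
    ultimately show ?thesis using J i by (simp add: indicator_def) blast
  next
    case False
    then have "(\<Prod>j\<in>J. if x \<in> B j then ennreal (s j) else 1) = 1"
      "(\<Sum>j\<in>J. ennreal (s j) * indicator (B j) x) = 0"
      by (auto intro!: prod.neutral sum.neutral)
    then show ?thesis using False x by (simp add: indicator_def)
  qed
  have "(\<integral>\<^sup>+x. (\<Prod>j\<in>J. if x \<in> B j then ennreal (s j) else 1) \<partial>M)
      = (\<integral>\<^sup>+x. (\<Sum>j\<in>J. ennreal (s j) * indicator (B j) x) + indicator (space M - ?U) x \<partial>M)"
    by (rule nn_integral_cong) (rule eq)
  also have "\<dots> = (\<integral>\<^sup>+x. (\<Sum>j\<in>J. ennreal (s j) * indicator (B j) x) \<partial>M) + (\<integral>\<^sup>+x. indicator (space M - ?U) x \<partial>M)"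
    using B U by (intro nn_integral_add) auto
  also have "(\<integral>\<^sup>+x. (\<Sum>j\<in>J. ennreal (s j) * indicator (B j) x) \<partial>M) = (\<Sum>j\<in>J. ennreal (s j * prob (B j)))"
    using B s by (subst nn_integral_sum) (auto simp: nn_integral_cmult emeasure_eq_measure ennreal_mult)
  also have "\<dots> = ennreal (\<Sum>j\<in>J. s j * prob (B j))"
    using s by (intro sum_ennreal) auto
  also have "(\<integral>\<^sup>+x. indicator (space M - ?U) x \<partial>M) = ennreal (1 - (\<Sum>j\<in>J. prob (B j)))"
  proof -
    have "prob ?U = (\<Sum>j\<in>J. prob (B j))"
      using J B disj by (intro finite_measure_finite_Union) auto
    then show ?thesis using U by (simp add: emeasure_eq_measure prob_compl)
  qed
  also have "ennreal (\<Sum>j\<in>J. s j * prob (B j)) + ennreal (1 - (\<Sum>j\<in>J. prob (B j)))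
      = ennreal ((\<Sum>j\<in>J. s j * prob (B j)) + (1 - (\<Sum>j\<in>J. prob (B j))))"
  proof (rule ennreal_plus[symmetric])
    show "0 \<le> (\<Sum>j\<in>J. s j * prob (B j))" using s by (intro sum_nonneg) auto
    have "(\<Sum>j\<in>J. prob (B j)) = prob ?U"
      using J B disj by (intro finite_measure_finite_Union[symmetric]) auto
    then show "0 \<le> 1 - (\<Sum>j\<in>J. prob (B j))" by simp
  qed
  also have "(\<Sum>j\<in>J. s j * prob (B j)) + (1 - (\<Sum>j\<in>J. prob (B j))) = 1 + (\<Sum>j\<in>J. prob (B j) * (s j - 1))"
    by (simp add: right_diff_distrib left_diff_distrib sum_subtractf mult.commute)
  finally show ?thesis .
qed

text \<open>Dominated convergence for indicator functions.\<close>

lemma (in prob_space) prob_tendsto_of_eventually_eq: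
  assumes E: "\<And>m. E m \<in> events" and F: "F \<in> events"
    and ev: "AE w in M. \<forall>\<^sub>F m in sequentially. w \<in> E m \<longleftrightarrow> w \<in> F"
  shows "(\<lambda>m. prob (E m)) \<longlonglongrightarrow> prob F"
proof -
  have "(\<lambda>m. \<integral>w. indicator (E m) w \<partial>M) \<longlonglongrightarrow> (\<integral>w. (indicator F w :: real) \<partial>M)"
  proof (rule integral_dominated_convergence[where w = "\<lambda>_. 1"])
    show "AE w in M. (\<lambda>m. indicator (E m) w :: real) \<longlonglongrightarrow> indicator F w"
      using ev
    proof eventually_elim
      case (elim w)
      then show ?case
        by (intro tendsto_eventually) (auto elim!: eventually_mono simp: indicator_def)
    qed
  qed (use E F in \<open>auto simp: indicator_def\<close>)
  then show ?thesis using E F sets.sets_into_space by (simp add: Int_absorb2)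
qed

lemma eventually_eq_nat_iff_limit_eq:
  assumes "(\<lambda>m. of_nat (f m) :: ennreal) \<longlonglongrightarrow> L"
  shows "\<forall>\<^sub>F m in sequentially. f m = k \<longleftrightarrow> L = of_nat k"
proof (cases "L = of_nat k")
  case False
  from tendsto_imp_eventually_ne[OF assms this] show ?thesis
    by eventually_elim (use False in auto)
next
  case True
  have "L < of_nat (Suc k)" unfolding True by (simp only: of_nat_less_iff)
  then have 1: "\<forall>\<^sub>F m in sequentially. of_nat (f m) < (of_nat (Suc k) :: ennreal)"
    by (rule order_tendstoD(2)[OF assms])
  have 2: "\<forall>\<^sub>F m in sequentially. k \<le> f m"
  proof (cases k)
    case (Suc k')
    then have "of_nat k' < L" using True by simp
    then have "\<forall>\<^sub>F m in sequentially. (of_nat k' :: ennreal) < of_nat (f m)"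
      by (rule order_tendstoD(1)[OF assms])
    then show ?thesis by eventually_elim (use Suc in simp)
  qed simp
  from 1 2 show ?thesis by eventually_elim (use True in \<open>simp only: of_nat_less_iff, simp\<close>)
qed

text \<open>The unit cells are enumerated by the natural numbers through \<open>int_decode\<close>, so that series over
all cells are ordinary series.\<close>

definition unit_cell :: "nat \<Rightarrow> real set" where
  "unit_cell n = {real_of_int (int_decode n) ..< real_of_int (int_decode n) + 1}"

definition uniform01 :: "real measure" where
  "uniform01 = uniform_measure lborel {0..<1}"

text \<open>The sample space of one cell: a Poisson number \<open>k\<close> of points and an infinite sequence of uniform
positions, of which the first \<open>k\<close> will be used.\<close>

definition poisson_cell :: "real \<Rightarrow> (nat \<times> (nat \<Rightarrow> real)) measure" where
  "poisson_cell l = measure_pmf (poisson_pmf l) \<Otimes>\<^sub>M PiM UNIV (\<lambda>_. uniform01)"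

definition poisson_sample :: "real \<Rightarrow> (nat \<Rightarrow> nat \<times> (nat \<Rightarrow> real)) measure" where
  "poisson_sample l = PiM UNIV (\<lambda>_. poisson_cell l)"

text \<open>The \<open>i\<close>-th candidate point in the \<open>n\<close>-th cell, indexed by the pair \<open>p = (n, i)\<close>.\<close>

definition point :: "(nat \<Rightarrow> nat \<times> (nat \<Rightarrow> real)) \<Rightarrow> nat \<times> nat \<Rightarrow> real" where
  "point w p = real_of_int (int_decode (fst p)) + snd (w (fst p)) (snd p)"

text \<open>An almost sure property under which distinct indices give distinct points, so that the
cardinality of a set of points is the number of their indices.\<close>

definition proper_cell :: "nat \<times> (nat \<Rightarrow> real) \<Rightarrow> bool" where
  "proper_cell x \<longleftrightarrow> (\<forall>i. snd x i \<in> {0..<1}) \<and> (\<forall>i j. i \<noteq> j \<longrightarrow> snd x i \<noteq> snd x j)"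

definition proper :: "(nat \<Rightarrow> nat \<times> (nat \<Rightarrow> real)) \<Rightarrow> bool" where
  "proper w \<longleftrightarrow> (\<forall>n. proper_cell (w n))"

definition indices :: "nat \<Rightarrow> (nat \<Rightarrow> nat \<times> (nat \<Rightarrow> real)) \<Rightarrow> (nat \<times> nat) set" where
  "indices m w = (SIGMA n:{..<m}. {..<fst (w n)})"

text \<open>On the null set of improper outcomes the configuration is empty, which makes it locally
finite for all outcomes.\<close>

definition poisson_points :: "(nat \<Rightarrow> nat \<times> (nat \<Rightarrow> real)) \<Rightarrow> real set" where
  "poisson_points w = (if proper w then (\<Union>m. point w ` indices m w) else {})"

definition partial_count :: "real set \<Rightarrow> nat \<Rightarrow> (nat \<Rightarrow> nat \<times> (nat \<Rightarrow> real)) \<Rightarrow> nat" where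
  "partial_count B m w = (\<Sum>n<m. \<Sum>i<fst (w n). of_bool (point w (n, i) \<in> B))"

lemma prob_space_uniform01: "prob_space uniform01"
  unfolding uniform01_def by (rule prob_space_uniform_measure) auto

lemma sets_uniform01 [measurable_cong, simp]: "sets uniform01 = sets borel"
  by (simp add: uniform01_def)

lemma prob_space_poisson_cell: "prob_space (poisson_cell l)"
proof -
  interpret U: prob_space uniform01 by (rule prob_space_uniform01)
  interpret UP: product_prob_space "\<lambda>_::nat. uniform01" UNIV by unfold_locales
  interpret PP: pair_prob_space "measure_pmf (poisson_pmf l)" "PiM UNIV (\<lambda>_::nat. uniform01)"
    by unfold_locales
  show ?thesis unfolding poisson_cell_def by unfold_locales
qed

lemma prob_space_poisson_sample: "prob_space (poisson_sample l)"
  unfolding poisson_sample_def by (intro prob_space_PiM prob_space_poisson_cell)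

lemma measurable_cell_fst [measurable]: "fst \<in> poisson_cell l \<rightarrow>\<^sub>M count_space UNIV"
  unfolding poisson_cell_def using measurable_fst[of "measure_pmf (poisson_pmf l)" "PiM UNIV (\<lambda>_::nat. uniform01)"]
  by (simp cong: measurable_cong_sets)

lemma measurable_cell_snd [measurable]: "(\<lambda>x. snd x i) \<in> poisson_cell l \<rightarrow>\<^sub>M borel"
proof -
  have "(\<lambda>x. snd x i) \<in> poisson_cell l \<rightarrow>\<^sub>M uniform01" unfolding poisson_cell_def by measurable
  then show ?thesis by (simp cong: measurable_cong_sets)
qed

lemma measurable_sample_fst [measurable]: "(\<lambda>w. fst (w n)) \<in> poisson_sample l \<rightarrow>\<^sub>M count_space UNIV"
  unfolding poisson_sample_def by measurable

lemma measurable_sample_snd [measurable]: "(\<lambda>w. snd (w n) i) \<in> poisson_sample l \<rightarrow>\<^sub>M borel"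
  unfolding poisson_sample_def 
  by (rule measurable_compose[OF measurable_component_singleton[of n] measurable_cell_snd]) simp

lemma measurable_point [measurable]: "(\<lambda>w. point w p) \<in> poisson_sample l \<rightarrow>\<^sub>M borel"
  unfolding point_def by measurable

lemma measurable_partial_count:
  assumes B: "B \<in> sets borel"
  shows "partial_count B m \<in> poisson_sample l \<rightarrow>\<^sub>M count_space UNIV"
proof -
  have "(\<lambda>w. \<Sum>i<k. of_bool (point w (n, i) \<in> B) :: nat) \<in> poisson_sample l \<rightarrow>\<^sub>M count_space UNIV" for n k
    using B by measurable
  then have "(\<lambda>w. \<Sum>i<fst (w n). of_bool (point w (n, i) \<in> B) :: nat) \<in> poisson_sample l \<rightarrow>\<^sub>M count_space UNIV" for n
    by (rule measurable_compose_countable[OF _ measurable_sample_fst])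
  then show ?thesis unfolding partial_count_def[abs_def] by measurable
qed

lemma sets_proper_cell: "{x \<in> space (poisson_cell l). proper_cell x} \<in> sets (poisson_cell l)"
proof -
  have 1: "{x \<in> space (poisson_cell l). snd x i \<in> {0..<1}} \<in> sets (poisson_cell l)" for i
  proof -
    have "(\<lambda>x. snd x i) -` {0..<1} \<inter> space (poisson_cell l) \<in> sets (poisson_cell l)"
      by (rule measurable_sets[OF measurable_cell_snd]) simp
    then show ?thesis by (simp add: vimage_def Int_def conj_commute)
  qed
  have 2: "{x \<in> space (poisson_cell l). i \<noteq> j \<longrightarrow> snd x i \<noteq> snd x j} \<in> sets (poisson_cell l)" for i j
    using borel_measurable_neq[OF measurable_cell_snd measurable_cell_snd, of l i j]
    by (cases "i = j") simp_all
  show ?thesis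
    unfolding proper_cell_def
    by (intro sets.sets_Collect_conj sets.sets_Collect_countable_All 1 2)
qed

lemma sets_proper: "{w \<in> space (poisson_sample l). proper w} \<in> sets (poisson_sample l)"
  unfolding proper_def
proof (rule sets.sets_Collect_countable_All)
  fix n
  have m: "(\<lambda>w. w n) \<in> poisson_sample l \<rightarrow>\<^sub>M poisson_cell l"
    unfolding poisson_sample_def by (rule measurable_component_singleton) simp
  have "{w \<in> space (poisson_sample l). proper_cell (w n)}
      = (\<lambda>w. w n) -` {x \<in> space (poisson_cell l). proper_cell x} \<inter> space (poisson_sample l)"
    using measurable_space[OF m] by auto
  also have "\<dots> \<in> sets (poisson_sample l)" by (rule measurable_sets[OF m sets_proper_cell])
  finally show "{w \<in> space (poisson_sample l). proper_cell (w n)} \<in> sets (poisson_sample l)" .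
qed

lemma AE_proper: "AE w in poisson_sample l. proper w"
proof -
  interpret U: prob_space uniform01 by (rule prob_space_uniform01)
  interpret UP: product_prob_space "\<lambda>_::nat. uniform01" UNIV by unfold_locales
  interpret PP: pair_prob_space "measure_pmf (poisson_pmf l)" "PiM UNIV (\<lambda>_::nat. uniform01)"
    by unfold_locales
  have atomless: "emeasure uniform01 {x} = 0" for x
    by (simp add: uniform01_def emeasure_lborel_countable)
  have 1: "AE u in PiM UNIV (\<lambda>_::nat. uniform01). u i \<in> {0..<1}" for i
  proof (rule AE_PiM_component)
    show "AE x in uniform01. x \<in> {0..<1}"
      unfolding uniform01_def by (rule AE_uniform_measureI) auto
  qed (auto intro: prob_space_uniform01)
  have 2: "AE u in PiM UNIV (\<lambda>_::nat. uniform01). i \<noteq> j \<longrightarrow> u i \<noteq> u j" for i j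
    using AE_PiM_coordinates_distinct[of "\<lambda>_. uniform01" i j] prob_space_uniform01 atomless
    by (cases "i = j") auto
  have "AE u in PiM UNIV (\<lambda>_::nat. uniform01). (\<forall>i. u i \<in> {0..<1}) \<and> (\<forall>i j. i \<noteq> j \<longrightarrow> u i \<noteq> u j)"
    unfolding AE_conj_iff AE_all_countable using 1 2 by blast
  then have 3: "AE u in PiM UNIV (\<lambda>_::nat. uniform01). proper_cell (k, u)" for k
    unfolding proper_cell_def snd_conv .
  have "AE x in poisson_cell l. proper_cell x"
    unfolding poisson_cell_def
    by (rule PP.AE_pair_measure[OF sets_proper_cell[unfolded poisson_cell_def]]) (rule AE_I2[OF 3])
  then have "AE w in poisson_sample l. proper_cell (w n)" for n
    unfolding poisson_sample_def by (intro AE_PiM_component) (auto intro: prob_space_poisson_cell)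
  then show ?thesis by (simp add: proper_def AE_all_countable)
qed

lemma finite_indices [simp]: "finite (indices m w)"
  by (simp add: indices_def)

lemma partial_count_eq_card: "partial_count B m w = card {p \<in> indices m w. point w p \<in> B}"
proof -
  have "partial_count B m w = (\<Sum>p\<in>indices m w. of_bool (point w p \<in> B))"
    unfolding partial_count_def indices_def by (subst sum.Sigma) auto
  also have "\<dots> = card {p \<in> indices m w. point w p \<in> B}"
    by (simp add: of_bool_def sum.If_cases Int_def)
  finally show ?thesis .
qed

lemma floor_point: "proper w \<Longrightarrow> \<lfloor>point w p\<rfloor> = int_decode (fst p)"
  by (simp add: proper_def proper_cell_def point_def floor_eq_iff)

lemma inj_point:
  assumes "proper w"
  shows "inj (point w)"
proof (rule injI)
  fix p q assume eq: "point w p = point w q"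
  then have "int_decode (fst p) = int_decode (fst q)" using floor_point[OF assms] by metis
  then have f: "fst p = fst q" by (simp add: int_decode_eq)
  with eq have "snd (w (fst p)) (snd p) = snd (w (fst p)) (snd q)" by (simp add: point_def)
  then have "snd p = snd q" using assms unfolding proper_def proper_cell_def by blast
  with f show "p = q" by (simp add: prod_eq_iff)
qed

text \<open>The counts in the first \<open>m\<close> cells increase to the count in all cells, also when the latter is
infinite.\<close>

lemma partial_count_tendsto:
  assumes w: "proper w"
  shows "(\<lambda>m. of_nat (partial_count B m w) :: ennreal) \<longlonglongrightarrow> num_points B (poisson_points w)"
proof -
  let ?A = "\<lambda>m. point w ` {p \<in> indices m w. point w p \<in> B}"
  have "(\<lambda>m. emeasure (count_space UNIV) (?A m)) \<longlonglongrightarrow> emeasure (count_space UNIV) (\<Union>m. ?A m)"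
    by (rule Lim_emeasure_incseq) (auto simp: incseq_def indices_def)
  moreover have "(\<Union>m. ?A m) = poisson_points w \<inter> B" using w by (auto simp: poisson_points_def)
  moreover have "emeasure (count_space UNIV) (?A m) = of_nat (partial_count B m w)" for m
    using inj_point[OF w] by (simp add: partial_count_eq_card card_image inj_on_subset)
  ultimately show ?thesis by (simp add: num_points_def)
qed

text \<open>A bounded set meets finitely many unit cells, each with finitely many points.\<close>

lemma locally_finite_poisson_points: "locally_finite (poisson_points w)"
proof (cases "proper w")
  case True
  show ?thesis
    unfolding locally_finite_def
  proof (intro allI impI)
    fix B :: "real set" assume "bounded B"
    then obtain c where c: "\<And>x. x \<in> B \<Longrightarrow> \<bar>x\<bar> \<le> c" by (auto simp: bounded_iff)
    have "finite (int_encode ` {\<lfloor>- c\<rfloor> .. \<lfloor>c\<rfloor>})" by simp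
    then obtain m where m: "\<And>n. n \<in> int_encode ` {\<lfloor>- c\<rfloor> .. \<lfloor>c\<rfloor>} \<Longrightarrow> n < m"
      using finite_nat_set_iff_bounded by auto
    have "poisson_points w \<inter> B \<subseteq> point w ` indices m w"
    proof
      fix x assume x: "x \<in> poisson_points w \<inter> B"
      then obtain m' p where p: "p \<in> indices m' w" "x = point w p"
        using True by (auto simp: poisson_points_def)
      have "- c \<le> x" "x \<le> c" using c[of x] x by auto
      then have "int_decode (fst p) \<in> {\<lfloor>- c\<rfloor> .. \<lfloor>c\<rfloor>}"
        using floor_point[OF True, of p] p(2) floor_mono[of "- c" x] floor_mono[of x c] by simp
      then have "int_encode (int_decode (fst p)) \<in> int_encode ` {\<lfloor>- c\<rfloor> .. \<lfloor>c\<rfloor>}" by (rule imageI)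
      then have "fst p < m" using m by simp
      then have "p \<in> indices m w" using p(1) by (auto simp: indices_def)
      then show "x \<in> point w ` indices m w" using p(2) by blast
    qed
    then show "finite (poisson_points w \<inter> B)" by (rule finite_subset) simp
  qed
qed (simp add: poisson_points_def locally_finite_def)

lemma measurable_poisson_points: "poisson_points \<in> poisson_sample l \<rightarrow>\<^sub>M configs"
proof (rule measurable_configsI)
  fix B :: "real set" assume B: "B \<in> sets borel"
  have "(\<lambda>w. if proper w then of_nat (partial_count B m w) else 0 :: ennreal) \<in> borel_measurable (poisson_sample l)" for m
  proof (rule measurable_If)
    show "(\<lambda>w. of_nat (partial_count B m w) :: ennreal) \<in> borel_measurable (poisson_sample l)"
      by (rule measurable_compose[OF measurable_partial_count[OF B]]) simp
  qed (auto intro: sets_proper)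
  then show "(\<lambda>w. num_points B (poisson_points w)) \<in> borel_measurable (poisson_sample l)"
  proof (rule borel_measurable_LIMSEQ_order[rotated])
    fix w
    show "(\<lambda>m. if proper w then of_nat (partial_count B m w) else 0 :: ennreal) \<longlonglongrightarrow> num_points B (poisson_points w)"
      using partial_count_tendsto[of w B] by (cases "proper w") (auto simp: poisson_points_def num_points_def)
  qed
qed (rule locally_finite_poisson_points)

text \<open>Given that the cell has \<open>k\<close> points, the mean of the product is \<open>v ^ k\<close> by independence of the
positions; averaging over the Poisson law of \<open>k\<close> yields the exponential.\<close>

lemma poisson_cell_gf:
  assumes l: "0 < l" and phi: "\<phi> \<in> borel_measurable borel"
    and v: "(\<integral>\<^sup>+u. \<phi> (a + u) \<partial>uniform01) = ennreal v" "0 \<le> v"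
  shows "(\<integral>\<^sup>+x. (\<Prod>i<fst x. \<phi> (a + snd x i)) \<partial>poisson_cell l) = ennreal (exp (l * (v - 1)))"
proof -
  interpret U: prob_space uniform01 by (rule prob_space_uniform01)
  interpret UP: product_prob_space "\<lambda>_::nat. uniform01" UNIV by unfold_locales
  let ?U = "PiM UNIV (\<lambda>_::nat. uniform01)"
  have m1: "(\<lambda>x. \<Prod>i<k. \<phi> (a + snd x i)) \<in> borel_measurable (poisson_cell l)" for k
    using phi by measurable
  have m: "(\<lambda>x. \<Prod>i<fst x. \<phi> (a + snd x i)) \<in> borel_measurable (poisson_cell l)"
    by (rule measurable_compose_countable[OF m1 measurable_cell_fst])
  have "(\<integral>\<^sup>+x. (\<Prod>i<fst x. \<phi> (a + snd x i)) \<partial>poisson_cell l)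
      = (\<integral>\<^sup>+k. (\<integral>\<^sup>+u. (\<Prod>i<k. \<phi> (a + u i)) \<partial>?U) \<partial>measure_pmf (poisson_pmf l))"
    using UP.P.nn_integral_fst[OF m[unfolded poisson_cell_def]] by (simp add: poisson_cell_def)
  also have "\<dots> = (\<integral>\<^sup>+k. ennreal v ^ k \<partial>measure_pmf (poisson_pmf l))"
  proof (rule nn_integral_cong)
    fix k
    have "(\<integral>\<^sup>+u. (\<Prod>i<k. \<phi> (a + u i)) \<partial>?U) = (\<Prod>i<k. \<integral>\<^sup>+u. \<phi> (a + u) \<partial>uniform01)"
      by (rule nn_integral_PiM_prod_coordinates[where f = "\<lambda>_ u. \<phi> (a + u)"])
         (use phi prob_space_uniform01 in \<open>auto intro!: measurable_compose[OF _ phi]\<close>)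
    then show "(\<integral>\<^sup>+u. (\<Prod>i<k. \<phi> (a + u i)) \<partial>?U) = ennreal v ^ k" by (simp add: v)
  qed
  also have "\<dots> = (\<Sum>k. ennreal (pmf (poisson_pmf l) k) * ennreal v ^ k)"
    by (simp only: nn_integral_measure_pmf nn_integral_count_space_nat)
  also have "\<dots> = (\<Sum>k. ennreal (poisson_weight l k * v ^ k))"
    using l v(2) by (intro suminf_cong) (simp add: poisson_weight_def ennreal_power flip: ennreal_mult)
  also have "\<dots> = ennreal (exp (l * (v - 1)))"
    using poisson_weight_gf_sums[of l v] l v(2)
    by (subst suminf_ennreal2) (auto simp: sums_iff poisson_weight_nonneg)
  finally show ?thesis .
qed

text \<open>A uniform point of the cell hits \<open>B\<close> with a probability equal to the length of \<open>B\<close> inside the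
cell.\<close>

lemma measure_uniform01_shift:
  assumes B: "B \<in> sets borel"
  shows "measure (distr uniform01 borel ((+) (real_of_int (int_decode n)))) B = measure lborel (B \<inter> unit_cell n)"
proof -
  let ?a = "real_of_int (int_decode n)"
  have pre: "(+) ?a -` A \<in> sets borel" if "A \<in> sets borel" for A :: "real set"
    using measurable_sets_borel[of "(+) ?a" borel A] that by simp
  have "emeasure (distr uniform01 borel ((+) ?a)) B = emeasure uniform01 ((+) ?a -` B)"
    using B by (subst emeasure_distr) (auto simp: uniform01_def)
  also have "\<dots> = emeasure lborel ({0..<1} \<inter> (+) ?a -` B)"
    using pre[OF B] by (simp add: uniform01_def divide_ennreal_def)
  also have "{0..<1} \<inter> (+) ?a -` B = (+) ?a -` (B \<inter> unit_cell n)"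
    by (auto simp: unit_cell_def)
  also have "emeasure lborel ((+) ?a -` (B \<inter> unit_cell n)) = emeasure (distr lborel borel ((+) ?a)) (B \<inter> unit_cell n)"
    using B by (subst emeasure_distr) (auto simp: unit_cell_def)
  also have "\<dots> = emeasure lborel (B \<inter> unit_cell n)" by (simp add: lborel_distr_plus)
  finally show ?thesis by (simp add: measure_def)
qed

text \<open>The counts in disjoint sets are obtained from one function \<open>\<phi>\<close> on the line, equal to \<open>s j\<close> on \<open>B j\<close>:
the product of \<open>s j ^ N j\<close> over \<open>j\<close> is the product of \<open>\<phi>\<close> over all points, so its mean factorises over
the cells into exponentials whose exponents are linear in each \<open>s j - 1\<close>.\<close>

lemma poisson_sample_prob_partial_counts:
  assumes l: "0 < l" and J: "finite J" and B: "\<And>j. j \<in> J \<Longrightarrow> B j \<in> sets borel" and disj: "disjoint_family_on B J"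
  shows "measure (poisson_sample l) {w \<in> space (poisson_sample l). \<forall>j\<in>J. partial_count (B j) m w = k j}
       = (\<Prod>j\<in>J. poisson_weight (l * (\<Sum>n<m. measure lborel (B j \<inter> unit_cell n))) (k j))"
proof -
  interpret P: prob_space "poisson_sample l" by (rule prob_space_poisson_sample)
  interpret U: prob_space uniform01 by (rule prob_space_uniform01)
  define q where "q n j = measure lborel (B j \<inter> unit_cell n)" for n j
  show ?thesis
  proof (rule P.independent_poisson_from_gf[OF J])
    fix s :: "_ \<Rightarrow> real" assume s: "\<And>j. j \<in> J \<Longrightarrow> 0 \<le> s j \<and> s j \<le> 1"
    define \<phi> where "\<phi> x = (\<Prod>j\<in>J. if x \<in> B j then ennreal (s j) else 1)" for x
    have phi: "\<phi> \<in> borel_measurable borel"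
      unfolding \<phi>_def[abs_def] using B by (intro borel_measurable_prod_ennreal measurable_If) auto
    define v where "v n = 1 + (\<Sum>j\<in>J. q n j * (s j - 1))" for n
    have v: "(\<integral>\<^sup>+u. \<phi> (real_of_int (int_decode n) + u) \<partial>uniform01) = ennreal (v n) \<and> 0 \<le> v n" for n
    proof
      let ?Q = "distr uniform01 borel ((+) (real_of_int (int_decode n)))"
      interpret Q: prob_space ?Q by (rule U.prob_space_distr) simp
      have "(\<integral>\<^sup>+u. \<phi> (real_of_int (int_decode n) + u) \<partial>uniform01) = (\<integral>\<^sup>+x. \<phi> x \<partial>?Q)"
        using phi by (subst nn_integral_distr) auto
      also have "\<dots> = ennreal (1 + (\<Sum>j\<in>J. measure ?Q (B j) * (s j - 1)))"
        unfolding \<phi>_def by (rule Q.nn_integral_step_function[OF J _ disj]) (use B s in auto)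
      also have "(\<Sum>j\<in>J. measure ?Q (B j) * (s j - 1)) = (\<Sum>j\<in>J. q n j * (s j - 1))"
        using B by (intro sum.cong) (simp_all add: measure_uniform01_shift q_def)
      finally show "(\<integral>\<^sup>+u. \<phi> (real_of_int (int_decode n) + u) \<partial>uniform01) = ennreal (v n)" by (simp add: v_def)
      have "(\<Sum>j\<in>J. q n j) = (\<Sum>j\<in>J. measure ?Q (B j))"
        using B by (intro sum.cong) (simp_all add: measure_uniform01_shift q_def)
      also have "\<dots> = measure ?Q (\<Union>j\<in>J. B j)"
        using J B disj by (intro Q.finite_measure_finite_Union[symmetric]) auto
      also have "\<dots> \<le> 1" by simp
      finally have "(\<Sum>j\<in>J. q n j) \<le> 1" .
      moreover have "(\<Sum>j\<in>J. q n j * (1 - s j)) \<le> (\<Sum>j\<in>J. q n j)"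
        using s by (intro sum_mono) (auto simp: q_def mult_left_le)
      moreover have "(\<Sum>j\<in>J. q n j * (s j - 1)) = - (\<Sum>j\<in>J. q n j * (1 - s j))"
        by (simp add: sum_negf[symmetric] algebra_simps)
      ultimately show "0 \<le> v n" by (simp add: v_def)
    qed
    have prod_eq: "(\<Prod>j\<in>J. ennreal (s j) ^ partial_count (B j) m w)
        = (\<Prod>n<m. \<Prod>i<fst (w n). \<phi> (real_of_int (int_decode n) + snd (w n) i))" for w
    proof -
      have "(\<Prod>j\<in>J. ennreal (s j) ^ partial_count (B j) m w)
          = (\<Prod>j\<in>J. \<Prod>n<m. \<Prod>i<fst (w n). if point w (n, i) \<in> B j then ennreal (s j) else 1)"
        unfolding partial_count_def power_sum by (intro prod.cong) auto
      also have "\<dots> = (\<Prod>n<m. \<Prod>j\<in>J. \<Prod>i<fst (w n). if point w (n, i) \<in> B j then ennreal (s j) else 1)"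
        by (rule prod.swap)
      also have "\<dots> = (\<Prod>n<m. \<Prod>i<fst (w n). \<Prod>j\<in>J. if point w (n, i) \<in> B j then ennreal (s j) else 1)"
        by (intro prod.cong refl prod.swap)
      finally show ?thesis by (simp add: \<phi>_def point_def)
    qed
    have "(\<integral>\<^sup>+w. (\<Prod>j\<in>J. ennreal (s j) ^ partial_count (B j) m w) \<partial>poisson_sample l)
        = (\<Prod>n<m. \<integral>\<^sup>+x. (\<Prod>i<fst x. \<phi> (real_of_int (int_decode n) + snd x i)) \<partial>poisson_cell l)"
      unfolding prod_eq poisson_sample_def
    proof (rule nn_integral_PiM_prod_coordinates[where f = "\<lambda>n x. \<Prod>i<fst x. \<phi> (real_of_int (int_decode n) + snd x i)"])
      fix n
      have "(\<lambda>x. \<Prod>i<k. \<phi> (real_of_int (int_decode n) + snd x i)) \<in> borel_measurable (poisson_cell l)" for k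
        using phi by measurable
      then show "(\<lambda>x. \<Prod>i<fst x. \<phi> (real_of_int (int_decode n) + snd x i)) \<in> borel_measurable (poisson_cell l)"
        by (rule measurable_compose_countable[OF _ measurable_cell_fst])
    qed (auto intro: prob_space_poisson_cell)
    also have "\<dots> = (\<Prod>n<m. ennreal (exp (l * (v n - 1))))"
      by (intro prod.cong refl poisson_cell_gf[OF l phi]) (use v in auto)
    also have "\<dots> = ennreal (exp (\<Sum>n<m. l * (v n - 1)))"
      by (simp add: prod_ennreal exp_sum)
    also have "(\<Sum>n<m. l * (v n - 1)) = (\<Sum>n<m. \<Sum>j\<in>J. l * q n j * (s j - 1))"
      by (simp add: v_def sum_distrib_left mult.assoc)
    also have "\<dots> = (\<Sum>j\<in>J. \<Sum>n<m. l * q n j * (s j - 1))" by (rule sum.swap)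
    also have "\<dots> = (\<Sum>j\<in>J. l * (\<Sum>n<m. q n j) * (s j - 1))"
      by (simp add: sum_distrib_left sum_distrib_right)
    also have "exp \<dots> = (\<Prod>j\<in>J. exp (l * (\<Sum>n<m. q n j) * (s j - 1)))" by (rule exp_sum[OF J])
    finally show "(\<integral>\<^sup>+w. (\<Prod>j\<in>J. ennreal (s j) ^ partial_count (B j) m w) \<partial>poisson_sample l)
        = ennreal (\<Prod>j\<in>J. exp (l * (\<Sum>n<m. measure lborel (B j \<inter> unit_cell n)) * (s j - 1)))"
      by (simp add: q_def)
  qed (use l B in \<open>auto intro!: measurable_partial_count mult_nonneg_nonneg sum_nonneg\<close>)
qed

text \<open>Laws and independence both come from the limit of \<open>poisson_sample_prob_partial_counts\<close> as the
number of cells grows.  Sets of infinite measure are covered by the same argument, because the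
product formula is inherited by limits whatever the limits are.\<close>

lemma poisson_process_poisson_points:
  assumes l: "0 < l"
  shows "poisson_process l (poisson_sample l) poisson_points"
proof -
  interpret P: prob_space "poisson_sample l" by (rule prob_space_poisson_sample)
  let ?N = "\<lambda>B w. num_points B (poisson_points w)"
  define \<rho> where "\<rho> B m = l * (\<Sum>n<m. measure lborel (B \<inter> unit_cell n))" for B m
  have Nm: "?N B \<in> borel_measurable (poisson_sample l)" if "B \<in> sets borel" for B
    using measurable_compose[OF measurable_poisson_points measurable_num_points[OF that]] .
  have lim: "(\<lambda>m. \<Prod>j\<in>J. poisson_weight (\<rho> (B j) m) (k j)) \<longlonglongrightarrow>
      P.prob {w \<in> space (poisson_sample l). \<forall>j\<in>J. ?N (B j) w = of_nat (k j)}"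
    if J: "finite J" and B: "\<And>j. j \<in> J \<Longrightarrow> B j \<in> sets borel" and disj: "disjoint_family_on B J"
    for J :: "nat set" and B k
  proof -
    have "(\<lambda>m. P.prob {w \<in> space (poisson_sample l). \<forall>j\<in>J. partial_count (B j) m w = k j}) \<longlonglongrightarrow>
        P.prob {w \<in> space (poisson_sample l). \<forall>j\<in>J. ?N (B j) w = of_nat (k j)}"
    proof (rule P.prob_tendsto_of_eventually_eq)
      fix m
      have "partial_count (B j) m \<in> poisson_sample l \<rightarrow>\<^sub>M count_space UNIV" if "j \<in> J" for j
        by (rule measurable_partial_count[OF B[OF that]])
      then show "{w \<in> space (poisson_sample l). \<forall>j\<in>J. partial_count (B j) m w = k j} \<in> sets (poisson_sample l)"
        using J by (intro sets.sets_Collect_finite_All) measurable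
    next
      have "{w \<in> space (poisson_sample l). ?N (B j) w = of_nat (k j)} \<in> sets (poisson_sample l)" if "j \<in> J" for j
        using Nm[OF B[OF that]] by measurable
      then show "{w \<in> space (poisson_sample l). \<forall>j\<in>J. ?N (B j) w = of_nat (k j)} \<in> sets (poisson_sample l)"
        using J by (intro sets.sets_Collect_finite_All)
    next
      show "AE w in poisson_sample l. \<forall>\<^sub>F m in sequentially.
          w \<in> {w \<in> space (poisson_sample l). \<forall>j\<in>J. partial_count (B j) m w = k j} \<longleftrightarrow>
          w \<in> {w \<in> space (poisson_sample l). \<forall>j\<in>J. ?N (B j) w = of_nat (k j)}"
        using AE_proper
      proof eventually_elim
        case (elim w)
        have "\<forall>\<^sub>F m in sequentially. \<forall>j\<in>J. partial_count (B j) m w = k j \<longleftrightarrow> ?N (B j) w = of_nat (k j)"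
          by (intro eventually_ball_finite J ballI eventually_eq_nat_iff_limit_eq partial_count_tendsto elim)
        then show ?case by eventually_elim auto
      qed
    qed
    then show ?thesis by (simp only: \<rho>_def poisson_sample_prob_partial_counts[OF l J B disj])
  qed
  have lim1: "(\<lambda>m. poisson_weight (\<rho> B m) k) \<longlonglongrightarrow> P.prob {w \<in> space (poisson_sample l). ?N B w = of_nat k}"
    if "B \<in> sets borel" for B k
    using lim[of "{0}" "\<lambda>_. B" "\<lambda>_. k"] that by (simp add: disjoint_family_on_def)
  show ?thesis
    unfolding poisson_process_def
  proof (intro conjI ballI allI impI)
    show "prob_space (poisson_sample l)" by (rule prob_space_poisson_sample)
    show "poisson_points \<in> poisson_sample l \<rightarrow>\<^sub>M configs" by (rule measurable_poisson_points)
  next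
    fix B :: "real set" and k :: nat assume B: "B \<in> sets borel" "emeasure lborel B < \<infinity>"
    have U: "(\<Union>n. B \<inter> unit_cell n) = B"
    proof -
      have "x \<in> unit_cell (int_encode \<lfloor>x\<rfloor>)" for x by (simp add: unit_cell_def)
      then show ?thesis by auto
    qed
    have "(\<lambda>n. measure lborel (B \<inter> unit_cell n)) sums measure lborel (\<Union>n. B \<inter> unit_cell n)"
    proof (rule measure_UNION)
      show "range (\<lambda>n. B \<inter> unit_cell n) \<subseteq> sets lborel" using B by (auto simp: unit_cell_def)
      have "n = n'" if "x \<in> unit_cell n" "x \<in> unit_cell n'" for x n n'
      proof -
        have "\<lfloor>x\<rfloor> = int_decode n" "\<lfloor>x\<rfloor> = int_decode n'"
          using that by (simp_all add: unit_cell_def floor_eq_iff)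
        then show ?thesis by (metis int_decode_eq)
      qed
      then show "disjoint_family (\<lambda>n. B \<inter> unit_cell n)" unfolding disjoint_family_on_def by blast
      show "emeasure lborel (\<Union>n. B \<inter> unit_cell n) \<noteq> \<infinity>" unfolding U using B(2) by simp
    qed
    then have "(\<lambda>m. \<Sum>n<m. measure lborel (B \<inter> unit_cell n)) \<longlonglongrightarrow> measure lborel B"
      unfolding U sums_def .
    then have "(\<lambda>m. poisson_weight (\<rho> B m) k) \<longlonglongrightarrow> poisson_weight (l * measure lborel B) k"
      unfolding \<rho>_def poisson_weight_def by (intro tendsto_intros) auto
    with lim1[OF B(1), of k]
    have "P.prob {w \<in> space (poisson_sample l). ?N B w = of_nat k} = poisson_weight (l * measure lborel B) k"
      by (rule LIMSEQ_unique)
    then show "P.prob {w \<in> space (poisson_sample l). ?N B w = of_nat k}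
        = (l * measure lborel B) ^ k / fact k * exp (- (l * measure lborel B))"
      by (simp add: poisson_weight_def)
  next
    fix I :: "nat set" and B :: "nat \<Rightarrow> real set"
    assume I: "finite I" and B: "\<forall>i\<in>I. B i \<in> sets borel" and disj: "disjoint_family_on B I"
    show "P.indep_vars (\<lambda>_. borel) (\<lambda>i w. ?N (B i) w) I"
    proof (rule P.indep_vars_from_nat_atoms)
      show "?N (B i) \<in> borel_measurable (poisson_sample l)" if "i \<in> I" for i
        using Nm B that by blast
      show "?N (B i) w = \<top> \<or> (\<exists>k::nat. ?N (B i) w = of_nat k)" for i w
        by (auto simp: num_points_def emeasure_count_space)
      fix J k assume J: "J \<subseteq> I" "finite J"
      have d: "disjoint_family_on B J" using disj J(1) by (rule disjoint_family_on_mono[rotated])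
      have "(\<lambda>m. \<Prod>j\<in>J. poisson_weight (\<rho> (B j) m) (k j)) \<longlonglongrightarrow>
          (\<Prod>j\<in>J. P.prob {w \<in> space (poisson_sample l). ?N (B j) w = of_nat (k j)})"
        using lim1 B J by (intro tendsto_prod) auto
      moreover have "(\<lambda>m. \<Prod>j\<in>J. poisson_weight (\<rho> (B j) m) (k j)) \<longlonglongrightarrow>
          P.prob {w \<in> space (poisson_sample l). \<forall>j\<in>J. ?N (B j) w = of_nat (k j)}"
        by (rule lim[OF J(2) _ d]) (use B J in auto)
      ultimately show "P.prob {w \<in> space (poisson_sample l). \<forall>j\<in>J. ?N (B j) w = of_nat (k j)}
          = (\<Prod>j\<in>J. P.prob {w \<in> space (poisson_sample l). ?N (B j) w = of_nat (k j)})"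
        by (rule LIMSEQ_unique[rotated])
    qed
  qed
qed

section \<open>Equivariant thickenings do not exist\<close>

lemma locally_finite_Un:
  assumes "locally_finite S" "locally_finite S'"
  shows "locally_finite (S \<union> S')"
  using assms by (simp add: locally_finite_def Int_Un_distrib2)

lemma sum_pos_iff_nat:
  fixes f :: "'a \<Rightarrow> nat"
  assumes "finite S"
  shows "0 < sum f S \<longleftrightarrow> (\<exists>i\<in>S. 0 < f i)"
  unfolding zero_less_iff_neq_zero sum_eq_0_iff[OF assms] by simp

lemma shift_Un: "shift t (S \<union> S') = shift t S \<union> shift t S'"
  by (simp add: shift_def image_Un)

text \<open>The constants are chosen in the order \<open>\<kappa>\<close>, \<open>m\<close>, \<open>\<theta>\<close>, \<open>n\<close>, \<open>N\<close>.  With \<open>d = l' - l\<close>, about \<open>d * N\<close> points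
are added, at least \<open>a = d / 2 * N\<close> with high probability; up to \<open>\<kappa> * N = d / 4 * N\<close> wrong blocks are
tolerated, half of this number, so that the exponent \<open>K - a\<close> of \<open>2 ^ m\<close> is \<open>- \<kappa> * N\<close>.\<close>

lemma no_equivariant_thickening_of_poisson_process:
  assumes l: "0 < l" and ll': "l < l'" and f: "thickening l l' f" and eqv: "equivariant f"
    and X: "poisson_process l P X"
  shows False
proof -
  define g where "g S = S \<union> f S" for S
  define Y where "Y w = g (X w)" for w
  define d where "d = l' - l"
  define \<kappa> where "\<kappa> = d / 4"
  have d: "0 < d" using ll' by (simp add: d_def)
  have l'0: "0 < l'" using l ll' by simp
  have mX: "X \<in> P \<rightarrow>\<^sub>M configs" and P: "prob_space P" using X by (simp_all add: poisson_process_def)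
  interpret P: prob_space P by fact
  have Y: "poisson_process l' P Y" unfolding Y_def g_def using thickeningD[OF f X] .
  have mY: "Y \<in> P \<rightarrow>\<^sub>M configs" using Y by (simp add: poisson_process_def)
  have mf: "f \<in> configs \<rightarrow>\<^sub>M configs" using f by (simp add: thickening_def)
  have lfg: "locally_finite (g S)" if "locally_finite S" for S
    using measurable_space[OF mf, of S] that by (simp add: g_def space_configs locally_finite_Un)
  have lfX: "locally_finite (X w)" if "w \<in> space P" for w
    using measurable_space[OF mX that] by (simp add: space_configs)
  have mg: "g \<in> configs \<rightarrow>\<^sub>M configs"
  proof -
    have "poisson_process l (distr P configs X) (\<lambda>S. S)"
      using poisson_process_distr_iff[OF P mX measurable_ident_sets[OF refl]] X by simp
    from thickeningD[OF f this] show ?thesis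
      by (simp add: poisson_process_def g_def[abs_def])
  qed
  have g_shift: "g (shift t S) = shift t (g S)" if "locally_finite S" for t S
    using eqv that by (simp add: g_def equivariant_def space_configs shift_Un)

  \<comment> \<open>blocks so short that the factor \<open>2 ^ m\<close> per added point beats all factors that are exponential in \<open>N\<close>\<close>
  obtain m :: nat where m: "2 + 4 * l'\<^sup>2 \<le> \<kappa> * (real m * ln 2)"
  proof -
    obtain m :: nat where "(2 + 4 * l'\<^sup>2) / (\<kappa> * ln 2) \<le> real m" using real_arch_simple by blast
    then have "2 + 4 * l'\<^sup>2 \<le> real m * (\<kappa> * ln 2)" using d by (simp add: \<kappa>_def pos_divide_le_eq)
    then show ?thesis by (intro that[of m]) (simp add: mult_ac)
  qed
  \<comment> \<open>the configurations whose thickening meets the block at the origin\<close>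
  define A where "A = {S \<in> space configs. 0 < cell_count m (g S) 0}"
  have Am: "A \<in> sets configs"
  proof -
    have "(\<lambda>S. cell_count m (g S) 0) \<in> configs \<rightarrow>\<^sub>M count_space UNIV"
      by (rule measurable_compose[OF mg measurable_cell_count])
    then show ?thesis unfolding A_def by measurable
  qed
  \<comment> \<open>there are \<open>N * 2 ^ m\<close> blocks, so the expected number of wrong ones is at most \<open>\<kappa> * N / 8\<close>\<close>
  define \<theta> where "\<theta> = \<kappa> / (8 * 2 ^ m)"
  have \<theta>: "0 < \<theta>" using d by (simp add: \<theta>_def \<kappa>_def)
  have "prob_space (distr P configs X)" by (rule P.prob_space_distr[OF mX])
  from approximation_by_local_event[OF this _ Am \<theta>, of m]
  obtain n T where mn: "m \<le> n" and nT: "measure (distr P configs X) (sym_diff A (local_event n T)) < \<theta>"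
    by auto
  define C where "C = sym_diff A (local_event n T)"
  have Cm: "C \<in> sets configs" unfolding C_def using Am by auto
  have CP: "measure P {w \<in> space P. X w \<in> C} < \<theta>"
    using nT Cm by (simp add: measure_distr[OF mX] C_def vimage_def Int_def conj_commute)

  \<comment> \<open>the window must be long compared with its margin, and long enough for the Chebyshev bounds\<close>
  obtain N :: nat where N: "1 \<le> real N" "2 * real n \<le> real N" "128 * l' / d\<^sup>2 \<le> real N"
      "2 * real n * l' * 2 ^ m + 2 \<le> real N"
  proof -
    obtain N :: nat where "1 + 2 * real n + 128 * l' / d\<^sup>2 + (2 * real n * l' * 2 ^ m + 2) \<le> real N"
      using real_arch_simple by blast
    moreover have "0 \<le> 2 * real n" "0 \<le> 128 * l' / d\<^sup>2" "0 \<le> 2 * real n * l' * 2 ^ m + 2"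
      using l'0 by simp_all
    ultimately show ?thesis by (intro that[of N]) linarith+
  qed
  define W where "W = {- real n ..< real (N + n)}"
  define L where "L = real N + 2 * real n"
  have L: "real N \<le> L" "L \<le> 2 * real N" "0 < L" using N by (simp_all add: L_def)
  have W: "W \<in> sets borel" "bounded W" "measure lborel W = L"
    by (simp_all add: W_def L_def bounded_subset[OF bounded_closed_interval[of "- real n" "real (N + n)"]] subset_iff)
  define J where "J = blocks m N"
  define E where "E j = {w \<in> space P. shift (- (real_of_int j / 2 ^ m)) (X w) \<in> C}" for j
  have Em: "E j \<in> sets P" for j
  proof -
    have "(\<lambda>w. shift (- (real_of_int j / 2 ^ m)) (X w)) \<in> P \<rightarrow>\<^sub>M configs"
      by (rule measurable_compose[OF mX measurable_shift])
    from measurable_sets[OF this Cm] show ?thesis by (simp add: E_def vimage_def Int_def conj_commute)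
  qed
  have EP: "P.prob (E j) \<le> \<theta>" for j
    unfolding E_def poisson_process_stationary[OF X Cm] using CP by simp
  define R where "R x = {j \<in> J. restrict (\<lambda>i. x (i + j * 2 ^ (n - m))) (window n) \<in> T}" for x
  define blk where "blk = (\<lambda>i::int. i div 2 ^ (n - m))"
  \<comment> \<open>by equivariance, block \<open>j\<close> is predicted wrongly exactly if the shift of \<open>X\<close> that brings it to the origin is in \<open>C\<close>\<close>
  have wrong: "sym_diff (occupied (long_window n N) J blk (cell_count n (Y w))) (R (restrict (cell_count n (X w)) (long_window n N)))
      = {j \<in> J. w \<in> E j}" if w: "w \<in> space P" for w
  proof -
    have occ: "j \<in> occupied (long_window n N) J blk (cell_count n (Y w)) \<longleftrightarrow>
        shift (- (real_of_int j / 2 ^ m)) (X w) \<in> A" if j: "j \<in> J" for j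
    proof -
      have "j \<in> occupied (long_window n N) J blk (cell_count n (Y w)) \<longleftrightarrow>
          (\<exists>i\<in>{i \<in> long_window n N. blk i = j}. 0 < cell_count n (Y w) i)"
        using j by (auto simp: occupied_def)
      also have "{i \<in> long_window n N. blk i = j} = {j * 2 ^ (n - m) ..< (j + 1) * 2 ^ (n - m)}"
        using block_cells(2)[OF mn] j by (simp add: blk_def J_def)
      also have "(\<exists>i\<in>{j * 2 ^ (n - m) ..< (j + 1) * 2 ^ (n - m)}. 0 < cell_count n (Y w) i) \<longleftrightarrow> 0 < cell_count m (Y w) j"
      proof -
        have "locally_finite (Y w)" unfolding Y_def by (rule lfg[OF lfX[OF w]])
        from cell_count_refine[OF this mn, of j] show ?thesis by (simp only: sum_pos_iff_nat finite_atLeastLessThan_int)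
      qed
      also have "cell_count m (Y w) j = cell_count m (shift (- (real_of_int j / 2 ^ m)) (Y w)) 0"
        by (subst cell_count_shift) auto
      also have "shift (- (real_of_int j / 2 ^ m)) (Y w) = g (shift (- (real_of_int j / 2 ^ m)) (X w))"
        by (simp add: Y_def g_shift lfX[OF w])
      finally show ?thesis
        by (simp add: A_def space_configs locally_finite_shift lfX[OF w])
    qed
    have loc: "j \<in> R (restrict (cell_count n (X w)) (long_window n N)) \<longleftrightarrow>
        shift (- (real_of_int j / 2 ^ m)) (X w) \<in> local_event n T" if j: "j \<in> J" for j
    proof -
      have "restrict (\<lambda>i. restrict (cell_count n (X w)) (long_window n N) (i + j * 2 ^ (n - m))) (window n)
          = window_counts n (shift (- (real_of_int j / 2 ^ m)) (X w))"
        unfolding window_counts_def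
        by (rule restrict_ext) (use window_shift_subset_long_window[OF mn] j in \<open>simp add: cell_count_shift[OF mn] J_def\<close>)
      then show ?thesis
        using j by (simp add: R_def local_event_def space_configs locally_finite_shift lfX[OF w])
    qed
    have sub: "occupied (long_window n N) J blk (cell_count n (Y w)) \<subseteq> J" "R x \<subseteq> J" for x
      by (auto simp: occupied_def R_def)
    show ?thesis
    proof (rule set_eqI)
      fix j
      show "j \<in> sym_diff (occupied (long_window n N) J blk (cell_count n (Y w))) (R (restrict (cell_count n (X w)) (long_window n N)))
          \<longleftrightarrow> j \<in> {j \<in> J. w \<in> E j}"
      proof (cases "j \<in> J")
        case True
        then show ?thesis using w by (simp add: occ[OF True] loc[OF True] E_def C_def)
      next
        case False
        then show ?thesis using sub by blast
      qed
    qed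
  qed

  define a where "a = d / 2 * real N"
  define b where "b = 4 * l' * real N"
  define K where "K = \<kappa> * real N"
  define G where "G = {w \<in> space P.
      a \<le> real (card (Y w \<inter> W)) - real (card (X w \<inter> W)) \<and> real (card (Y w \<inter> W)) \<le> b \<and>
      real (card (sym_diff (occupied (long_window n N) J blk (cell_count n (Y w))) (R (restrict (cell_count n (X w)) (long_window n N))))) \<le> K}"
  have "measure P G \<le> (2 ^ m) powr (K - a) * exp (real N + l' * b + 2 * real n * l' * 2 ^ m)"
    unfolding G_def J_def W_def blk_def
    by (rule prob_reconstructible_window_le[OF Y _ mn]) (use l'0 in \<open>auto simp: Y_def g_def R_def J_def\<close>)
  also have "(2 ^ m) powr (K - a) = exp (- (\<kappa> * (real m * ln 2)) * real N)"
    by (simp add: powr_def K_def a_def \<kappa>_def ln_realpow)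
  also have "\<dots> * exp (real N + l' * b + 2 * real n * l' * 2 ^ m)
      = exp (- (\<kappa> * (real m * ln 2)) * real N + (real N + l' * b + 2 * real n * l' * 2 ^ m))"
    by (simp only: exp_add)
  also have "\<dots> \<le> exp (- 2)"
  proof -
    have "(2 + 4 * l'\<^sup>2) * real N \<le> \<kappa> * (real m * ln 2) * real N" using m by (intro mult_right_mono) auto
    moreover have "l' * b = 4 * l'\<^sup>2 * real N" by (simp add: b_def power2_eq_square)
    ultimately show ?thesis using N(4) by (simp add: algebra_simps)
  qed
  also have "exp (- 2 :: real) \<le> 1 / 3"
    using exp_ge_add_one_self[of "2::real"] by (simp add: exp_minus field_simps)
  finally have upper: "measure P G \<le> 1 / 3" .

  \<comment> \<open>the exceptional events: too many or too few points of either process, too many wrong blocks\<close>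
  define B1 where "B1 = {w \<in> space P. d / 4 * L \<le> \<bar>real (card (Y w \<inter> W)) - l' * L\<bar>}"
  define B2 where "B2 = {w \<in> space P. d / 4 * L \<le> \<bar>real (card (X w \<inter> W)) - l * L\<bar>}"
  define B3 where "B3 = {w \<in> space P. K < real (card {j \<in> J. w \<in> E j})}"
  have small: "r * L / (d / 4 * L)\<^sup>2 \<le> 1 / 8" if "0 \<le> r" "r \<le> l'" for r
  proof -
    have "128 * r \<le> 128 * l'" using that by simp
    also have "128 * l' \<le> real N * d\<^sup>2" using N(3) d by (simp add: pos_divide_le_eq)
    also have "\<dots> \<le> L * d\<^sup>2" using L by (intro mult_right_mono) auto
    finally show ?thesis using L d by (simp add: power2_eq_square field_simps)
  qed
  have dL: "0 < d / 4 * L" using d L by simp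
  have "measure P B1 \<le> l' * L / (d / 4 * L)\<^sup>2"
    using poisson_process_deviation[OF Y W(1,2) dL] l'0 by (simp add: B1_def W(3))
  then have B1: "measure P B1 \<le> 1 / 8" using small[of l'] l'0 by linarith
  have "measure P B2 \<le> l * L / (d / 4 * L)\<^sup>2"
    using poisson_process_deviation[OF X W(1,2) dL] l by (simp add: B2_def W(3))
  then have B2: "measure P B2 \<le> 1 / 8" using small[of l] l ll' by linarith
  have K0: "0 < K" using d N by (simp add: K_def \<kappa>_def)
  have B3: "measure P B3 \<le> 1 / 8"
  proof -
    have "measure P B3 \<le> (\<Sum>j\<in>J. P.prob (E j)) / K"
      unfolding B3_def by (rule P.prob_card_gt_le) (use Em K0 in \<open>auto simp: J_def\<close>)
    also have "\<dots> \<le> (\<Sum>j\<in>J. \<theta>) / K" using K0 EP by (intro divide_right_mono sum_mono) auto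
    also have "(\<Sum>j\<in>J. \<theta>) = real N * 2 ^ m * \<theta>" by (simp add: J_def card_blocks)
    also have "real N * 2 ^ m * \<theta> / K = 1 / 8"
      using d N(1) by (simp add: K_def \<theta>_def \<kappa>_def)
    finally show ?thesis .
  qed
  have mcY: "(\<lambda>w. card (Y w \<inter> W)) \<in> P \<rightarrow>\<^sub>M count_space UNIV"
    by (rule measurable_compose[OF mY measurable_card_Int[OF W(1,2)]])
  have mcX: "(\<lambda>w. card (X w \<inter> W)) \<in> P \<rightarrow>\<^sub>M count_space UNIV"
    by (rule measurable_compose[OF mX measurable_card_Int[OF W(1,2)]])
  have B1m: "B1 \<in> sets P" unfolding B1_def using mcY by measurable
  have B2m: "B2 \<in> sets P" unfolding B2_def using mcX by measurable
  have B3m: "B3 \<in> sets P"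
  proof -
    have "(\<lambda>w. \<Sum>j\<in>J. indicator (E j) w :: real) \<in> borel_measurable P"
      using Em by (intro borel_measurable_sum borel_measurable_indicator)
    moreover have "real (card {j\<in>J. w \<in> E j}) = (\<Sum>j\<in>J. indicator (E j) w)" for w
      by (simp add: indicator_def sum.If_cases Int_def J_def)
    ultimately show ?thesis unfolding B3_def by simp
  qed
  have Gm: "G = {w \<in> space P. a \<le> real (card (Y w \<inter> W)) - real (card (X w \<inter> W)) \<and> real (card (Y w \<inter> W)) \<le> b} - B3"
    unfolding G_def B3_def using wrong by auto
  have GM: "G \<in> sets P" unfolding Gm using mcX mcY B3m by measurable
  have "space P \<subseteq> G \<union> (B1 \<union> (B2 \<union> B3))"
  proof
    fix w assume w: "w \<in> space P"
    show "w \<in> G \<union> (B1 \<union> (B2 \<union> B3))"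
    proof (rule ccontr)
      assume "\<not> ?thesis"
      then have nG: "w \<notin> G" and "w \<notin> B1" "w \<notin> B2" and nB3: "w \<notin> B3" by auto
      then have y: "\<bar>real (card (Y w \<inter> W)) - l' * L\<bar> < d / 4 * L"
        and x: "\<bar>real (card (X w \<inter> W)) - l * L\<bar> < d / 4 * L"
        using w by (auto simp: B1_def B2_def not_le)
      have "l' * L - l * L = d * L" by (simp add: d_def left_diff_distrib)
      then have "d / 2 * L \<le> real (card (Y w \<inter> W)) - real (card (X w \<inter> W))"
        using x y by linarith
      moreover have "a \<le> d / 2 * L" using L d by (simp add: a_def)
      moreover have "real (card (Y w \<inter> W)) \<le> b"
      proof -
        have "d / 4 * L \<le> l' * L" using L l l'0 by (intro mult_right_mono) (auto simp: d_def)
        then have "real (card (Y w \<inter> W)) \<le> 2 * l' * L" using y by linarith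
        also have "\<dots> \<le> 2 * l' * (2 * real N)" using L l'0 by (intro mult_left_mono) auto
        finally show ?thesis by (simp add: b_def)
      qed
      ultimately show False using nG nB3 w unfolding Gm by auto
    qed
  qed
  then have "1 \<le> measure P (G \<union> (B1 \<union> (B2 \<union> B3)))"
    using P.finite_measure_mono[of "space P" "G \<union> (B1 \<union> (B2 \<union> B3))"] GM B1m B2m B3m
    by (simp add: P.prob_space)
  also have "\<dots> \<le> measure P G + measure P (B1 \<union> (B2 \<union> B3))" using GM B1m B2m B3m by (intro measure_Un_le) auto
  also have "measure P (B1 \<union> (B2 \<union> B3)) \<le> measure P B1 + measure P (B2 \<union> B3)"
    using B1m B2m B3m by (intro measure_Un_le) auto
  also have "measure P (B2 \<union> B3) \<le> measure P B2 + measure P B3" using B2m B3m by (intro measure_Un_le) auto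
  finally show False using upper B1 B2 B3 by linarith
qed

theorem theorem1p1:
  fixes l l' :: real
  assumes "0 < l" and "l < l'"
  shows "\<not> (\<exists>f. thickening l l' f \<and> equivariant f)"
  using no_equivariant_thickening_of_poisson_process[OF assms _ _ poisson_process_poisson_points[OF assms(1)]]
  by blast

end
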